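(* Let $X\subset\mathbb{C}^n$ be an irreducible affine cone defined by polynomials with real coefficients, let $Y=X^*\subset\mathbb{C}^n$ be its dual variety, and let $u\in\mathbb{C}^n$ be a general data point. Then the map $x\mapsto u-x$ gives a bijection from the critical points of $d_u$ on $X$ to the critical points of $d_u$ on $Y$. Consequently, $\mathrm{EDdegree}(X)=\mathrm{EDdegree}(Y)$. Moreover, if $u$ is real, then the map sends real critical points to real critical points, and hence $\mathrm{aEDdegree}(X,\omega)=\mathrm{aEDdegree}(Y,\omega)$ for any volume form $\omega$ on $\mathbb{R}^n$ whose density satisfies $\int_{\mathbb{R}^n}|\omega|=1$. The map is proximity-reversing: for real $u$, if $x,x'$ are real critical points of $d_u$ on $X$ and $x$ is closer to $u$ than $x'$, then $u-x$ is further from $u$ than $u-x'$.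
   Context: On $\mathbb{C}^n$ use the symmetric bilinear form $x\cdot y=\sum_i x_iy_i$ (no complex conjugation); $\perp$ refers to it. An affine cone is a variety $X\subset\mathbb{C}^n$ with $\lambda x\in X$ for all $x\in X,\lambda\in\mathbb{C}$. Write $X_{\rm sing}$ for the singular locus. The dual variety is $$X^*=\overline{\{y\in\mathbb{C}^n \mid \exists\, x\in X\setminus X_{\rm sing}:\ y\perp T_xX\}}.$$ For $u\in\mathbb{C}^n$, a critical point of $d_u(x)=\sum_i(u_i-x_i)^2$ on a variety $X$ is a point $x\in X\setminus X_{\rm sing}$ with $u-x\perp T_xX$; it is real if its coordinates are real. "General" means: in some nonempty Zariski open subset of $\mathbb{C}^n$. For general $u$ the number of critical points is finite and constant; this number is $\mathrm{EDdegree}(X)$. The average ED degree is $$\mathrm{aEDdegree}(X,\omega)=\int_{\mathbb{R}^n}\#\{\text{real critical points of } d_u \text{ on } X\}\cdot|\omega|,$$ the integral being over $u\in\mathbb{R}^n$. Distances between real points are Euclidean. *)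

theory Defs
  imports "HOL-Analysis.Analysis"
begin

text \<open>
  Affine space is \<open>complex ^ 'n\<close>. As \<open>\<complex>\<close> is infinite, polynomials in \<open>CARD('n)\<close> variables are
  identified with the functions they define; for a subring \<open>K\<close> of \<open>\<complex>\<close>, \<open>polys K\<close> is the
  polynomial ring with coefficients in \<open>K\<close>.
\<close>

inductive_set polys :: "complex set \<Rightarrow> (complex ^ 'n::finite \<Rightarrow> complex) set"
  for K :: "complex set" where
  const: "c \<in> K \<Longrightarrow> (\<lambda>x. c) \<in> polys K"
| coord: "(\<lambda>x. x $ i) \<in> polys K"
| add: "f \<in> polys K \<Longrightarrow> g \<in> polys K \<Longrightarrow> (\<lambda>x. f x + g x) \<in> polys K"
| mult: "f \<in> polys K \<Longrightarrow> g \<in> polys K \<Longrightarrow> (\<lambda>x. f x * g x) \<in> polys K"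

definition zeros :: "(complex ^ 'n::finite \<Rightarrow> complex) set \<Rightarrow> (complex ^ 'n) set" where
  "zeros F = {x. \<forall>f\<in>F. f x = 0}"

definition vanishing_ideal :: "(complex ^ 'n::finite) set \<Rightarrow> (complex ^ 'n \<Rightarrow> complex) set" where
  "vanishing_ideal S = {f \<in> polys UNIV. \<forall>x\<in>S. f x = 0}"

definition zariski_closed :: "(complex ^ 'n::finite) set \<Rightarrow> bool" where
  "zariski_closed S \<longleftrightarrow> (\<exists>F \<subseteq> polys UNIV. S = zeros F)"

definition zariski_open :: "(complex ^ 'n::finite) set \<Rightarrow> bool" where
  "zariski_open U \<longleftrightarrow> zariski_closed (- U)"

definition zariski_closure :: "(complex ^ 'n::finite) set \<Rightarrow> (complex ^ 'n) set" where
  "zariski_closure S = zeros (vanishing_ideal S)"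

definition irreducible_variety :: "(complex ^ 'n::finite) set \<Rightarrow> bool" where
  "irreducible_variety X \<longleftrightarrow> zariski_closed X \<and> X \<noteq> {} \<and>
     (\<forall>A B. zariski_closed A \<longrightarrow> zariski_closed B \<longrightarrow> X = A \<union> B \<longrightarrow> X = A \<or> X = B)"

definition defined_over_reals :: "(complex ^ 'n::finite) set \<Rightarrow> bool" where
  "defined_over_reals X \<longleftrightarrow> (\<exists>F \<subseteq> polys \<real>. X = zeros F)"

definition affine_cone :: "(complex ^ 'n::finite) set \<Rightarrow> bool" where
  "affine_cone X \<longleftrightarrow> zariski_closed X \<and> (\<forall>x\<in>X. \<forall>c. c *s x \<in> X)"

text \<open>
  Krull dimension: the supremum of the lengths \<open>d\<close> of chains of irreducible closed subsets of \<open>X\<close>.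
  The set is bounded by \<open>CARD('n)\<close> and, for \<open>X \<noteq> {}\<close>, nonempty, so the supremum in \<open>nat\<close> is a maximum.
\<close>

definition variety_dim :: "(complex ^ 'n::finite) set \<Rightarrow> nat" where
  "variety_dim X = Sup {d. \<exists>Z :: nat \<Rightarrow> (complex ^ 'n) set.
      (\<forall>i\<le>d. irreducible_variety (Z i) \<and> Z i \<subseteq> X) \<and> (\<forall>i<d. Z i \<subset> Z (Suc i))}"

definition bform :: "complex ^ 'n::finite \<Rightarrow> complex ^ 'n \<Rightarrow> complex" where
  "bform x y = (\<Sum>i\<in>UNIV. x $ i * y $ i)"

definition perp :: "complex ^ 'n::finite \<Rightarrow> (complex ^ 'n) set \<Rightarrow> bool" where
  "perp y V \<longleftrightarrow> (\<forall>v\<in>V. bform y v = 0)"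

definition gradient :: "(complex ^ 'n::finite \<Rightarrow> complex) \<Rightarrow> complex ^ 'n \<Rightarrow> complex ^ 'n" where
  "gradient f x = (\<chi> i. deriv (\<lambda>t. f (x + axis i t)) 0)"

definition tangent_space :: "(complex ^ 'n::finite) set \<Rightarrow> complex ^ 'n \<Rightarrow> (complex ^ 'n) set" where
  "tangent_space X x = {v. \<forall>f\<in>vanishing_ideal X. bform (gradient f x) v = 0}"

text \<open>
  For irreducible \<open>X\<close>: the points where the Jacobian matrix of generators of the ideal of \<open>X\<close> has rank
  less than the codimension of \<open>X\<close>. At a point of \<open>X\<close> the gradients of all elements of the ideal
  span the row space of that matrix, so no choice of generators is needed.
\<close>

definition singular_locus :: "(complex ^ 'n::finite) set \<Rightarrow> (complex ^ 'n) set" where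
  "singular_locus X =
     {x\<in>X. vec.dim ((\<lambda>f. gradient f x) ` vanishing_ideal X) < CARD('n) - variety_dim X}"

definition dual_variety :: "(complex ^ 'n::finite) set \<Rightarrow> (complex ^ 'n) set" where
  "dual_variety X = zariski_closure {y. \<exists>x \<in> X - singular_locus X. perp y (tangent_space X x)}"

definition critical_points :: "(complex ^ 'n::finite) set \<Rightarrow> complex ^ 'n \<Rightarrow> (complex ^ 'n) set" where
  "critical_points X u = {x \<in> X - singular_locus X. perp (u - x) (tangent_space X x)}"

definition real_point :: "complex ^ 'n::finite \<Rightarrow> bool" where
  "real_point x \<longleftrightarrow> (\<forall>i. x $ i \<in> \<real>)"

definition real_critical_points ::
    "(complex ^ 'n::finite) set \<Rightarrow> complex ^ 'n \<Rightarrow> (complex ^ 'n) set" where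
  "real_critical_points X u = {x \<in> critical_points X u. real_point x}"

definition for_general :: "(complex ^ 'n::finite \<Rightarrow> bool) \<Rightarrow> bool" where
  "for_general P \<longleftrightarrow> (\<exists>U. zariski_open U \<and> U \<noteq> {} \<and> (\<forall>u\<in>U. P u))"

definition EDdegree :: "(complex ^ 'n::finite) set \<Rightarrow> nat" where
  "EDdegree X =
     (THE N. for_general (\<lambda>u. finite (critical_points X u) \<and> card (critical_points X u) = N))"

definition complexify :: "real ^ 'n::finite \<Rightarrow> complex ^ 'n" where
  "complexify u = (\<chi> i. complex_of_real (u $ i))"

text \<open>
  The volume form \<open>\<omega> = w du\<^sub>1 \<and> \<dots> \<and> du\<^sub>n\<close> on \<open>\<real>\<^sup>n\<close> is represented by its coefficient function \<open>w\<close>;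
  its density \<open>|\<omega>|\<close> is \<open>|w|\<close> times Lebesgue measure. Points are counted by the
  counting measure, so an infinite set counts as \<open>\<infinity>\<close> rather than 0.
\<close>

definition aEDdegree :: "(complex ^ 'n::finite) set \<Rightarrow> (real ^ 'n \<Rightarrow> real) \<Rightarrow> ennreal" where
  "aEDdegree X w =
     (\<integral>\<^sup>+ u. emeasure (count_space UNIV) (real_critical_points X (complexify u)) * ennreal \<bar>w u\<bar> \<partial>lborel)"

end

theory Submission
  imports Defs "HOL-Computational_Algebra.Fundamental_Theorem_Algebra"
begin

text \<open>
  A critical point \<open>x\<close> of the distance from \<open>u\<close> on \<open>X\<close> is the same as a pair \<open>(x, y)\<close> with \<open>x + y = u\<close>, where
  \<open>x\<close> is a nonsingular point of \<open>X\<close> and \<open>y \<bottom> T\<^sub>x X\<close>. These pairs form the conormal variety of \<open>X\<close>, which is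
  irreducible of dimension \<open>n\<close> (\<open>conormal_prime\<close>, \<open>conormal_growth\<close>, \<open>conormal_independent\<close>). For a cone, swapping
  \<open>x\<close> and \<open>y\<close> gives the conormal variety of the dual \<open>Y\<close>, up to closure (\<open>biduality\<close>). So the critical
  points on \<open>X\<close> and on \<open>Y\<close> are read off from the same pairs, except for the pairs that lie over special
  points of \<open>X\<close> or \<open>Y\<close>. The exceptional pairs are contained in a proper closed subset, of dimension less
  than \<open>n\<close>, and their sums \<open>x + y\<close> satisfy a nontrivial polynomial equation (\<open>general_sum_avoids\<close>). For \<open>u\<close>
  outside this hypersurface \<open>x \<mapsto> u - x\<close> is a bijection of critical points.

  Biduality holds because of the two relations \<open>y \<cdot> dx = 0\<close> and \<open>x \<cdot> y = 0\<close> on the conormal variety, the second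
  from Euler's relation; together they give \<open>x \<cdot> dy = 0\<close>. Differentials are handled by polynomial vector
  fields: a field tangent to a projection of a variety lifts to the variety after multiplication by a
  polynomial (\<open>tangent_field_extend\<close>), which is the generic smoothness of projections in characteristic 0.
  At general points the tangent space has a basis of such fields (\<open>tangent_frame\<close>).

  Dimension is the maximal number of algebraically independent coordinates. Its upper bounds come from
  counting polynomials of bounded degree (\<open>hilbert_bound\<close>, \<open>algebraic_relation\<close>). To know that the singular locus,
  which is defined through the Krull dimension, omits the general points, chains of irreducible
  subsets of that length are needed (\<open>prime_chain\<close>); they and the Nullstellensatz are obtained from the
  fact that \<open>\<complex>\<close> is uncountable while the polynomial ring has countable dimension.

  The equality of the generic numbers of critical points is formal. For real data the bijection
  respects real points, a hypersurface has measure zero (\<open>AE_polynomial_nonzero\<close>), and the reversal of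
  proximity is the theorem of Pythagoras (\<open>critical_pythagoras\<close>).
\<close>

section \<open>Polynomials in a set of coordinates\<close>

text \<open>
  The ring \<open>\<complex>[x\<^sub>i | i \<in> K]\<close> as a ring of functions, filtered by total degree. The filtration is
  what dimension counts below are made of; the restriction to \<open>K\<close> allows elimination of one
  coordinate at a time.
\<close>

inductive poly_deg_le ::
    "'n::finite set \<Rightarrow> nat \<Rightarrow> (complex ^ 'n \<Rightarrow> complex) \<Rightarrow> bool" for K where
  const: "poly_deg_le K M (\<lambda>x. c)"
| coord: "i \<in> K \<Longrightarrow> 1 \<le> M \<Longrightarrow> poly_deg_le K M (\<lambda>x. x $ i)"
| add: "poly_deg_le K M f \<Longrightarrow> poly_deg_le K M g \<Longrightarrow> poly_deg_le K M (\<lambda>x. f x + g x)"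
| mult: "poly_deg_le K a f \<Longrightarrow> poly_deg_le K b g \<Longrightarrow> a + b \<le> M \<Longrightarrow> poly_deg_le K M (\<lambda>x. f x * g x)"

definition polys_on :: "'n::finite set \<Rightarrow> (complex ^ 'n \<Rightarrow> complex) set" where
  "polys_on K = {f. \<exists>M. poly_deg_le K M f}"

lemma poly_deg_le_mono:
  assumes "poly_deg_le K M f" "K \<subseteq> L" "M \<le> M'"
  shows "poly_deg_le L M' f"
  using assms
proof (induction arbitrary: M' rule: poly_deg_le.induct)
  case (mult a f b g M)
  then show ?case
    by (intro poly_deg_le.mult[of L a f b g]) auto
qed (auto intro: poly_deg_le.intros)

lemma polys_on_mono: "f \<in> polys_on K \<Longrightarrow> K \<subseteq> L \<Longrightarrow> f \<in> polys_on L"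
  by (auto simp: polys_on_def intro: poly_deg_le_mono)

lemma polys_on_const [simp, intro]: "(\<lambda>x. c) \<in> polys_on K"
  by (auto simp: polys_on_def intro: poly_deg_le.const)

lemma polys_on_coord [simp, intro]: "i \<in> K \<Longrightarrow> (\<lambda>x. x $ i) \<in> polys_on K"
  by (auto simp: polys_on_def intro!: exI[of _ 1] poly_deg_le.coord)

lemma polys_on_add [intro]:
  assumes "f \<in> polys_on K" "g \<in> polys_on K"
  shows "(\<lambda>x. f x + g x) \<in> polys_on K"
proof -
  obtain a b where "poly_deg_le K a f" "poly_deg_le K b g"
    using assms by (auto simp: polys_on_def)
  then have "poly_deg_le K (max a b) f" "poly_deg_le K (max a b) g"
    by (auto intro: poly_deg_le_mono)
  then show ?thesis
    by (auto simp: polys_on_def intro: poly_deg_le.add)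
qed

lemma polys_on_mult [intro]:
  "f \<in> polys_on K \<Longrightarrow> g \<in> polys_on K \<Longrightarrow> (\<lambda>x. f x * g x) \<in> polys_on K"
  by (auto simp: polys_on_def intro: poly_deg_le.mult)

lemma polys_on_induct [consumes 1, case_names const coord add mult]:
  assumes "f \<in> polys_on K"
    and "\<And>c. P (\<lambda>x. c)"
    and "\<And>i. i \<in> K \<Longrightarrow> P (\<lambda>x. x $ i)"
    and "\<And>f g. f \<in> polys_on K \<Longrightarrow> g \<in> polys_on K \<Longrightarrow> P f \<Longrightarrow> P g \<Longrightarrow> P (\<lambda>x. f x + g x)"
    and "\<And>f g. f \<in> polys_on K \<Longrightarrow> g \<in> polys_on K \<Longrightarrow> P f \<Longrightarrow> P g \<Longrightarrow> P (\<lambda>x. f x * g x)"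
  shows "P f"
proof -
  obtain M where "poly_deg_le K M f"
    using assms(1) by (auto simp: polys_on_def)
  then show ?thesis
  proof (induction rule: poly_deg_le.induct)
    case (add M f g)
    then show ?case by (auto simp: polys_on_def intro!: assms(4))
  next
    case (mult a f b g M)
    then show ?case by (auto simp: polys_on_def intro!: assms(5))
  qed (auto intro: assms(2,3))
qed

lemma polys_UNIV: "(polys UNIV :: (complex ^ 'n::finite \<Rightarrow> complex) set) = polys_on UNIV"
    (is "?P = ?Q")
proof
  show "?P \<subseteq> ?Q"
  proof
    fix f :: "complex ^ 'n \<Rightarrow> complex"
    assume "f \<in> polys UNIV"
    then show "f \<in> polys_on UNIV"
      by induction auto
  qed
  show "?Q \<subseteq> ?P"
  proof
    fix f :: "complex ^ 'n \<Rightarrow> complex"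
    assume "f \<in> polys_on UNIV"
    then show "f \<in> polys UNIV"
      by (induction rule: polys_on_induct) (auto intro: polys.intros)
  qed
qed

lemma polys_on_cmult [intro]: "f \<in> polys_on K \<Longrightarrow> (\<lambda>x. c * f x) \<in> polys_on K"
  by (rule polys_on_mult) auto

lemma polys_on_uminus [intro]: "f \<in> polys_on K \<Longrightarrow> (\<lambda>x. - f x) \<in> polys_on K"
  using polys_on_cmult[of f K "-1"] by simp

lemma polys_on_diff [intro]:
  "f \<in> polys_on K \<Longrightarrow> g \<in> polys_on K \<Longrightarrow> (\<lambda>x. f x - g x) \<in> polys_on K"
  using polys_on_add[of f K "\<lambda>x. - g x"] by (auto intro: polys_on_uminus)

lemma polys_on_power [intro]: "f \<in> polys_on K \<Longrightarrow> (\<lambda>x. f x ^ k) \<in> polys_on K"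
  by (induction k) auto

lemma polys_on_sum [intro]:
  "(\<And>a. a \<in> A \<Longrightarrow> f a \<in> polys_on K) \<Longrightarrow> (\<lambda>x. \<Sum>a\<in>A. f a x) \<in> polys_on K"
  by (induction A rule: infinite_finite_induct) auto

lemma polys_on_prod [intro]:
  "(\<And>a. a \<in> A \<Longrightarrow> f a \<in> polys_on K) \<Longrightarrow> (\<lambda>x. \<Prod>a\<in>A. f a x) \<in> polys_on K"
  by (induction A rule: infinite_finite_induct) auto

lemma poly_deg_le_sum:
  "(\<And>a. a \<in> A \<Longrightarrow> poly_deg_le K M (f a)) \<Longrightarrow> poly_deg_le K M (\<lambda>x. \<Sum>a\<in>A. f a x)"
  by (induction A rule: infinite_finite_induct) (auto intro: poly_deg_le.intros)

lemma poly_deg_le_prod: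
  "finite A \<Longrightarrow> (\<And>a. a \<in> A \<Longrightarrow> poly_deg_le K M (f a)) \<Longrightarrow>
   poly_deg_le K (card A * M) (\<lambda>x. \<Prod>a\<in>A. f a x)"
  by (induction A rule: finite_induct) (auto intro: poly_deg_le.const poly_deg_le.mult[OF _ _ order_refl])

lemma poly_deg_le_power: "poly_deg_le K M f \<Longrightarrow> poly_deg_le K (k * M) (\<lambda>x. f x ^ k)"
  by (induction k) (auto intro: poly_deg_le.const poly_deg_le.mult[OF _ _ order_refl])

lemma polys_on_compose:
  assumes "f \<in> polys_on K" and "\<And>i. i \<in> K \<Longrightarrow> (\<lambda>z. h z $ i) \<in> polys_on L"
  shows "(\<lambda>z. f (h z)) \<in> polys_on L"
  using assms by (induction rule: polys_on_induct) auto

lemma poly_deg_le_compose: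
  assumes "poly_deg_le K M f" and "\<And>i. i \<in> K \<Longrightarrow> poly_deg_le L \<delta> (\<lambda>z. h z $ i)"
  shows "poly_deg_le L (M * \<delta>) (\<lambda>z. f (h z))"
  using assms
proof (induction rule: poly_deg_le.induct)
  case (coord i M)
  then have "poly_deg_le L \<delta> (\<lambda>z. h z $ i)" "\<delta> \<le> M * \<delta>"
    by auto
  then show ?case
    by (blast intro: poly_deg_le_mono)
next
  case (mult a f b g M)
  then show ?case
    by (intro poly_deg_le.mult[of L "a * \<delta>" _ "b * \<delta>"]) (auto simp flip: add_mult_distrib)
qed (auto intro: poly_deg_le.intros)

lemma polys_on_cong:
  assumes "f \<in> polys_on K" "\<And>i. i \<in> K \<Longrightarrow> x $ i = y $ i"
  shows "f x = f y"
  using assms by (induction rule: polys_on_induct) auto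

text \<open>
  Coefficients beyond the degree are required to vanish because the product of two expansions is
  their Cauchy product, which is only correct for coefficients extended by zero.
\<close>

lemma poly_deg_le_insert_expand:
  fixes f :: "complex ^ 'n::finite \<Rightarrow> complex"
  assumes "poly_deg_le (insert j K) M f"
  shows "\<exists>c. (\<forall>i. poly_deg_le K M (c i)) \<and> (\<forall>i>M. c i = (\<lambda>x. 0)) \<and>
             (\<forall>x. f x = (\<Sum>i\<le>M. c i x * x $ j ^ i))"
  using assms
proof (induction rule: poly_deg_le.induct)
  case (const M c)
  show ?case
    by (rule exI[of _ "\<lambda>i x. if i = 0 then c else 0"])
      (auto simp: if_distrib[of "\<lambda>z. z * _"] cong: if_cong intro: poly_deg_le.const)
next
  case (coord k M)
  show ?case
  proof (cases "k = j")
    case True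
    have "x $ j = (\<Sum>i\<le>M. if i = 1 then x $ j ^ i else 0)" for x :: "complex ^ 'n"
      using coord by simp
    then show ?thesis
      using True coord
      by (intro exI[of _ "\<lambda>i x. if i = 1 then 1 else 0"])
        (auto simp: if_distrib[of "\<lambda>z. z * _"] cong: if_cong intro: poly_deg_le.const)
  next
    case False
    then have "poly_deg_le K M (\<lambda>x. if i = 0 then x $ k else 0)" for i :: nat
      using coord by (cases "i = 0") (auto intro: poly_deg_le.intros)
    then show ?thesis
      by (intro exI[of _ "\<lambda>i x. if i = 0 then x $ k else 0"])
        (auto simp: if_distrib[of "\<lambda>z. z * _"] cong: if_cong)
  qed
next
  case (add M f g)
  obtain c where
    c: "\<And>i. poly_deg_le K M (c i)" "\<And>i. i > M \<Longrightarrow> c i = (\<lambda>x. 0)"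
      "\<And>x. f x = (\<Sum>i\<le>M. c i x * x $ j ^ i)"
    using add.IH(1) by (elim exE conjE) blast
  obtain d where
    d: "\<And>i. poly_deg_le K M (d i)" "\<And>i. i > M \<Longrightarrow> d i = (\<lambda>x. 0)"
      "\<And>x. g x = (\<Sum>i\<le>M. d i x * x $ j ^ i)"
    using add.IH(2) by (elim exE conjE) blast
  have "f x + g x = (\<Sum>i\<le>M. (c i x + d i x) * x $ j ^ i)" for x
    unfolding c(3) d(3) by (simp add: distrib_right sum.distrib)
  then show ?case
    using c(1,2) d(1,2) by (intro exI[of _ "\<lambda>i x. c i x + d i x"])
      (simp add: poly_deg_le.add)
next
  case (mult a f b g M)
  obtain c where
    c: "\<And>i. poly_deg_le K a (c i)" "\<And>i. i > a \<Longrightarrow> c i = (\<lambda>x. 0)"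
      "\<And>x. f x = (\<Sum>i\<le>a. c i x * x $ j ^ i)"
    using mult.IH(1) by (elim exE conjE) blast
  obtain d where
    d: "\<And>i. poly_deg_le K b (d i)" "\<And>i. i > b \<Longrightarrow> d i = (\<lambda>x. 0)"
      "\<And>x. g x = (\<Sum>i\<le>b. d i x * x $ j ^ i)"
    using mult.IH(2) by (elim exE conjE) blast
  define e where "e = (\<lambda>r x. \<Sum>k\<le>r. c k x * d (r - k) x)"
  have z: "e r x = 0" if "r > a + b" for r x
    unfolding e_def
  proof (intro sum.neutral ballI)
    fix k assume "k \<in> {..r}"
    then have "k > a \<or> r - k > b"
      using that by auto
    then show "c k x * d (r - k) x = 0"
      using c(2) d(2) by auto
  qed
  have "poly_deg_le K M (e r)" for r
    unfolding e_def using c(1) d(1) mult.hyps by (auto intro!: poly_deg_le_sum poly_deg_le.mult)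
  moreover have "f x * g x = (\<Sum>r\<le>M. e r x * x $ j ^ r)" for x
  proof -
    have "f x * g x = (\<Sum>r\<le>a + b. e r x * x $ j ^ r)"
      unfolding c(3) d(3) e_def
      by (rule polynomial_product) (auto simp: c(2) d(2))
    also have "\<dots> = (\<Sum>r\<le>M. e r x * x $ j ^ r)"
      using mult.hyps z by (intro sum.mono_neutral_left) auto
    finally show ?thesis .
  qed
  moreover have "e i = (\<lambda>x. 0)" if "i > M" for i
    using z[of i] mult.hyps that by (intro ext) auto
  ultimately show ?case
    by (intro exI[of _ e] conjI allI impI)
qed

lemma polys_on_insert_expand:
  assumes "f \<in> polys_on (insert j K)"
  shows "\<exists>M c. (\<forall>i. c i \<in> polys_on K) \<and> (\<forall>x. f x = (\<Sum>i\<le>M. c i x * x $ j ^ i))"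
proof -
  obtain M where "poly_deg_le (insert j K) M f"
    using assms by (auto simp: polys_on_def)
  from poly_deg_le_insert_expand[OF this] show ?thesis
    unfolding polys_on_def by (elim exE conjE) blast
qed

section \<open>Restriction to lines\<close>

lemma poly_on_line:
  assumes "f \<in> polys_on K"
  shows "\<exists>q. \<forall>t. f (a + t *s b) = poly q t"
  using assms
proof (induction rule: polys_on_induct)
  case (const c)
  show ?case by (rule exI[of _ "[:c:]"]) auto
next
  case (coord i)
  show ?case by (rule exI[of _ "[:a $ i, b $ i:]"]) auto
next
  case (add f g)
  then show ?case by (metis poly_add)
next
  case (mult f g)
  then show ?case by (metis poly_mult)
qed

text \<open>
  Two univariate polynomials that are not identically zero have only finitely many zeros together.
  This is where the irreducibility of affine space, and of the fibres of the conormal variety, comes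
  from.
\<close>

lemma common_nonzero_on_line:
  assumes "f \<in> polys_on K" "g \<in> polys_on L" "f (a + t0 *s b) \<noteq> 0" "g (a + t1 *s b) \<noteq> 0"
  shows "\<exists>t. f (a + t *s b) \<noteq> 0 \<and> g (a + t *s b) \<noteq> 0"
proof -
  obtain p q where p: "\<And>t. f (a + t *s b) = poly p t" and q: "\<And>t. g (a + t *s b) = poly q t"
    using poly_on_line assms(1,2) by metis
  then have "p \<noteq> 0" "q \<noteq> 0"
    using assms(3,4) by auto
  then have "finite {t. poly (p * q) t = 0}"
    by (intro poly_roots_finite) auto
  then obtain t where "t \<notin> {t. poly (p * q) t = 0}"
    using ex_new_if_finite infinite_UNIV_char_0 by blast
  then show ?thesis
    using p q by auto
qed

lemma polys_no_zero_divisors: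
  assumes "f \<in> polys_on K" "g \<in> polys_on L" "f a \<noteq> 0" "g b \<noteq> 0"
  shows "\<exists>x. f x \<noteq> 0 \<and> g x \<noteq> 0"
  using common_nonzero_on_line[OF assms(1,2), of a 0 "b - a" 1] assms(3,4) by auto

section \<open>Gradients\<close>

lemma has_field_derivative_line:
  assumes "f \<in> polys_on K"
  shows "((\<lambda>t. f (a + t *s b)) has_field_derivative deriv (\<lambda>t. f (a + t *s b)) s) (at s)"
proof -
  obtain q where "\<And>t. f (a + t *s b) = poly q t"
    using poly_on_line[OF assms] by metis
  then have "(\<lambda>t. f (a + t *s b)) = poly q"
    by auto
  then show ?thesis
    by (metis DERIV_imp_deriv poly_DERIV)
qed

lemma axis_eq: "axis i t = t *s (axis i 1 :: 'a::comm_ring_1 ^ 'n)"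
  by (vector axis_def) 

lemma gradient_eq: "gradient f x $ i = deriv (\<lambda>t. f (x + t *s axis i 1)) 0"
  unfolding gradient_def by (simp add: axis_eq[symmetric])

lemma gradient_const [simp]: "gradient (\<lambda>x. c) x = 0"
  by (simp add: vec_eq_iff gradient_eq)

lemma gradient_coord: "gradient (\<lambda>x. x $ i) x = axis i 1"
proof -
  have "deriv (\<lambda>t. x $ i + t * c) 0 = c" for c :: complex
    by (rule DERIV_imp_deriv) (auto intro!: derivative_eq_intros)
  then show ?thesis
    by (auto simp: vec_eq_iff gradient_eq axis_def)
qed

lemma gradient_add:
  assumes "f \<in> polys_on K" "g \<in> polys_on L"
  shows "gradient (\<lambda>x. f x + g x) x = gradient f x + gradient g x"
  using assms
  by (auto simp: vec_eq_iff gradient_eq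
      intro!: DERIV_imp_deriv DERIV_add has_field_derivative_line)

lemma gradient_mult:
  assumes "f \<in> polys_on K" "g \<in> polys_on L"
  shows "gradient (\<lambda>x. f x * g x) x = g x *s gradient f x + f x *s gradient g x"
proof -
  have "deriv (\<lambda>t. f (x + t *s b) * g (x + t *s b)) 0 =
        g x * deriv (\<lambda>t. f (x + t *s b)) 0 + f x * deriv (\<lambda>t. g (x + t *s b)) 0" for b
    using DERIV_mult[OF has_field_derivative_line[OF assms(1), of x b 0]
        has_field_derivative_line[OF assms(2), of x b 0]]
    by (intro DERIV_imp_deriv) (simp add: algebra_simps)
  then show ?thesis
    by (auto simp: vec_eq_iff gradient_eq)
qed

lemma bform_add_left: "bform (a + b) v = bform a v + bform b v"
  by (simp add: bform_def sum.distrib distrib_right)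

lemma bform_add_right: "bform v (a + b) = bform v a + bform v b"
  by (simp add: bform_def sum.distrib distrib_left)

lemma bform_diff_left: "bform (a - b) v = bform a v - bform b v"
  by (simp add: bform_def sum_subtractf left_diff_distrib)

lemma bform_scale_left: "bform (c *s a) v = c * bform a v"
  by (simp add: bform_def sum_distrib_left mult.assoc)

lemma bform_scale_right: "bform v (c *s a) = c * bform v a"
  by (simp add: bform_def sum_distrib_left mult_ac)

lemma bform_zero [simp]: "bform 0 v = 0" "bform v 0 = 0"
  by (simp_all add: bform_def)

lemma bform_commute: "bform x y = bform y x"
  by (simp add: bform_def mult.commute)

lemma bform_axis [simp]: "bform (axis i c) v = c * v $ i" "bform v (axis i c) = c * v $ i"
  by (simp_all add: bform_def axis_def if_distrib[of "\<lambda>z. z * _"] if_distrib[of "\<lambda>z. _ * z"] mult.commute cong: if_cong)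

lemma bform_sum_right: "bform v (\<Sum>a\<in>A. f a) = (\<Sum>a\<in>A. bform v (f a))"
  by (induction A rule: infinite_finite_induct) (auto simp: bform_add_right)

lemmas bform_linear = bform_add_left bform_add_right bform_scale_left bform_scale_right

lemma gradient_sum:
  assumes "\<And>a. a \<in> A \<Longrightarrow> f a \<in> polys_on K"
  shows "gradient (\<lambda>x. \<Sum>a\<in>A. f a x) x = (\<Sum>a\<in>A. gradient (f a) x)"
  using assms
proof (induction A rule: infinite_finite_induct)
  case (insert a A)
  then show ?case
    by (simp add: gradient_add[where K = K and L = K] polys_on_sum)
qed auto

lemma gradient_power:
  assumes "f \<in> polys_on K"
  shows "gradient (\<lambda>x. f x ^ k) x = (of_nat k * f x ^ (k - 1)) *s gradient f x"
proof (induction k)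
  case (Suc k)
  have "gradient (\<lambda>x. f x ^ Suc k) x = f x ^ k *s gradient f x + f x *s gradient (\<lambda>x. f x ^ k) x"
    using gradient_mult[of f K "\<lambda>x. f x ^ k" K x] assms by auto
  also have "\<dots> = (of_nat (Suc k) * f x ^ k) *s gradient f x"
    unfolding Suc by (cases k) (auto simp: vec_eq_iff algebra_simps)
  finally show ?case by simp
qed auto

lemma polys_on_gradient:
  assumes "f \<in> polys_on K"
  shows "(\<lambda>x. gradient f x $ i) \<in> polys_on K"
  using assms
proof (induction rule: polys_on_induct)
  case (add f g)
  then show ?case by (auto simp: gradient_add)
next
  case (mult f g)
  then show ?case by (auto simp: gradient_mult)
qed (auto simp: gradient_coord)

lemma gradient_outside:
  assumes "f \<in> polys_on K" "i \<notin> K"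
  shows "gradient f x $ i = 0"
  using assms
proof (induction rule: polys_on_induct)
  case (add f g)
  then show ?case by (auto simp: gradient_add)
next
  case (mult f g)
  then show ?case by (auto simp: gradient_mult)
qed (auto simp: gradient_coord axis_def)

lemma directional_derivative:
  assumes "f \<in> polys_on K"
  shows "((\<lambda>t. f (x + t *s v)) has_field_derivative bform (gradient f x) v) (at 0)"
  using assms
proof (induction rule: polys_on_induct)
  case (coord i)
  then show ?case
    by (auto simp: gradient_coord intro!: derivative_eq_intros)
next
  case (add f g)
  then show ?case
    by (auto simp: gradient_add bform_linear intro!: DERIV_add)
next
  case (mult f g)
  then show ?case
    using DERIV_mult[OF mult.IH]
    by (simp add: gradient_mult bform_linear add.commute mult.commute)
qed auto

section \<open>Growth and algebraic dependence\<close>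

text \<open>
  Gaussian elimination: each equation with a nonzero coefficient is used to eliminate one unknown.
\<close>

lemma homogeneous_system_solvable:
  fixes m :: "'a \<Rightarrow> 'b \<Rightarrow> 'c::field"
  assumes "finite A" "finite B" "card B < card A"
  shows "\<exists>c. (\<exists>a\<in>A. c a \<noteq> 0) \<and> (\<forall>b\<in>B. (\<Sum>a\<in>A. c a * m a b) = 0)"
  using assms(2,1,3)
proof (induction B arbitrary: A m rule: finite_induct)
  case empty
  then show ?case by (intro exI[of _ "\<lambda>_. 1"]) (auto simp: card_gt_0_iff)
next
  case (insert b B)
  show ?case
  proof (cases "\<forall>a\<in>A. m a b = 0")
    case True
    have "card B < card A"
      using insert by auto
    from insert.IH[OF insert.prems(1) this, of m] True show ?thesis
      by auto
  next
    case False
    then obtain a0 where a0: "a0 \<in> A" "m a0 b \<noteq> 0"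
      by auto
    define A' where "A' = A - {a0}"
    have A': "finite A'" "A = insert a0 A'" "a0 \<notin> A'" "card B < card A'"
      using insert a0 by (auto simp: A'_def)
    obtain c where c: "\<exists>a\<in>A'. c a \<noteq> 0"
      "\<And>b'. b' \<in> B \<Longrightarrow> (\<Sum>a\<in>A'. c a * (m a b' - m a b / m a0 b * m a0 b')) = 0"
      using insert.IH[OF A'(1,4), of "\<lambda>a b'. m a b' - m a b / m a0 b * m a0 b'"] by auto
    define s where "s = - (\<Sum>a\<in>A'. c a * m a b) / m a0 b"
    define c' where "c' = c(a0 := s)"
    have c': "(\<Sum>a\<in>A. c' a * m a b') = s * m a0 b' + (\<Sum>a\<in>A'. c a * m a b')" for b'
    proof -
      have "(\<Sum>a\<in>A'. c' a * m a b') = (\<Sum>a\<in>A'. c a * m a b')"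
        using A'(3) by (intro sum.cong) (auto simp: c'_def)
      then show ?thesis
        using A'(1,3) by (simp add: A'(2) c'_def)
    qed
    have "(\<Sum>a\<in>A. c' a * m a b') = 0" if "b' \<in> B" for b'
    proof -
      have "(\<Sum>a\<in>A'. c a * m a b') = (\<Sum>a\<in>A'. c a * m a b / m a0 b * m a0 b')"
        using c(2)[OF that] by (simp add: right_diff_distrib sum_subtractf mult.assoc)
      also have "\<dots> = (\<Sum>a\<in>A'. c a * m a b) / m a0 b * m a0 b'"
        by (simp add: sum_distrib_right sum_divide_distrib)
      finally show ?thesis
        unfolding c' s_def by simp
    qed
    moreover have "(\<Sum>a\<in>A. c' a * m a b) = 0"
      unfolding c' s_def using a0 by simp
    moreover have "\<exists>a\<in>A. c' a \<noteq> 0"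
      using c(1) A' by (auto simp: c'_def)
    ultimately show ?thesis
      by (intro exI[of _ c']) auto
  qed
qed

definition lin_span :: "'a set \<Rightarrow> ('a \<Rightarrow> complex) set \<Rightarrow> ('a \<Rightarrow> complex) set" where
  "lin_span V B = {f. \<exists>m. \<forall>x\<in>V. f x = (\<Sum>b\<in>B. m b * b x)}"

lemma lin_span_base: "finite B \<Longrightarrow> b \<in> B \<Longrightarrow> b \<in> lin_span V B"
  unfolding lin_span_def
  by (auto intro!: exI[of _ "\<lambda>b'. if b' = b then 1 else 0"] simp: if_distrib[of "\<lambda>z. z * _"] cong: if_cong)

lemma lin_span_scale: "f \<in> lin_span V B \<Longrightarrow> (\<lambda>x. c * f x) \<in> lin_span V B"
proof -
  assume "f \<in> lin_span V B"
  then obtain m where "\<And>x. x \<in> V \<Longrightarrow> f x = (\<Sum>b\<in>B. m b * b x)"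
    by (auto simp: lin_span_def)
  then show ?thesis
    unfolding lin_span_def by (auto intro!: exI[of _ "\<lambda>b. c * m b"] simp: sum_distrib_left mult.assoc)
qed

lemma lin_span_add:
  assumes "f \<in> lin_span V B" "g \<in> lin_span V B"
  shows "(\<lambda>x. f x + g x) \<in> lin_span V B"
proof -
  obtain m m' where "\<And>x. x \<in> V \<Longrightarrow> f x = (\<Sum>b\<in>B. m b * b x)" "\<And>x. x \<in> V \<Longrightarrow> g x = (\<Sum>b\<in>B. m' b * b x)"
    using assms by (auto simp: lin_span_def)
  then show ?thesis
    unfolding lin_span_def by (auto intro!: exI[of _ "\<lambda>b. m b + m' b"] simp: sum.distrib distrib_right)
qed

lemma lin_span_sum:
  assumes "\<And>a. a \<in> A \<Longrightarrow> f a \<in> lin_span V B"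
  shows "(\<lambda>x. \<Sum>a\<in>A. f a x) \<in> lin_span V B"
  using assms
proof (induction A rule: infinite_finite_induct)
  case (insert a A)
  then show ?case by (simp add: lin_span_add)
qed (auto simp: lin_span_def intro!: exI[of _ "\<lambda>_. 0"])

lemma lin_span_cong:
  assumes "f \<in> lin_span V B" "\<And>x. x \<in> V \<Longrightarrow> g x = f x"
  shows "g \<in> lin_span V B"
  using assms by (auto simp: lin_span_def)

lemma lin_span_dependence:
  assumes "finite A" "finite B" "card B < card A"
    and F: "\<And>a. a \<in> A \<Longrightarrow> (\<lambda>x. h x * F a x) \<in> lin_span V B"
  shows "\<exists>c. (\<exists>a\<in>A. c a \<noteq> 0) \<and> (\<forall>x\<in>V. h x * (\<Sum>a\<in>A. c a * F a x) = 0)"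
proof -
  have "\<forall>a\<in>A. \<exists>m. \<forall>x\<in>V. h x * F a x = (\<Sum>b\<in>B. m b * b x)"
    using F by (auto simp: lin_span_def)
  then obtain m where m: "\<And>a x. a \<in> A \<Longrightarrow> x \<in> V \<Longrightarrow> h x * F a x = (\<Sum>b\<in>B. m a b * b x)"
    by metis
  obtain c where c: "\<exists>a\<in>A. c a \<noteq> 0" "\<And>b. b \<in> B \<Longrightarrow> (\<Sum>a\<in>A. c a * m a b) = 0"
    using homogeneous_system_solvable[OF assms(1-3), of m] by blast
  have "h x * (\<Sum>a\<in>A. c a * F a x) = 0" if x: "x \<in> V" for x
  proof -
    have "h x * (\<Sum>a\<in>A. c a * F a x) = (\<Sum>a\<in>A. c a * (h x * F a x))"
      by (simp add: sum_distrib_left mult_ac)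
    also have "\<dots> = (\<Sum>a\<in>A. \<Sum>b\<in>B. c a * m a b * b x)"
      by (intro sum.cong refl) (simp add: m x sum_distrib_left mult.assoc)
    also have "\<dots> = (\<Sum>b\<in>B. (\<Sum>a\<in>A. c a * m a b) * b x)"
      by (subst sum.swap) (simp add: sum_distrib_right)
    finally show ?thesis
      using c(2) by simp
  qed
  then show ?thesis
    using c(1) by blast
qed

text \<open>
  Irreducibility, stated through the vanishing ideal. The point of not asking for a closed set is
  the conormal variety: over a singular point of the base the tangent space jumps up and the fibre
  is too small, so the set of all conormal pairs is in general not closed.
\<close>

definition prime_set :: "(complex ^ 'n::finite) set \<Rightarrow> bool" where
  "prime_set V \<longleftrightarrow> V \<noteq> {} \<and> (\<forall>f\<in>polys_on UNIV. \<forall>g\<in>polys_on UNIV.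
     (\<forall>x\<in>V. f x * g x = 0) \<longrightarrow> (\<forall>x\<in>V. f x = 0) \<or> (\<forall>x\<in>V. g x = 0))"

lemma prime_setD:
  assumes "prime_set V" "f \<in> polys_on K" "g \<in> polys_on L" "\<And>x. x \<in> V \<Longrightarrow> f x * g x = 0"
    "x \<in> V" "f x \<noteq> 0" "y \<in> V"
  shows "g y = 0"
proof -
  have "f \<in> polys_on UNIV" "g \<in> polys_on UNIV"
    using assms(2,3) by (auto intro: polys_on_mono)
  then show ?thesis
    using assms unfolding prime_set_def by blast
qed

lemma prime_set_common:
  assumes "prime_set V" "f \<in> polys_on K" "g \<in> polys_on L" "x \<in> V" "f x \<noteq> 0" "y \<in> V" "g y \<noteq> 0"
  shows "\<exists>z\<in>V. f z \<noteq> 0 \<and> g z \<noteq> 0"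
  using prime_setD[OF assms(1-3) _ assms(4,5), of y] assms by auto

text \<open>
  On \<open>V\<close>, up to a common denominator \<open>h\<close>, the polynomials of degree at most \<open>M\<close> in the coordinates \<open>K\<close>
  span a space of dimension at most \<open>D\<close>. The denominator allows for relations that are not monic.
\<close>

definition hilbert_bound :: "(complex ^ 'n::finite) set \<Rightarrow> 'n set \<Rightarrow> nat \<Rightarrow> nat \<Rightarrow> bool" where
  "hilbert_bound V K M D \<longleftrightarrow> (\<exists>B. \<exists>h\<in>polys_on UNIV. finite B \<and> card B \<le> D \<and>
     (\<exists>x\<in>V. h x \<noteq> 0) \<and> (\<forall>g. poly_deg_le K M g \<longrightarrow> (\<lambda>x. h x * g x) \<in> lin_span V B))"

text \<open>
  An upper bound \<open>d\<close> on the transcendence degree over \<open>\<complex>\<close> of the coordinates in \<open>K\<close>, expressed as a bound on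
  the growth of the Hilbert function.
\<close>

definition growth :: "(complex ^ 'n::finite) set \<Rightarrow> 'n set \<Rightarrow> nat \<Rightarrow> bool" where
  "growth V K d \<longleftrightarrow> (\<exists>C. \<forall>M. hilbert_bound V K M (C * (M + 1) ^ d))"

lemma growth_empty:
  fixes V :: "(complex ^ 'n::finite) set"
  assumes "V \<noteq> {}"
  shows "growth V {} 0"
proof -
  have "(\<lambda>x. 1 * g x) \<in> lin_span V {\<lambda>_. 1}" if "poly_deg_le {} M g" for M and g :: "complex ^ 'n \<Rightarrow> complex"
  proof -
    have "g x = g 0" for x
      using that by (intro polys_on_cong[of g "{}"]) (auto simp: polys_on_def)
    then show ?thesis
      unfolding lin_span_def by (auto intro!: exI[of _ "\<lambda>_. g 0"])
  qed
  then show ?thesis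
    unfolding growth_def hilbert_bound_def using assms
    by (intro exI[of _ 1] allI exI[of _ "{\<lambda>_. 1}"] bexI[of _ "\<lambda>_. 1"]) auto
qed

lemma card_image_products:
  assumes "finite B" "finite I"
  shows "card ((\<lambda>(b, i) x. b x * x $ j ^ i) ` (B \<times> I)) \<le> card B * card I"
  using card_image_le[of "B \<times> I"] assms by (simp add: card_cartesian_product)

lemma growth_insert:
  fixes V :: "(complex ^ 'n::finite) set"
  assumes "growth V K d"
  shows "growth V (insert j K) (Suc d)"
proof -
  obtain C where C: "\<And>M. hilbert_bound V K M (C * (M + 1) ^ d)"
    using assms by (auto simp: growth_def)
  show ?thesis
    unfolding growth_def
  proof (intro exI[of _ C] allI)
    fix M
    obtain B h where B: "finite B" "card B \<le> C * (M + 1) ^ d" and h: "h \<in> polys_on UNIV" "\<exists>x\<in>V. h x \<noteq> 0"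
      and g: "\<And>g. poly_deg_le K M g \<Longrightarrow> (\<lambda>x. h x * g x) \<in> lin_span V B"
      using C[of M] unfolding hilbert_bound_def by blast
    define B' where "B' = (\<lambda>(b, i) x. b x * x $ j ^ i) ` (B \<times> {..M})"
    have "finite B'"
      using B by (auto simp: B'_def)
    have "card B' \<le> card B * (M + 1)"
      using card_image_products[of B "{..M}" j] B by (simp add: B'_def)
    also have "\<dots> \<le> C * (M + 1) ^ d * (M + 1)"
      using B(2) by (intro mult_right_mono) auto
    finally have card: "card B' \<le> C * (M + 1) ^ Suc d"
      by (simp add: algebra_simps)
    have "(\<lambda>x. h x * f x) \<in> lin_span V B'" if f: "poly_deg_le (insert j K) M f" for f
    proof -
      obtain c where c: "\<And>i. poly_deg_le K M (c i)" "\<And>x. f x = (\<Sum>i\<le>M. c i x * x $ j ^ i)"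
        using poly_deg_le_insert_expand[OF f] by (elim exE conjE) blast
      have "(\<lambda>x. h x * c i x * x $ j ^ i) \<in> lin_span V B'" if i: "i \<le> M" for i
      proof -
        obtain m where m: "\<And>x. x \<in> V \<Longrightarrow> h x * c i x = (\<Sum>b\<in>B. m b * b x)"
          using g[OF c(1)[of i]] by (auto simp: lin_span_def)
        have "(\<lambda>x. \<Sum>b\<in>B. m b * (b x * x $ j ^ i)) \<in> lin_span V B'"
          using i \<open>finite B'\<close> by (intro lin_span_sum lin_span_scale lin_span_base) (auto simp: B'_def)
        then show ?thesis
          by (rule lin_span_cong) (simp add: m sum_distrib_right mult.assoc)
      qed
      then have "(\<lambda>x. \<Sum>i\<le>M. h x * c i x * x $ j ^ i) \<in> lin_span V B'"
        by (intro lin_span_sum) auto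
      then show ?thesis
        by (rule lin_span_cong) (simp add: c sum_distrib_left mult.assoc)
    qed
    then show "hilbert_bound V (insert j K) M (C * (M + 1) ^ Suc d)"
      unfolding hilbert_bound_def using \<open>finite B'\<close> card h by (intro exI[of _ B'] bexI[of _ h]) auto
  qed
qed

lemma growth_card:
  assumes "V \<noteq> {}"
  shows "growth V K (card K)"
proof -
  have "finite K" by simp
  then show ?thesis
  proof (induction K rule: finite_induct)
    case empty
    show ?case using growth_empty[OF assms] by simp
  next
    case (insert j K)
    show ?case using growth_insert[OF insert.IH] insert.hyps by simp
  qed
qed

text \<open>
  Powers of an algebraic coordinate reduce to powers below the degree of its relation, at the price of
  one factor of the leading coefficient for each reduction; the degrees of the coefficients grow only
  linearly, which is what keeps the order of growth.
\<close>

lemma reduce_power: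
  fixes V :: "(complex ^ 'n::finite) set"
  assumes c: "\<And>i. i \<le> Suc D \<Longrightarrow> poly_deg_le K \<gamma> (c i)"
    and rel: "\<And>x. x \<in> V \<Longrightarrow> (\<Sum>i\<le>Suc D. c i x * x $ j ^ i) = 0"
  shows "\<exists>e. (\<forall>i. poly_deg_le K (\<gamma> * a) (e i)) \<and>
      (\<forall>x\<in>V. c (Suc D) x ^ a * x $ j ^ a = (\<Sum>i\<le>D. e i x * x $ j ^ i))"
proof (induction a)
  case 0
  have "(\<Sum>i\<le>D. (if i = 0 then 1 else 0) * x $ j ^ i) = 1" for x :: "complex ^ 'n"
    by (simp add: if_distrib[of "\<lambda>z. z * _"] cong: if_cong)
  then show ?case
    by (intro exI[of _ "\<lambda>i x. if i = 0 then 1 else 0"]) (auto intro: poly_deg_le.const)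
next
  case (Suc a)
  then obtain e where e: "\<And>i. poly_deg_le K (\<gamma> * a) (e i)"
    "\<And>x. x \<in> V \<Longrightarrow> c (Suc D) x ^ a * x $ j ^ a = (\<Sum>i\<le>D. e i x * x $ j ^ i)"
    by blast
  define e' where "e' = (\<lambda>i x. (if i = 0 then 0 else c (Suc D) x * e (i - 1) x) +
                                 (if i \<le> D then (- 1) * (e D x * c i x) else 0))"
  have "poly_deg_le K (\<gamma> * Suc a) (e' i)" for i
  proof -
    have "poly_deg_le K (\<gamma> * Suc a) (\<lambda>x. if i = 0 then 0 else c (Suc D) x * e (i - 1) x)"
      using e(1)[of "i - 1"] c[of "Suc D"]
      by (cases "i = 0") (auto intro: poly_deg_le.const poly_deg_le.mult[where a = \<gamma> and b = "\<gamma> * a"])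
    moreover have "poly_deg_le K (\<gamma> * Suc a) (\<lambda>x. if i \<le> D then (- 1) * (e D x * c i x) else 0)"
    proof (cases "i \<le> D")
      case True
      then have "poly_deg_le K (\<gamma> * Suc a) (\<lambda>x. (- 1) * (e D x * c i x))"
        by (intro poly_deg_le.mult[where a = 0 and b = "\<gamma> * Suc a"] poly_deg_le.const
            poly_deg_le.mult[where a = "\<gamma> * a" and b = \<gamma>] e c) auto
      then show ?thesis using True by simp
    qed (auto intro: poly_deg_le.const)
    ultimately show ?thesis
      unfolding e'_def by (rule poly_deg_le.add)
  qed
  moreover have "c (Suc D) x ^ Suc a * x $ j ^ Suc a = (\<Sum>i\<le>D. e' i x * x $ j ^ i)" if x: "x \<in> V" for x
  proof -
    have top: "c (Suc D) x * x $ j ^ Suc D = - (\<Sum>i\<le>D. c i x * x $ j ^ i)"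
      using rel[OF x] by (simp add: add_eq_0_iff)
    have "c (Suc D) x ^ Suc a * x $ j ^ Suc a = c (Suc D) x * x $ j * (\<Sum>i\<le>D. e i x * x $ j ^ i)"
      by (simp flip: e(2)[OF x])
    also have "\<dots> = (\<Sum>i<Suc D. c (Suc D) x * e i x * x $ j ^ Suc i)"
      unfolding lessThan_Suc_atMost by (simp add: sum_distrib_left mult_ac)
    also have "\<dots> = (\<Sum>i<D. c (Suc D) x * e i x * x $ j ^ Suc i) + e D x * (c (Suc D) x * x $ j ^ Suc D)"
      unfolding sum.lessThan_Suc by (simp add: mult_ac)
    also have "(\<Sum>i<D. c (Suc D) x * e i x * x $ j ^ Suc i) =
               (\<Sum>i<Suc D. (if i = 0 then 0 else c (Suc D) x * e (i - 1) x) * x $ j ^ i)"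
      by (subst sum.lessThan_Suc_shift) simp
    also have "e D x * (c (Suc D) x * x $ j ^ Suc D) = (\<Sum>i<Suc D. - (e D x * c i x) * x $ j ^ i)"
      unfolding top by (simp add: sum_distrib_left sum_negf mult_ac lessThan_Suc_atMost)
    also have "(\<Sum>i<Suc D. (if i = 0 then 0 else c (Suc D) x * e (i - 1) x) * x $ j ^ i) +
        (\<Sum>i<Suc D. - (e D x * c i x) * x $ j ^ i) = (\<Sum>i\<le>D. e' i x * x $ j ^ i)"
      unfolding lessThan_Suc_atMost sum.distrib[symmetric]
      by (intro sum.cong) (auto simp: e'_def algebra_simps)
    finally show ?thesis .
  qed
  ultimately show ?case
    by (intro exI[of _ e'] conjI allI ballI)
qed

text \<open>
  An algebraic coordinate contributes boundedly many powers, hence a constant factor. The denominator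
  absorbs the powers of the leading coefficient; it stays nonzero on \<open>V\<close> because \<open>V\<close> is irreducible.
\<close>

lemma growth_algebraic:
  fixes V :: "(complex ^ 'n::finite) set"
  assumes V: "prime_set V" and "growth V K d"
    and c: "\<And>i. i \<le> D \<Longrightarrow> c i \<in> polys_on K"
    and rel: "\<And>x. x \<in> V \<Longrightarrow> (\<Sum>i\<le>D. c i x * x $ j ^ i) = 0"
    and top: "x0 \<in> V" "c D x0 \<noteq> 0"
  shows "growth V (insert j K) d"
proof -
  have "D \<noteq> 0"
    using rel[OF top(1)] top(2) by (intro notI) auto
  then obtain D' where D': "D = Suc D'"
    by (cases D) auto
  have "\<forall>i\<in>{..D}. \<exists>M. poly_deg_le K M (c i)"
    using c by (auto simp: polys_on_def)
  then obtain \<mu> where \<mu>: "\<And>i. i \<le> D \<Longrightarrow> poly_deg_le K (\<mu> i) (c i)"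
    by (metis atMost_iff)
  define \<gamma> where "\<gamma> = (\<Sum>i\<le>D. \<mu> i)"
  have \<gamma>: "poly_deg_le K \<gamma> (c i)" if "i \<le> D" for i
    using that by (intro poly_deg_le_mono[OF \<mu>]) (auto simp: \<gamma>_def intro!: member_le_sum)
  define l where "l = c D"
  have l: "l \<in> polys_on UNIV"
    using c[of D] by (auto simp: l_def intro: polys_on_mono)
  have red: "\<exists>e. (\<forall>i. poly_deg_le K (\<gamma> * a) (e i)) \<and>
      (\<forall>x\<in>V. l x ^ a * x $ j ^ a = (\<Sum>i\<le>D'. e i x * x $ j ^ i))" for a
    using reduce_power[of D' K \<gamma> c V j a] \<gamma> rel by (auto simp: D' l_def)
  obtain C where C: "\<And>M. hilbert_bound V K M (C * (M + 1) ^ d)"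
    using assms(2) by (auto simp: growth_def)
  define C' where "C' = C * (\<gamma> + 1) ^ d * D"
  show ?thesis
    unfolding growth_def
  proof (intro exI[of _ C'] allI)
    fix M
    obtain B h where B: "finite B" "card B \<le> C * (M + \<gamma> * M + 1) ^ d"
      and h: "h \<in> polys_on UNIV" "\<exists>x\<in>V. h x \<noteq> 0"
      and g: "\<And>g. poly_deg_le K (M + \<gamma> * M) g \<Longrightarrow> (\<lambda>x. h x * g x) \<in> lin_span V B"
      using C[of "M + \<gamma> * M"] unfolding hilbert_bound_def by blast
    define B' where "B' = (\<lambda>(b, i) x. b x * x $ j ^ i) ` (B \<times> {..D'})"
    define h' where "h' = (\<lambda>x. h x * l x ^ M)"
    have h': "h' \<in> polys_on UNIV"
      using h(1) l by (auto simp: h'_def)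
    obtain x1 where x1: "x1 \<in> V" "h x1 \<noteq> 0"
      using h(2) by blast
    have "\<exists>x\<in>V. h' x \<noteq> 0"
      using prime_set_common[OF V h(1) l x1 top(1)] top(2) by (auto simp: l_def h'_def)
    have "finite B'"
      using B by (auto simp: B'_def)
    have "card B' \<le> card B * D"
      using card_image_products[of B "{..D'}" j] B by (simp add: B'_def D')
    also have "card B \<le> C * ((\<gamma> + 1) * (M + 1)) ^ d"
      using B(2) by (rule order_trans) (intro mult_left_mono power_mono, auto)
    also have "\<dots> * D = C' * (M + 1) ^ d"
      by (simp only: C'_def power_mult_distrib mult_ac)
    finally have card: "card B' \<le> C' * (M + 1) ^ d"
      by simp
    have "(\<lambda>x. h' x * f x) \<in> lin_span V B'" if f: "poly_deg_le (insert j K) M f" for f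
    proof -
      obtain u where u: "\<And>i. poly_deg_le K M (u i)" "\<And>x. f x = (\<Sum>i\<le>M. u i x * x $ j ^ i)"
        using poly_deg_le_insert_expand[OF f] by (elim exE conjE) blast
      have "(\<lambda>x. h' x * (u a x * x $ j ^ a)) \<in> lin_span V B'" if a: "a \<le> M" for a
      proof -
        obtain e where e: "\<And>i. poly_deg_le K (\<gamma> * a) (e i)"
          "\<And>x. x \<in> V \<Longrightarrow> l x ^ a * x $ j ^ a = (\<Sum>i\<le>D'. e i x * x $ j ^ i)"
          using red[of a] by blast
        have "(\<lambda>x. h x * (l x ^ (M - a) * (u a x * e i x)) * x $ j ^ i) \<in> lin_span V B'"
          if i: "i \<le> D'" for i
        proof -
          have "poly_deg_le K ((M - a) * \<gamma>) (\<lambda>x. l x ^ (M - a))"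
            unfolding l_def by (intro poly_deg_le_power \<gamma>) auto
          moreover have "(M - a) * \<gamma> + (M + \<gamma> * a) = M + \<gamma> * M"
            using a by (simp add: diff_mult_distrib algebra_simps)
          ultimately have "poly_deg_le K (M + \<gamma> * M) (\<lambda>x. l x ^ (M - a) * (u a x * e i x))"
            using poly_deg_le.mult[OF u(1)[of a] e(1)[of i] order_refl]
            by (auto intro: poly_deg_le.mult)
          then obtain m where m: "\<And>x. x \<in> V \<Longrightarrow> h x * (l x ^ (M - a) * (u a x * e i x)) = (\<Sum>b\<in>B. m b * b x)"
            using g by (fastforce simp: lin_span_def)
          have "(\<lambda>x. \<Sum>b\<in>B. m b * (b x * x $ j ^ i)) \<in> lin_span V B'"
            using i \<open>finite B'\<close> by (intro lin_span_sum lin_span_scale lin_span_base) (auto simp: B'_def)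
          then show ?thesis
            by (rule lin_span_cong) (simp add: m sum_distrib_right mult.assoc)
        qed
        then have "(\<lambda>x. \<Sum>i\<le>D'. h x * (l x ^ (M - a) * (u a x * e i x)) * x $ j ^ i) \<in> lin_span V B'"
          by (intro lin_span_sum) auto
        then show ?thesis
        proof (rule lin_span_cong)
          fix x assume x: "x \<in> V"
          have "h' x * (u a x * x $ j ^ a) = h x * l x ^ (M - a) * u a x * (l x ^ a * x $ j ^ a)"
            using a by (simp add: h'_def algebra_simps flip: power_add)
          then show "h' x * (u a x * x $ j ^ a) =
              (\<Sum>i\<le>D'. h x * (l x ^ (M - a) * (u a x * e i x)) * x $ j ^ i)"
            unfolding e(2)[OF x] by (simp add: sum_distrib_left mult_ac)
        qed
      qed
      then have "(\<lambda>x. \<Sum>a\<le>M. h' x * (u a x * x $ j ^ a)) \<in> lin_span V B'"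
        by (intro lin_span_sum) auto
      then show ?thesis
        by (rule lin_span_cong) (simp add: u sum_distrib_left)
    qed
    then show "hilbert_bound V (insert j K) M (C' * (M + 1) ^ d)"
      unfolding hilbert_bound_def using \<open>finite B'\<close> card h' \<open>\<exists>x\<in>V. h' x \<noteq> 0\<close> by (intro exI[of _ B'] bexI[of _ h']) auto
  qed
qed

text \<open>
  Unnormalised Lagrange polynomials for the grid \<open>{0, \<dots>, M - 1}\<^sup>K\<close>: each is nonzero at its own grid point
  and zero at the others. They replace the monomials with exponents below \<open>M\<close>, and their linear
  independence is visible by evaluation.
\<close>

definition grid_poly :: "'k set \<Rightarrow> nat \<Rightarrow> ('k \<Rightarrow> nat) \<Rightarrow> complex ^ 'k::finite \<Rightarrow> complex" where
  "grid_poly K M g u = (\<Prod>i\<in>K. \<Prod>c\<in>{..<M} - {g i}. u $ i - of_nat c)"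

lemma grid_poly_deg: "poly_deg_le K (card K * M) (grid_poly K M g)"
proof -
  have "poly_deg_le K M (\<lambda>u. \<Prod>c\<in>{..<M} - {g i}. u $ i - of_nat c)" if "i \<in> K" for i
  proof -
    have "poly_deg_le K 1 (\<lambda>u. u $ i + (- of_nat c))" for c
      using that by (intro poly_deg_le.add poly_deg_le.const poly_deg_le.coord) auto
    then have "poly_deg_le K (card ({..<M} - {g i}) * 1) (\<lambda>u. \<Prod>c\<in>{..<M} - {g i}. u $ i + (- of_nat c))"
      by (intro poly_deg_le_prod) auto
    moreover have "card ({..<M} - {g i}) \<le> M"
      using card_mono[of "{..<M}" "{..<M} - {g i}"] by simp
    ultimately show ?thesis
      by (auto intro: poly_deg_le_mono)
  qed
  then show ?thesis
    unfolding grid_poly_def[abs_def] by (intro poly_deg_le_prod) auto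
qed

lemma grid_poly_eq_0_iff:
  assumes "g \<in> PiE K (\<lambda>_. {..<M})" "g' \<in> PiE K (\<lambda>_. {..<M})"
  shows "grid_poly K M g (\<chi> i. of_nat (g' i)) = 0 \<longleftrightarrow> g \<noteq> g'"
proof
  assume "grid_poly K M g (\<chi> i. of_nat (g' i)) = 0"
  then show "g \<noteq> g'"
    by (auto simp: grid_poly_def)
next
  assume "g \<noteq> g'"
  then obtain i where "i \<in> K" "g i \<noteq> g' i"
    using PiE_ext[OF assms] by auto
  moreover from this have "g' i \<in> {..<M} - {g i}"
    using assms(2) by (auto simp: PiE_iff)
  ultimately show "grid_poly K M g (\<chi> i. of_nat (g' i)) = 0"
    unfolding grid_poly_def by (intro prod_zero bexI[of _ i] bexI[of _ "g' i"]) auto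
qed

text \<open>
  More than \<open>d\<close> polynomials are algebraically dependent on a variety of dimension at most \<open>d\<close>. Among the
  products \<open>f\<^sup>i q\<^sub>g(\<sigma>)\<close>, with \<open>i < M\<close> and a grid polynomial \<open>q\<^sub>g\<close>, there are \<open>M\<^bsup>card K + 1\<^esup>\<close> many, all of
  degree \<open>O(M)\<close>; for large \<open>M\<close> this exceeds the dimension \<open>O(M\<^sup>d)\<close> of the space that they lie in. In a
  linear relation the lowest power of \<open>f\<close> can be cancelled, and then the part without \<open>f\<close> is a
  nonzero polynomial in the \<open>\<sigma>\<^sub>i\<close>. On the zero set of \<open>f\<close> this polynomial vanishes: the \<open>\<sigma>\<^sub>i\<close> map a
  proper closed subset of \<open>V\<close> into a hypersurface.
\<close>

lemma algebraic_relation: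
  fixes V :: "(complex ^ 'n::finite) set" and \<sigma> :: "complex ^ 'n \<Rightarrow> complex ^ 'k::finite"
  assumes V: "prime_set V" and gr: "growth V UNIV d" and K: "d \<le> card K"
    and \<sigma>: "\<And>i. i \<in> K \<Longrightarrow> (\<lambda>x. \<sigma> x $ i) \<in> polys_on UNIV"
    and f: "f \<in> polys_on UNIV" "x0 \<in> V" "f x0 \<noteq> 0"
  shows "\<exists>Q\<in>polys_on K. \<exists>R\<in>polys_on UNIV. (\<exists>u. Q u \<noteq> 0) \<and> (\<forall>x\<in>V. Q (\<sigma> x) + f x * R x = 0)"
proof -
  define k where "k = card K"
  obtain a where a: "poly_deg_le UNIV a f"
    using f by (auto simp: polys_on_def)
  have "\<forall>i\<in>K. \<exists>M. poly_deg_le UNIV M (\<lambda>x. \<sigma> x $ i)"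
    using \<sigma> by (auto simp: polys_on_def)
  then obtain \<mu> where \<mu>: "\<And>i. i \<in> K \<Longrightarrow> poly_deg_le UNIV (\<mu> i) (\<lambda>x. \<sigma> x $ i)"
    by metis
  define \<delta> where "\<delta> = a + (\<Sum>i\<in>K. \<mu> i)"
  have \<delta>f: "poly_deg_le UNIV \<delta> f"
    using a by (rule poly_deg_le_mono) (auto simp: \<delta>_def)
  have \<delta>\<sigma>: "poly_deg_le UNIV \<delta> (\<lambda>x. \<sigma> x $ i)" if "i \<in> K" for i
    using \<mu>[OF that] by (rule poly_deg_le_mono)
      (use that in \<open>auto simp: \<delta>_def intro!: trans_le_add2 member_le_sum\<close>)
  obtain C where C: "\<And>M. hilbert_bound V UNIV M (C * (M + 1) ^ d)"
    using gr by (auto simp: growth_def)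
  \<comment> \<open>\<open>L * M\<close> bounds the degrees of the products, and \<open>M\<close> is chosen so that their number is too large.\<close>
  define L where "L = (k + 1) * \<delta>"
  define M where "M = C * (L + 1) ^ d + 1"
  obtain B h where B: "finite B" "card B \<le> C * (L * M + 1) ^ d"
      and h: "h \<in> polys_on UNIV" "\<exists>x\<in>V. h x \<noteq> 0"
      and g: "\<And>g. poly_deg_le UNIV (L * M) g \<Longrightarrow> (\<lambda>x. h x * g x) \<in> lin_span V B"
    using C[of "L * M"] unfolding hilbert_bound_def by blast
  define G where "G = PiE K (\<lambda>_. {..<M})"
  define A where "A = {..<M} \<times> G"
  have G: "finite G" "card G = M ^ k"
    by (auto simp: G_def k_def card_PiE intro!: finite_PiE)
  have A: "finite A" "card A = M * M ^ k"
    using G by (auto simp: A_def card_cartesian_product)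
  have "card B \<le> C * ((L + 1) * M) ^ d"
    using B(2) by (rule order_trans) (intro mult_left_mono power_mono, auto simp: M_def)
  also have "\<dots> = C * (L + 1) ^ d * M ^ d"
    by (simp only: power_mult_distrib mult.assoc)
  also have "\<dots> \<le> C * (L + 1) ^ d * M ^ k"
    using K by (intro mult_left_mono power_increasing) (auto simp: k_def M_def)
  also have "\<dots> < M * M ^ k"
    by (simp add: M_def)
  finally have card: "card B < card A"
    by (simp add: A)
  define F where "F = (\<lambda>(i, g) x. f x ^ i * grid_poly K M g (\<sigma> x))"
  have "(\<lambda>x. h x * F p x) \<in> lin_span V B" if pA: "p \<in> A" for p
  proof -
    obtain i \<gamma> where p: "p = (i, \<gamma>)" "i < M"
      using pA by (cases p) (auto simp: A_def)
    have "poly_deg_le UNIV (i * \<delta>) (\<lambda>x. f x ^ i)"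
      by (intro poly_deg_le_power \<delta>f)
    moreover have "poly_deg_le UNIV (k * M * \<delta>) (\<lambda>x. grid_poly K M \<gamma> (\<sigma> x))"
      unfolding k_def by (rule poly_deg_le_compose[OF grid_poly_deg \<delta>\<sigma>])
    moreover have "i * \<delta> + k * M * \<delta> \<le> L * M"
    proof -
      have "i * \<delta> \<le> M * \<delta>"
        using p by simp
      then show ?thesis
        by (simp add: L_def algebra_simps)
    qed
    ultimately have "poly_deg_le UNIV (L * M) (F p)"
      unfolding F_def p by (auto intro: poly_deg_le.mult)
    then show ?thesis
      by (rule g)
  qed
  then have "\<exists>c. (\<exists>p\<in>A. c p \<noteq> 0) \<and> (\<forall>x\<in>V. h x * (\<Sum>p\<in>A. c p * F p x) = 0)"
    by (rule lin_span_dependence[OF A(1) B(1) card])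
  then obtain c where c: "\<exists>p\<in>A. c p \<noteq> 0" and hF: "\<forall>x\<in>V. h x * (\<Sum>p\<in>A. c p * F p x) = 0"
    by blast
  define Q where "Q = (\<lambda>i u. \<Sum>g\<in>G. c (i, g) * grid_poly K M g u)"
  have Q: "Q i \<in> polys_on K" for i
    unfolding Q_def by (intro polys_on_sum polys_on_cmult) (auto simp: polys_on_def intro: grid_poly_deg)
  have Q\<sigma>: "(\<lambda>x. Q i (\<sigma> x)) \<in> polys_on UNIV" for i
    by (rule polys_on_compose[OF Q]) (use \<sigma> in auto)
  have FQ: "(\<Sum>p\<in>A. c p * F p x) = (\<Sum>i<M. f x ^ i * Q i (\<sigma> x))" for x
  proof -
    have "(\<Sum>p\<in>A. c p * F p x) = (\<Sum>i<M. \<Sum>g\<in>G. c (i, g) * F (i, g) x)"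
      unfolding A_def sum.cartesian_product by (intro sum.cong) auto
    then show ?thesis
      by (simp add: Q_def F_def sum_distrib_left mult_ac)
  qed
  obtain x1 where x1: "x1 \<in> V" "h x1 \<noteq> 0"
    using h by blast
  have rel: "(\<Sum>i<M. f x ^ i * Q i (\<sigma> x)) = 0" if "x \<in> V" for x
  proof (rule prime_setD[OF V h(1) _ _ x1 that])
    show "(\<lambda>x. \<Sum>i<M. f x ^ i * Q i (\<sigma> x)) \<in> polys_on UNIV"
      by (intro polys_on_sum polys_on_mult polys_on_power Q\<sigma> f)
    show "h x * (\<Sum>i<M. f x ^ i * Q i (\<sigma> x)) = 0" if "x \<in> V" for x
      using hF that by (simp add: FQ)
  qed
  have "\<exists>i. i < M \<and> (\<exists>u. Q i u \<noteq> 0)"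
  proof -
    obtain i g where ig: "i < M" "g \<in> G" "c (i, g) \<noteq> 0"
      using c(1) by (auto simp: A_def)
    define u :: "complex ^ 'k" where "u = (\<chi> i. of_nat (g i))"
    have "Q i u = (\<Sum>g'\<in>G. if g' = g then c (i, g) * grid_poly K M g u else 0)"
      unfolding Q_def u_def using ig(2) grid_poly_eq_0_iff[of _ K M g]
      by (intro sum.cong) (auto simp: G_def)
    then have "Q i u = c (i, g) * grid_poly K M g u"
      using ig G by simp
    moreover have "grid_poly K M g u \<noteq> 0"
      using ig(2) grid_poly_eq_0_iff[of g K M g] by (auto simp: u_def G_def)
    ultimately have "Q i u \<noteq> 0"
      using ig(3) by simp
    then show ?thesis
      using ig(1) by blast
  qed
  \<comment> \<open>The lowest power of \<open>f\<close> that occurs in the relation.\<close>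
  define i0 where "i0 = (LEAST i. i < M \<and> (\<exists>u. Q i u \<noteq> 0))"
  have i0: "i0 < M" "\<exists>u. Q i0 u \<noteq> 0" "\<And>i u. i < i0 \<Longrightarrow> Q i u = 0"
    using LeastI_ex[OF \<open>\<exists>i. i < M \<and> (\<exists>u. Q i u \<noteq> 0)\<close>, folded i0_def]
      not_less_Least[of _ "\<lambda>i. i < M \<and> (\<exists>u. Q i u \<noteq> 0)", folded i0_def] by force+
  define R where "R = (\<lambda>x. \<Sum>i\<in>{i0<..<M}. f x ^ (i - i0 - 1) * Q i (\<sigma> x))"
  have R: "R \<in> polys_on UNIV"
    unfolding R_def by (intro polys_on_sum polys_on_mult polys_on_power Q\<sigma> f)
  have split: "(\<Sum>i<M. f x ^ i * Q i (\<sigma> x)) = f x ^ i0 * (Q i0 (\<sigma> x) + f x * R x)" for x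
  proof -
    have "(\<Sum>i<M. f x ^ i * Q i (\<sigma> x)) = (\<Sum>i\<in>insert i0 {i0<..<M}. f x ^ i * Q i (\<sigma> x))"
      using i0(1,3) by (intro sum.mono_neutral_right) (auto simp: not_less)
    also have "\<dots> = f x ^ i0 * Q i0 (\<sigma> x) + (\<Sum>i\<in>{i0<..<M}. f x ^ i * Q i (\<sigma> x))"
      by simp
    also have "(\<Sum>i\<in>{i0<..<M}. f x ^ i * Q i (\<sigma> x)) =
               (\<Sum>i\<in>{i0<..<M}. f x ^ i0 * (f x * (f x ^ (i - i0 - 1) * Q i (\<sigma> x))))"
    proof (rule sum.cong[OF refl])
      fix i assume "i \<in> {i0<..<M}"
      then have "f x ^ i = f x ^ (i0 + 1 + (i - i0 - 1))"
        by simp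
      then show "f x ^ i * Q i (\<sigma> x) = f x ^ i0 * (f x * (f x ^ (i - i0 - 1) * Q i (\<sigma> x)))"
        by (simp add: power_add)
    qed
    finally show ?thesis
      by (simp add: R_def sum_distrib_left distrib_left)
  qed
  have "Q i0 (\<sigma> x) + f x * R x = 0" if x: "x \<in> V" for x
  proof (rule prime_setD[OF V _ _ _ f(2) _ x])
    show "(\<lambda>x. f x ^ i0) \<in> polys_on UNIV" "(\<lambda>x. Q i0 (\<sigma> x) + f x * R x) \<in> polys_on UNIV"
      using f(1) R Q\<sigma> by auto
    show "f x0 ^ i0 \<noteq> 0"
      using f by simp
    show "f x ^ i0 * (Q i0 (\<sigma> x) + f x * R x) = 0" if "x \<in> V" for x
      using rel[OF that] split by simp
  qed
  then show ?thesis
    using Q[of i0] R i0(2) by blast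
qed

section \<open>Ideals and the Nullstellensatz\<close>

definition poly_ideal :: "(complex ^ 'n::finite \<Rightarrow> complex) set \<Rightarrow> bool" where
  "poly_ideal J \<longleftrightarrow> J \<subseteq> polys_on UNIV \<and> (\<lambda>x. 0) \<in> J \<and>
     (\<forall>f\<in>J. \<forall>g\<in>J. (\<lambda>x. f x + g x) \<in> J) \<and>
     (\<forall>f\<in>J. \<forall>g\<in>polys_on UNIV. (\<lambda>x. g x * f x) \<in> J)"

definition prime_poly_ideal :: "(complex ^ 'n::finite \<Rightarrow> complex) set \<Rightarrow> bool" where
  "prime_poly_ideal J \<longleftrightarrow> poly_ideal J \<and> (\<lambda>x. 1) \<notin> J \<and>
     (\<forall>f\<in>polys_on UNIV. \<forall>g\<in>polys_on UNIV. (\<lambda>x. f x * g x) \<in> J \<longrightarrow> f \<in> J \<or> g \<in> J)"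

lemma poly_idealD:
  assumes "poly_ideal J"
  shows "f \<in> J \<Longrightarrow> f \<in> polys_on UNIV" "(\<lambda>x. 0) \<in> J"
    "f \<in> J \<Longrightarrow> g \<in> J \<Longrightarrow> (\<lambda>x. f x + g x) \<in> J"
    "f \<in> J \<Longrightarrow> g \<in> polys_on UNIV \<Longrightarrow> (\<lambda>x. g x * f x) \<in> J"
  using assms by (auto simp: poly_ideal_def)

lemma prime_poly_idealD:
  assumes "prime_poly_ideal J"
  shows "poly_ideal J" "(\<lambda>x. 1) \<notin> J"
    "f \<in> polys_on UNIV \<Longrightarrow> g \<in> polys_on UNIV \<Longrightarrow> (\<lambda>x. f x * g x) \<in> J \<Longrightarrow> f \<in> J \<or> g \<in> J"
  using assms by (auto simp: prime_poly_ideal_def)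

lemma poly_ideal_sum:
  assumes "poly_ideal J" "\<And>a. a \<in> A \<Longrightarrow> f a \<in> J"
  shows "(\<lambda>x. \<Sum>a\<in>A. f a x) \<in> J"
  using assms(2)
  by (induction A rule: infinite_finite_induct) (auto intro: poly_idealD[OF assms(1)])

lemma poly_ideal_diff:
  assumes "poly_ideal J" "f \<in> J" "g \<in> J"
  shows "(\<lambda>x. f x - g x) \<in> J"
  using poly_idealD(3)[OF assms(1,2) poly_idealD(4)[OF assms(1,3), of "\<lambda>_. - 1"]] by simp

lemma prime_poly_ideal_power:
  assumes "prime_poly_ideal J" "f \<in> polys_on UNIV" "f \<notin> J"
  shows "(\<lambda>x. f x ^ k) \<notin> J"
proof (induction k)
  case (Suc k)
  then show ?case
    using prime_poly_idealD(3)[OF assms(1), of f "\<lambda>x. f x ^ k"] assms by auto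
qed (use prime_poly_idealD[OF assms(1)] in simp)

lemma prime_poly_ideal_const:
  assumes "prime_poly_ideal J" "(\<lambda>x. c) \<in> J"
  shows "c = 0"
proof (rule ccontr)
  assume "c \<noteq> 0"
  then show False
    using poly_idealD(4)[OF prime_poly_idealD(1)[OF assms(1)] assms(2), of "\<lambda>_. 1 / c"]
      prime_poly_idealD(2)[OF assms(1)] by simp
qed

text \<open>
  The ideal generated by \<open>J\<close> and \<open>a\<close>.
\<close>

definition adjoin :: "(complex ^ 'n::finite \<Rightarrow> complex) set \<Rightarrow> (complex ^ 'n \<Rightarrow> complex) \<Rightarrow> (complex ^ 'n \<Rightarrow> complex) set" where
  "adjoin J a = {f \<in> polys_on UNIV. \<exists>r\<in>polys_on UNIV. (\<lambda>x. f x - r x * a x) \<in> J}"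

lemma adjoin_ideal:
  fixes J :: "(complex ^ 'n::finite \<Rightarrow> complex) set"
  assumes J: "poly_ideal J" and a: "a \<in> polys_on UNIV"
  shows "poly_ideal (adjoin J a)" "J \<subseteq> adjoin J a" "a \<in> adjoin J a"
proof -
  show "J \<subseteq> adjoin J a"
    using poly_idealD[OF J] by (auto simp: adjoin_def intro!: bexI[of _ "\<lambda>_. 0"])
  show "a \<in> adjoin J a"
    using poly_idealD[OF J] a by (auto simp: adjoin_def intro!: bexI[of _ "\<lambda>_. 1"])
  show "poly_ideal (adjoin J a)"
    unfolding poly_ideal_def
  proof (intro conjI ballI)
    show "adjoin J a \<subseteq> polys_on UNIV"
      by (auto simp: adjoin_def)
    show "(\<lambda>x. 0) \<in> adjoin J a"
      using \<open>J \<subseteq> adjoin J a\<close> poly_idealD[OF J] by auto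
  next
    fix f g assume "f \<in> adjoin J a" "g \<in> adjoin J a"
    then obtain r s where r: "f \<in> polys_on UNIV" "r \<in> polys_on UNIV" "(\<lambda>x. f x - r x * a x) \<in> J"
      and s: "g \<in> polys_on UNIV" "s \<in> polys_on UNIV" "(\<lambda>x. g x - s x * a x) \<in> J"
      by (auto simp: adjoin_def)
    have "(\<lambda>x. (f x + g x) - (r x + s x) * a x) \<in> J"
      using poly_idealD(3)[OF J r(3) s(3)] by (simp add: algebra_simps)
    then show "(\<lambda>x. f x + g x) \<in> adjoin J a"
      using r s unfolding adjoin_def by (auto intro!: bexI[of _ "\<lambda>x. r x + s x"])
  next
    fix f g :: "complex ^ 'n \<Rightarrow> complex"
    assume "f \<in> adjoin J a" and g: "g \<in> polys_on UNIV"
    then obtain r where r: "f \<in> polys_on UNIV" "r \<in> polys_on UNIV" "(\<lambda>x. f x - r x * a x) \<in> J"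
      by (auto simp: adjoin_def)
    have "(\<lambda>x. g x * f x - (g x * r x) * a x) \<in> J"
      using poly_idealD(4)[OF J r(3) g] by (simp add: algebra_simps)
    then show "(\<lambda>x. g x * f x) \<in> adjoin J a"
      using r g unfolding adjoin_def by (auto intro!: bexI[of _ "\<lambda>x. g x * r x"])
  qed
qed

text \<open>
  An ideal that is maximal among those avoiding a multiplicative set is prime. The maximality is kept
  in the conclusion, as it says that the quotient is as small as the multiplicative set permits.
\<close>

lemma prime_avoiding:
  fixes J S :: "(complex ^ 'n::finite \<Rightarrow> complex) set"
  assumes J: "poly_ideal J" and S: "S \<subseteq> polys_on UNIV" "(\<lambda>x. 1) \<in> S"
      "\<And>f g. f \<in> S \<Longrightarrow> g \<in> S \<Longrightarrow> (\<lambda>x. f x * g x) \<in> S"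
    and disj: "J \<inter> S = {}"
  obtains P where "J \<subseteq> P" "prime_poly_ideal P" "P \<inter> S = {}"
    "\<And>a. a \<in> polys_on UNIV \<Longrightarrow> a \<notin> P \<Longrightarrow> adjoin P a \<inter> S \<noteq> {}"
proof -
  define \<A> where "\<A> = {Q. poly_ideal Q \<and> J \<subseteq> Q \<and> Q \<inter> S = {}}"
  have "\<Union>\<C> \<in> \<A>" if \<C>: "\<C> \<noteq> {}" "subset.chain \<A> \<C>" for \<C>
  proof -
    have sub: "\<And>Q. Q \<in> \<C> \<Longrightarrow> poly_ideal Q \<and> J \<subseteq> Q \<and> Q \<inter> S = {}"
      using \<C>(2) by (auto simp: subset.chain_def \<A>_def)
    have lin: "\<And>Q R. Q \<in> \<C> \<Longrightarrow> R \<in> \<C> \<Longrightarrow> Q \<subseteq> R \<or> R \<subseteq> Q"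
      using \<C>(2) unfolding subset.chain_def by blast
    have "poly_ideal (\<Union>\<C>)"
      unfolding poly_ideal_def
    proof (intro conjI ballI)
      show "\<Union>\<C> \<subseteq> polys_on UNIV"
        using sub poly_idealD(1) by blast
      show "(\<lambda>x. 0) \<in> \<Union>\<C>"
        using sub \<C>(1) poly_idealD(2) by blast
    next
      fix f g assume "f \<in> \<Union>\<C>" "g \<in> \<Union>\<C>"
      then obtain Q R where "Q \<in> \<C>" "f \<in> Q" "R \<in> \<C>" "g \<in> R"
        by auto
      then obtain T where "T \<in> \<C>" "f \<in> T" "g \<in> T"
        using lin by blast
      then show "(\<lambda>x. f x + g x) \<in> \<Union>\<C>"
        using sub poly_idealD(3) by blast
    next
      fix f g :: "complex ^ 'n \<Rightarrow> complex" assume "f \<in> \<Union>\<C>" "g \<in> polys_on UNIV"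
      then show "(\<lambda>x. g x * f x) \<in> \<Union>\<C>"
        using sub poly_idealD(4) by blast
    qed
    then show ?thesis
      using sub \<C>(1) by (auto simp: \<A>_def)
  qed
  moreover have "J \<in> \<A>"
    using J disj by (auto simp: \<A>_def)
  ultimately obtain P where P: "P \<in> \<A>" "\<And>Q. Q \<in> \<A> \<Longrightarrow> P \<subseteq> Q \<Longrightarrow> Q = P"
    using subset_Zorn_nonempty[of \<A>] by blast
  then have ideal: "poly_ideal P" and sub: "J \<subseteq> P" and PS: "P \<inter> S = {}"
    by (auto simp: \<A>_def)
  have meet: "adjoin P a \<inter> S \<noteq> {}" if a: "a \<in> polys_on UNIV" "a \<notin> P" for a
  proof
    assume "adjoin P a \<inter> S = {}"
    then have "adjoin P a \<in> \<A>"
      using adjoin_ideal[OF ideal a(1)] sub by (auto simp: \<A>_def)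
    then have "adjoin P a = P"
      using P(2) adjoin_ideal[OF ideal a(1)] by blast
    then show False
      using adjoin_ideal[OF ideal a(1)] a(2) by blast
  qed
  have "prime_poly_ideal P"
    unfolding prime_poly_ideal_def
  proof (intro conjI ballI impI)
    show "poly_ideal P" by fact
    show "(\<lambda>x. 1) \<notin> P" using PS S(2) by auto
    fix f g :: "complex ^ 'n \<Rightarrow> complex"
    assume f: "f \<in> polys_on UNIV" and g: "g \<in> polys_on UNIV" and fg: "(\<lambda>x. f x * g x) \<in> P"
    show "f \<in> P \<or> g \<in> P"
    proof (rule ccontr)
      assume "\<not> (f \<in> P \<or> g \<in> P)"
      then obtain s t r q where s: "s \<in> S" "s \<in> polys_on UNIV" "r \<in> polys_on UNIV" "(\<lambda>x. s x - r x * f x) \<in> P"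
        and t: "t \<in> S" "t \<in> polys_on UNIV" "q \<in> polys_on UNIV" "(\<lambda>x. t x - q x * g x) \<in> P"
        using meet[OF f] meet[OF g] by (auto simp: adjoin_def)
      \<comment> \<open>From \<open>s \<equiv> r f\<close> and \<open>t \<equiv> q g\<close> it follows that \<open>s t \<equiv> r q f g \<equiv> 0\<close>.\<close>
      have "(\<lambda>x. t x * (s x - r x * f x)) \<in> P" "(\<lambda>x. (r x * f x) * (t x - q x * g x)) \<in> P"
        "(\<lambda>x. (r x * q x) * (f x * g x)) \<in> P"
        using s t f g fg by (auto intro!: poly_idealD(4)[OF ideal])
      then have "(\<lambda>x. t x * (s x - r x * f x) + (r x * f x) * (t x - q x * g x) +
          (r x * q x) * (f x * g x)) \<in> P"
        by (intro poly_idealD(3)[OF ideal])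
      moreover have "t x * (s x - r x * f x) + (r x * f x) * (t x - q x * g x) +
          (r x * q x) * (f x * g x) = s x * t x" for x
        by (simp add: algebra_simps)
      ultimately have "(\<lambda>x. s x * t x) \<in> P"
        by simp
      then show False
        using S(3)[OF s(1) t(1)] PS by auto
    qed
  qed
  with sub PS meet that show ?thesis by blast
qed

lemma prime_set_UNIV: "prime_set (UNIV :: (complex ^ 'n::finite) set)"
  unfolding prime_set_def using polys_no_zero_divisors by (metis UNIV_I empty_not_UNIV mult_eq_0_iff)

text \<open>
  The polynomial ring is a countable union of finite-dimensional spaces, one for each degree, whereas
  \<open>\<complex>\<close> is uncountable. So infinitely many members of the family have the same degree bound (and the same
  label \<open>k\<close>), and they lie in one finite-dimensional space.
\<close>

lemma uncountable_family_dependent: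
  fixes A :: "complex \<Rightarrow> complex ^ 'n::finite \<Rightarrow> complex" and k :: "complex \<Rightarrow> nat"
  assumes A: "\<And>c. A c \<in> polys_on UNIV"
  shows "\<exists>F \<alpha> c0. finite F \<and> c0 \<in> F \<and> \<alpha> c0 \<noteq> 0 \<and> (\<forall>c\<in>F. k c = k c0) \<and>
           (\<forall>x. (\<Sum>c\<in>F. \<alpha> c * A c x) = 0)"
proof -
  have "\<forall>c. \<exists>M. poly_deg_le UNIV M (A c)"
    using A by (auto simp: polys_on_def)
  then obtain M where M: "\<And>c. poly_deg_le UNIV (M c) (A c)"
    by metis
  have "\<exists>p. infinite {c. (M c, k c) = p}"
  proof (rule ccontr)
    assume "\<not> (\<exists>p. infinite {c. (M c, k c) = p})"
    then have "countable (\<Union>p. {c. (M c, k c) = p})"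
      by (intro countable_UN) (auto intro: countable_finite)
    moreover have "(\<Union>p. {c. (M c, k c) = p}) = UNIV"
      by auto
    ultimately show False
      using uncountable_UNIV_complex by simp
  qed
  then obtain M0 k0 where inf: "infinite {c. (M c, k c) = (M0, k0)}"
    by auto
  have "growth (UNIV :: (complex ^ 'n) set) UNIV (card (UNIV :: 'n set))"
    by (rule growth_card) simp
  then obtain B h where B: "finite B" and h: "h \<in> polys_on UNIV" "\<exists>x\<in>UNIV. h x \<noteq> 0"
      and g: "\<And>g :: complex ^ 'n \<Rightarrow> complex. poly_deg_le UNIV M0 g \<Longrightarrow> (\<lambda>x. h x * g x) \<in> lin_span UNIV B"
    unfolding growth_def hilbert_bound_def by blast
  obtain F where F: "F \<subseteq> {c. (M c, k c) = (M0, k0)}" "finite F" "card F = Suc (card B)"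
    using infinite_arbitrarily_large[OF inf] by blast
  have "(\<lambda>x. h x * A c x) \<in> lin_span UNIV B" if "c \<in> F" for c
  proof -
    have "M c = M0"
      using F that by auto
    then show ?thesis
      using g[of "A c"] M[of c] by simp
  qed
  then have "\<exists>\<alpha>. (\<exists>c\<in>F. \<alpha> c \<noteq> 0) \<and> (\<forall>x\<in>UNIV. h x * (\<Sum>c\<in>F. \<alpha> c * A c x) = 0)"
    using F(3) by (intro lin_span_dependence[OF F(2) B]) auto
  then obtain \<alpha> c0 where \<alpha>: "c0 \<in> F" "\<alpha> c0 \<noteq> 0" and hA: "\<And>x. h x * (\<Sum>c\<in>F. \<alpha> c * A c x) = 0"
    by blast
  obtain x1 where x1: "h x1 \<noteq> 0"
    using h by auto
  have "(\<Sum>c\<in>F. \<alpha> c * A c x) = 0" for x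
    by (rule prime_setD[where L = UNIV, OF prime_set_UNIV h(1) _ hA UNIV_I x1 UNIV_I])
      (intro polys_on_sum polys_on_cmult A)
  then show ?thesis
    using F \<alpha> by (intro exI[of _ F] exI[of _ \<alpha>] exI[of _ c0]) auto
qed

text \<open>
  If \<open>q c \<equiv> A c \<cdot> (x\<^sub>j - c)\<close> modulo \<open>J\<close> for every \<open>c\<close>, then a linear dependence of the cofactors \<open>A c\<close>
  is a relation between the \<open>q c\<close> after clearing denominators. It is a substitute for the linear
  independence of the functions \<open>1 / (x\<^sub>j - c)\<close>.
\<close>

lemma vanishing_combination:
  fixes q :: "complex \<Rightarrow> complex ^ 'n::finite \<Rightarrow> complex" and k :: "complex \<Rightarrow> nat"
  assumes J: "poly_ideal J" and q: "\<And>c. q c \<in> adjoin J (\<lambda>x. x $ j - c)"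
  shows "\<exists>F \<alpha> c0. finite F \<and> c0 \<in> F \<and> \<alpha> c0 \<noteq> 0 \<and> (\<forall>c\<in>F. k c = k c0) \<and>
           (\<lambda>x. \<Sum>c\<in>F. \<alpha> c * q c x * (\<Prod>c'\<in>F - {c}. x $ j - c')) \<in> J"
proof -
  have "\<forall>c. \<exists>r\<in>polys_on UNIV. (\<lambda>x. q c x - r x * (x $ j - c)) \<in> J"
    using q by (auto simp: adjoin_def)
  then obtain A where A: "\<And>c. A c \<in> polys_on UNIV" "\<And>c. (\<lambda>x. q c x - A c x * (x $ j - c)) \<in> J"
    by metis
  obtain F \<alpha> c0 where F: "finite F" "c0 \<in> F" "\<alpha> c0 \<noteq> 0" "\<forall>c\<in>F. k c = k c0"
    and dep: "\<And>x. (\<Sum>c\<in>F. \<alpha> c * A c x) = 0"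
    using uncountable_family_dependent[of A k, OF A(1)] by (elim exE conjE) blast
  define \<pi> where "\<pi> = (\<lambda>c x :: complex ^ 'n. \<Prod>c'\<in>F - {c}. x $ j - c')"
  have "(\<lambda>x. \<Sum>c\<in>F. (\<alpha> c * \<pi> c x) * (q c x - A c x * (x $ j - c))) \<in> J"
    unfolding \<pi>_def
    by (intro poly_ideal_sum[OF J] poly_idealD(4)[OF J] A polys_on_cmult polys_on_prod polys_on_diff) auto
  moreover have "(\<Sum>c\<in>F. (\<alpha> c * \<pi> c x) * (q c x - A c x * (x $ j - c))) =
      (\<Sum>c\<in>F. \<alpha> c * q c x * \<pi> c x)" for x
  proof -
    have "\<pi> c x * (x $ j - c) = (\<Prod>c'\<in>F. x $ j - c')" if "c \<in> F" for c
      unfolding \<pi>_def using F(1) that by (simp add: prod.remove mult.commute)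
    then have "(\<Sum>c\<in>F. \<alpha> c * A c x * (\<pi> c x * (x $ j - c))) =
        (\<Sum>c\<in>F. \<alpha> c * A c x) * (\<Prod>c'\<in>F. x $ j - c')"
      by (simp add: sum_distrib_right)
    then show ?thesis
      by (simp add: dep right_diff_distrib sum_subtractf mult_ac)
  qed
  ultimately have "(\<lambda>x. \<Sum>c\<in>F. \<alpha> c * q c x * \<pi> c x) \<in> J"
    by (simp only:)
  then show ?thesis
    unfolding \<pi>_def by (intro exI[of _ F] exI[of _ \<alpha>] exI[of _ c0] conjI F)
qed

lemma prime_contains_root:
  assumes P: "prime_poly_ideal P" and "(\<lambda>x. poly p (x $ j)) \<in> P" "p \<noteq> 0"
  shows "\<exists>c. (\<lambda>x. x $ j - c) \<in> P"
  using assms(2,3)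
proof (induction "degree p" arbitrary: p rule: less_induct)
  case less
  show ?case
  proof (cases "degree p = 0")
    case True
    then obtain c where "p = [:c:]"
      using degree_eq_zeroE by blast
    then have "c = 0"
      using prime_poly_ideal_const[OF P] less.prems by simp
    then show ?thesis
      using less.prems \<open>p = [:c:]\<close> by simp
  next
    case False
    then have "\<not> constant (poly p)"
      by (simp add: constant_degree)
    then obtain c where "poly p c = 0"
      using fundamental_theorem_of_algebra by blast
    then obtain r where r: "p = [:- c, 1:] * r"
      by (auto simp: poly_eq_0_iff_dvd)
    have "r \<noteq> 0"
      using r less.prems by auto
    have pr: "(\<lambda>x. poly s (x $ j)) \<in> polys_on UNIV" for s
      by (induction s) (auto intro!: polys_on_add polys_on_mult)
    have "(\<lambda>x. (x $ j - c) * poly r (x $ j)) \<in> P"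
      using less.prems(1) by (simp add: r algebra_simps)
    then have "(\<lambda>x. x $ j - c) \<in> P \<or> (\<lambda>x. poly r (x $ j)) \<in> P"
      using pr[of r] by (intro prime_poly_idealD(3)[OF P]) auto
    moreover have "degree r < degree p"
      using \<open>r \<noteq> 0\<close> by (subst r, subst degree_mult_eq) auto
    ultimately show ?thesis
      using less.hyps[of r] \<open>r \<noteq> 0\<close> by blast
  qed
qed

text \<open>
  Enlarge \<open>J\<close> to an ideal \<open>P\<close> that is maximal among those avoiding the powers of \<open>f\<close>. If no \<open>x\<^sub>j - c\<close> were in
  \<open>P\<close>, each of them would divide a power of \<open>f\<close> modulo \<open>P\<close>; infinitely many of them divide the same power,
  and their vanishing combination puts a nonzero polynomial in \<open>x\<^sub>j\<close>, hence one of its linear factors,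
  into \<open>P\<close>. So \<open>P\<close> is the ideal of a point.
\<close>

theorem nullstellensatz:
  assumes J: "prime_poly_ideal J" and f: "f \<in> polys_on UNIV" "f \<notin> J"
  shows "\<exists>x. f x \<noteq> 0 \<and> (\<forall>g\<in>J. g x = 0)"
proof -
  define S where "S = range (\<lambda>k x. f x ^ k)"
  have S1: "(\<lambda>x. f x ^ k) \<in> S" for k
    by (auto simp: S_def)
  have "J \<inter> S = {}"
    using prime_poly_ideal_power[OF J f] by (auto simp: S_def)
  obtain P where P: "J \<subseteq> P" "prime_poly_ideal P" "P \<inter> S = {}"
    "\<And>a. a \<in> polys_on UNIV \<Longrightarrow> a \<notin> P \<Longrightarrow> adjoin P a \<inter> S \<noteq> {}"
  proof (rule prime_avoiding[OF prime_poly_idealD(1)[OF J] _ _ _ \<open>J \<inter> S = {}\<close>])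
    show "S \<subseteq> polys_on UNIV"
      using f by (auto simp: S_def)
    show "(\<lambda>x. 1) \<in> S"
      using S1[of 0] by simp
    show "(\<lambda>x. g x * h x) \<in> S" if "g \<in> S" "h \<in> S" for g h
      using that by (auto simp: S_def simp flip: power_add)
  qed blast
  note Pi = prime_poly_idealD(1)[OF P(2)]
  have "\<exists>c. (\<lambda>x. x $ j - c) \<in> P" for j
  proof (rule ccontr)
    assume no: "\<not> (\<exists>c. (\<lambda>x. x $ j - c) \<in> P)"
    have "\<exists>k. (\<lambda>x. f x ^ k) \<in> adjoin P (\<lambda>x. x $ j - c)" for c
    proof -
      have "(\<lambda>x. x $ j - c) \<in> polys_on UNIV" "(\<lambda>x. x $ j - c) \<notin> P"
        using no by auto
      then show ?thesis
        using P(4) by (fastforce simp: S_def)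
    qed
    then obtain k where k: "\<And>c. (\<lambda>x. f x ^ k c) \<in> adjoin P (\<lambda>x. x $ j - c)"
      by metis
    obtain F \<alpha> c0 where F: "finite F" "c0 \<in> F" "\<alpha> c0 \<noteq> 0" "\<forall>c\<in>F. k c = k c0"
      and comb: "(\<lambda>x. \<Sum>c\<in>F. \<alpha> c * f x ^ k c * (\<Prod>c'\<in>F - {c}. x $ j - c')) \<in> P"
      using vanishing_combination[of P _ j k, OF Pi k] by (elim exE conjE) blast
    \<comment> \<open>The combination is \<open>f\<^sup>k\<close> times this polynomial in \<open>x\<^sub>j\<close>; at \<open>c0\<close> only one summand survives.\<close>
    define p where "p = (\<Sum>c\<in>F. smult (\<alpha> c) (\<Prod>c'\<in>F - {c}. [:- c', 1:]))"
    have p: "poly p t = (\<Sum>c\<in>F. \<alpha> c * (\<Prod>c'\<in>F - {c}. t - c'))" for t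
      by (simp add: p_def poly_sum poly_prod)
    have "(\<Sum>c\<in>F. \<alpha> c * f x ^ k c * (\<Prod>c'\<in>F - {c}. x $ j - c')) = f x ^ k c0 * poly p (x $ j)" for x
      unfolding p sum_distrib_left using F(4) by (intro sum.cong) (auto simp: mult_ac)
    then have "(\<lambda>x. f x ^ k c0 * poly p (x $ j)) \<in> P"
      using comb by simp
    moreover have "(\<lambda>x. poly p (x $ j)) \<in> polys_on UNIV"
      unfolding p by (intro polys_on_sum polys_on_cmult polys_on_prod polys_on_diff) auto
    ultimately have "(\<lambda>x. poly p (x $ j)) \<in> P"
      using prime_poly_idealD(3)[OF P(2), of "\<lambda>x. f x ^ k c0"] f(1) S1[of "k c0"] P(3) by auto
    moreover have "p \<noteq> 0"
    proof -
      have "poly p c0 = (\<Sum>c\<in>F. if c = c0 then \<alpha> c0 * (\<Prod>c'\<in>F - {c0}. c0 - c') else 0)"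
        unfolding p using F(1,2) by (intro sum.cong) auto
      then have "poly p c0 \<noteq> 0"
        using F by auto
      then show ?thesis
        by auto
    qed
    ultimately show False
      using prime_contains_root[OF P(2)] no by blast
  qed
  then obtain a where a: "\<And>j. (\<lambda>x. x $ j - a j) \<in> P"
    by metis
  define x0 where "x0 = (\<chi> j. a j)"
  have ev: "(\<lambda>x. g x - g x0) \<in> P" if "g \<in> polys_on UNIV" for g
    using that
  proof (induction rule: polys_on_induct)
    case (const c)
    then show ?case using poly_idealD(2)[OF Pi] by simp
  next
    case (coord i)
    then show ?case using a[of i] by (simp add: x0_def)
  next
    case (add g h)
    show ?case
      using poly_idealD(3)[OF Pi add.IH] by (simp add: algebra_simps)
  next
    case (mult g h)
    have "(\<lambda>x. h x * (g x - g x0) + g x0 * (h x - h x0)) \<in> P"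
      by (intro poly_idealD(3)[OF Pi] poly_idealD(4)[OF Pi] mult) auto
    then show ?case
      by (simp add: algebra_simps)
  qed
  have "g x0 = 0" if "g \<in> P" for g
  proof -
    have "(\<lambda>x. g x - (g x - g x0)) \<in> P"
      by (intro poly_ideal_diff[OF Pi] that ev poly_idealD(1)[OF Pi that])
    then show ?thesis
      using prime_poly_ideal_const[OF P(2)] by simp
  qed
  moreover have "f x0 \<noteq> 0"
  proof
    assume "f x0 = 0"
    then have "f \<in> P"
      using ev[OF f(1)] by simp
    then show False
      using S1[of 1] P(3) by auto
  qed
  ultimately show ?thesis
    using P(1) by blast
qed

section \<open>Dimension\<close>

lemma zariski_closed_separates:
  assumes "zariski_closed A" "x \<notin> A"
  shows "\<exists>f\<in>polys_on UNIV. f x \<noteq> 0 \<and> (\<forall>y\<in>A. f y = 0)"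
  using assms by (auto simp: zariski_closed_def zeros_def polys_UNIV)

lemma prime_set_imp_irreducible:
  assumes "prime_set V" "zariski_closed V"
  shows "irreducible_variety V"
  unfolding irreducible_variety_def
proof (intro conjI allI impI)
  show "V \<noteq> {}" "zariski_closed V"
    using assms by (auto simp: prime_set_def)
  fix A B assume A: "zariski_closed A" and B: "zariski_closed B" and AB: "V = A \<union> B"
  show "V = A \<or> V = B"
  proof (rule ccontr)
    assume "\<not> (V = A \<or> V = B)"
    then obtain a b where a: "a \<in> V" "a \<notin> A" and b: "b \<in> V" "b \<notin> B"
      using AB by blast
    obtain f where f: "f \<in> polys_on UNIV" "f a \<noteq> 0" "\<And>x. x \<in> A \<Longrightarrow> f x = 0"
      using zariski_closed_separates[OF A a(2)] by blast
    obtain g where g: "g \<in> polys_on UNIV" "g b \<noteq> 0" "\<And>x. x \<in> B \<Longrightarrow> g x = 0"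
      using zariski_closed_separates[OF B b(2)] by blast
    show False
      using prime_set_common[OF assms(1) f(1) g(1) a(1) f(2) b(1) g(2)] AB f(3) g(3) by auto
  qed
qed

lemma zeros_prime_irreducible:
  assumes J: "prime_poly_ideal J"
  shows "irreducible_variety (zeros J)"
proof (rule prime_set_imp_irreducible)
  note Ji = prime_poly_idealD(1)[OF J]
  show "zariski_closed (zeros J)"
    using poly_idealD(1)[OF Ji] by (auto simp: zariski_closed_def polys_UNIV)
  have "zeros J \<noteq> {}"
    using nullstellensatz[OF J, of "\<lambda>_. 1"] prime_poly_idealD(2)[OF J] by (auto simp: zeros_def)
  moreover have mem: "f \<in> J \<longleftrightarrow> (\<forall>x\<in>zeros J. f x = 0)" if "f \<in> polys_on UNIV" for f
    using nullstellensatz[OF J that] by (auto simp: zeros_def)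
  have "(\<forall>x\<in>zeros J. f x = 0) \<or> (\<forall>x\<in>zeros J. g x = 0)"
    if f: "f \<in> polys_on UNIV" and g: "g \<in> polys_on UNIV" and fg: "\<forall>x\<in>zeros J. f x * g x = 0" for f g
    using prime_poly_idealD(3)[OF J f g] mem[OF polys_on_mult[OF f g]] fg mem[OF f] mem[OF g] by blast
  ultimately show "prime_set (zeros J)"
    by (simp add: prime_set_def)
qed

definition independent_on :: "(complex ^ 'n::finite) set \<Rightarrow> 'n set \<Rightarrow> bool" where
  "independent_on V S \<longleftrightarrow> (\<forall>f\<in>polys_on S. (\<forall>x\<in>V. f x = 0) \<longrightarrow> (\<forall>x. f x = 0))"

text \<open>
  For some \<open>c\<close> the ideal \<open>J + (x\<^sub>j - c)\<close> still contains no nonzero polynomial in the remaining independent coordinates,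
  because otherwise a vanishing combination would be a nonzero element of \<open>J\<close> in the independent
  coordinates. A prime avoiding those polynomials is the next member of the chain, and the
  Nullstellensatz turns primes into irreducible sets.
\<close>

lemma prime_chain:
  fixes T :: "'n::finite set"
  assumes "prime_poly_ideal J" and "\<And>f x. f \<in> J \<Longrightarrow> f \<in> polys_on T \<Longrightarrow> f x = 0"
  shows "\<exists>Z :: nat \<Rightarrow> (complex ^ 'n) set. (\<forall>i\<le>card T. irreducible_variety (Z i) \<and> Z i \<subseteq> zeros J) \<and>
     (\<forall>i<card T. Z i \<subset> Z (Suc i))"
proof -
  have "finite T" by simp
  then show ?thesis using assms
  proof (induction T arbitrary: J rule: finite_induct)
    case empty
    then show ?case
      using zeros_prime_irreducible by (intro exI[of _ "\<lambda>_. zeros J"]) auto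
  next
    case (insert j T)
    note Ji = prime_poly_idealD(1)[OF insert.prems(1)]
    define S :: "(complex ^ 'n \<Rightarrow> complex) set" where "S = {f \<in> polys_on T. \<exists>x. f x \<noteq> 0}"
    have "\<exists>c. adjoin J (\<lambda>x. x $ j - c) \<inter> S = {}"
    proof (rule ccontr)
      assume "\<not> ?thesis"
      then have "\<forall>c. \<exists>q\<in>S. q \<in> adjoin J (\<lambda>x. x $ j - c)"
        by blast
      then obtain q where q: "\<And>c. q c \<in> S" "\<And>c. q c \<in> adjoin J (\<lambda>x. x $ j - c)"
        by metis
      obtain F \<alpha> c0 where F: "finite F" "c0 \<in> F" "\<alpha> c0 \<noteq> 0"
        and comb: "(\<lambda>x. \<Sum>c\<in>F. \<alpha> c * q c x * (\<Prod>c'\<in>F - {c}. x $ j - c')) \<in> J"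
        using vanishing_combination[of J q j "\<lambda>_. 0", OF Ji q(2)] by (elim exE conjE) blast
      obtain x1 where x1: "q c0 x1 \<noteq> 0"
        using q(1)[of c0] by (auto simp: S_def)
      \<comment> \<open>At \<open>x\<^sub>j = c0\<close> all summands but one vanish.\<close>
      define x where "x = (\<chi> i. if i = j then c0 else x1 $ i)"
      have "q c0 x = q c0 x1"
        using q(1)[of c0] insert.hyps by (intro polys_on_cong[of "q c0" T x x1]) (auto simp: S_def x_def)
      have "(\<Sum>c\<in>F. \<alpha> c * q c x * (\<Prod>c'\<in>F - {c}. x $ j - c')) = 0"
      proof (rule insert.prems(2)[OF comb])
        show "(\<lambda>x. \<Sum>c\<in>F. \<alpha> c * q c x * (\<Prod>c'\<in>F - {c}. x $ j - c')) \<in> polys_on (insert j T)"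
          using q(1) by (intro polys_on_sum polys_on_mult polys_on_cmult polys_on_prod polys_on_diff)
            (auto simp: S_def intro: polys_on_mono)
      qed
      also have "(\<Sum>c\<in>F. \<alpha> c * q c x * (\<Prod>c'\<in>F - {c}. x $ j - c')) =
          (\<Sum>c\<in>F. if c = c0 then \<alpha> c0 * q c0 x * (\<Prod>c'\<in>F - {c0}. c0 - c') else 0)"
        using F(1,2) by (intro sum.cong) (auto simp: x_def)
      finally show False
        using F x1 \<open>q c0 x = q c0 x1\<close> by auto
    qed
    then obtain c where c: "adjoin J (\<lambda>x. x $ j - c) \<inter> S = {}"
      by blast
    define a where "a = (\<lambda>x :: complex ^ 'n. x $ j - c)"
    have a: "a \<in> polys_on (insert j T)" "a \<in> polys_on UNIV"
      by (auto simp: a_def)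
    obtain P where P: "adjoin J a \<subseteq> P" "prime_poly_ideal P" "P \<inter> S = {}"
    proof (rule prime_avoiding[OF adjoin_ideal(1)[OF Ji a(2)]])
      show "adjoin J a \<inter> S = {}"
        using c by (simp add: a_def)
      show "S \<subseteq> polys_on UNIV"
        by (auto simp: S_def intro: polys_on_mono)
      show "(\<lambda>x. 1) \<in> S"
        by (auto simp: S_def)
      show "(\<lambda>x. g x * h x) \<in> S" if "g \<in> S" "h \<in> S" for g h
        using that polys_no_zero_divisors[of g T h T] by (auto simp: S_def)
    qed blast
    have "f x = 0" if "f \<in> P" "f \<in> polys_on T" for f x
      using that P(3) by (auto simp: S_def)
    then obtain Z where Z: "\<And>i. i \<le> card T \<Longrightarrow> irreducible_variety (Z i)"
        "\<And>i. i \<le> card T \<Longrightarrow> Z i \<subseteq> zeros P" "\<And>i. i < card T \<Longrightarrow> Z i \<subset> Z (Suc i)"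
      using insert.IH[OF P(2)] by blast
    have "J \<subseteq> P" "a \<in> P"
      using P(1) adjoin_ideal[OF Ji a(2)] by auto
    have "a (axis j (c + 1)) \<noteq> 0"
      by (simp add: a_def axis_def)
    then have "a \<notin> J"
      using insert.prems(2)[of a] a by blast
    then obtain x where "a x \<noteq> 0" "x \<in> zeros J"
      using nullstellensatz[OF insert.prems(1) a(2)] by (auto simp: zeros_def)
    then have strict: "zeros P \<subset> zeros J"
      using \<open>J \<subseteq> P\<close> \<open>a \<in> P\<close> by (auto simp: zeros_def)
    define Z' where "Z' = Z(Suc (card T) := zeros J)"
    have "irreducible_variety (Z' i) \<and> Z' i \<subseteq> zeros J" if "i \<le> Suc (card T)" for i
      using that Z(1,2)[of i] strict zeros_prime_irreducible[OF insert.prems(1)]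
      by (cases "i = Suc (card T)") (auto simp: Z'_def)
    moreover have "Z' i \<subset> Z' (Suc i)" if "i < Suc (card T)" for i
      using that Z(2)[of i] Z(3)[of i] strict by (cases "i = card T") (auto simp: Z'_def)
    ultimately show ?case
      using insert.hyps by (intro exI[of _ Z']) auto
  qed
qed

definition algebraic_over :: "(complex ^ 'n::finite) set \<Rightarrow> 'n set \<Rightarrow> 'n \<Rightarrow> bool" where
  "algebraic_over V K j \<longleftrightarrow> (\<exists>D c. (\<forall>i. c i \<in> polys_on K) \<and>
     (\<forall>x\<in>V. (\<Sum>i\<le>D. c i x * x $ j ^ i) = 0) \<and> (\<exists>x\<in>V. c D x \<noteq> 0))"

definition transcendence_basis :: "(complex ^ 'n::finite) set \<Rightarrow> 'n set \<Rightarrow> bool" where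
  "transcendence_basis V S \<longleftrightarrow> independent_on V S \<and> (\<forall>j. j \<notin> S \<longrightarrow> algebraic_over V S j)"

lemma algebraic_over_mono: "algebraic_over V K j \<Longrightarrow> K \<subseteq> L \<Longrightarrow> algebraic_over V L j"
  unfolding algebraic_over_def by (meson polys_on_mono)

text \<open>
  Terms whose coefficient vanishes on \<open>V\<close> can be dropped from the top of a relation.
\<close>

lemma algebraic_over_truncate:
  assumes "\<And>i. c i \<in> polys_on K" "\<And>x. x \<in> V \<Longrightarrow> (\<Sum>i\<le>D. c i x * x $ j ^ i) = 0"
    and "k \<le> D" "x0 \<in> V" "c k x0 \<noteq> 0"
  shows "\<exists>D'\<le>D. (\<forall>x\<in>V. (\<Sum>i\<le>D'. c i x * x $ j ^ i) = 0) \<and> (\<exists>x\<in>V. c D' x \<noteq> 0)"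
proof -
  define D' where "D' = (GREATEST i. i \<le> D \<and> (\<exists>x\<in>V. c i x \<noteq> 0))"
  have D': "D' \<le> D" "\<exists>x\<in>V. c D' x \<noteq> 0"
    using GreatestI_nat[of "\<lambda>i. i \<le> D \<and> (\<exists>x\<in>V. c i x \<noteq> 0)" k D] assms(3-) by (auto simp: D'_def)
  have z: "c i x = 0" if "D' < i" "i \<le> D" "x \<in> V" for i x
    using Greatest_le_nat[of "\<lambda>i. i \<le> D \<and> (\<exists>x\<in>V. c i x \<noteq> 0)" i D] that by (force simp: D'_def)
  have "(\<Sum>i\<le>D'. c i x * x $ j ^ i) = (\<Sum>i\<le>D. c i x * x $ j ^ i)" if "x \<in> V" for x
    using D'(1) z that by (intro sum.mono_neutral_left) auto
  then show ?thesis
    using D' assms(2) by (intro exI[of _ D']) auto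
qed

lemma transcendence_basis_exists:
  fixes V :: "(complex ^ 'n::finite) set"
  assumes V: "V \<noteq> {}"
  shows "\<exists>S. transcendence_basis V S"
proof -
  have "f x = 0" if "f \<in> polys_on {}" "\<forall>x\<in>V. f x = 0" for f x
  proof -
    obtain y where "y \<in> V" using V by auto
    then show ?thesis
      using polys_on_cong[OF that(1), of x y] that(2) by simp
  qed
  then have "independent_on V {}"
    by (auto simp: independent_on_def)
  have "finite {S. independent_on V S}"
    by simp
  with \<open>independent_on V {}\<close> obtain S where S: "independent_on V S"
    and max: "\<And>S'. independent_on V S' \<Longrightarrow> S \<subseteq> S' \<Longrightarrow> S' = S"
    using finite_has_maximal2[of "{S. independent_on V S}" "{}"] by auto
  have "algebraic_over V S j" if j: "j \<notin> S" for j
  proof -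
    have "\<not> independent_on V (insert j S)"
      using max[of "insert j S"] j by auto
    then obtain f x1 where f: "f \<in> polys_on (insert j S)" "\<And>x. x \<in> V \<Longrightarrow> f x = 0" "f x1 \<noteq> 0"
      by (auto simp: independent_on_def)
    obtain M c where c: "\<And>i. c i \<in> polys_on S" "\<And>x. f x = (\<Sum>i\<le>M. c i x * x $ j ^ i)"
      using polys_on_insert_expand[OF f(1)] by (elim exE conjE) blast
    have "\<exists>i\<le>M. c i x1 \<noteq> 0"
    proof (rule ccontr)
      assume "\<not> (\<exists>i\<le>M. c i x1 \<noteq> 0)"
      then have "f x1 = 0" unfolding c(2) by (intro sum.neutral) auto
      then show False using f by simp
    qed
    then obtain k where "k \<le> M" "c k x1 \<noteq> 0"
      by blast
    then obtain x0 where "x0 \<in> V" "c k x0 \<noteq> 0"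
      using S c(1)[of k] by (auto simp: independent_on_def)
    have "(\<Sum>i\<le>M. c i x * x $ j ^ i) = 0" if "x \<in> V" for x
      using f(2)[OF that] by (simp only: c(2))
    from algebraic_over_truncate[OF c(1) this \<open>k \<le> M\<close> \<open>x0 \<in> V\<close> \<open>c k x0 \<noteq> 0\<close>]
    show ?thesis
      unfolding algebraic_over_def using c(1) by blast
  qed
  then show ?thesis
    using S by (auto simp: transcendence_basis_def)
qed

lemma growth_algebraic_extension:
  assumes V: "prime_set V" and K: "growth V K d"
    and alg: "\<And>j. j \<in> L - K \<Longrightarrow> algebraic_over V K j"
  shows "growth V (K \<union> L) d"
proof -
  have "finite (L - K)" by simp
  then have "growth V (K \<union> (L - K)) d"
    using alg
  proof (induction "L - K" arbitrary: L rule: finite_induct)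
    case empty
    then show ?case using K by (metis Un_empty_right)
  next
    case (insert j F)
    have F: "F = (L - {j}) - K" "j \<in> L - K"
      using insert.hyps by auto
    then have "growth V (K \<union> (L - {j} - K)) d"
      using insert by blast
    moreover have "algebraic_over V (K \<union> (L - {j} - K)) j"
      using insert.prems[OF F(2)] by (rule algebraic_over_mono) auto
    then obtain D c x0 where c: "\<And>i. c i \<in> polys_on (K \<union> (L - {j} - K))"
      "\<And>x. x \<in> V \<Longrightarrow> (\<Sum>i\<le>D. c i x * x $ j ^ i) = 0" "x0 \<in> V" "c D x0 \<noteq> 0"
      unfolding algebraic_over_def by (elim exE conjE bexE) blast
    ultimately have "growth V (insert j (K \<union> (L - {j} - K))) d"
      by (intro growth_algebraic[OF V, of _ d D c j x0]) auto
    moreover have "insert j (K \<union> (L - {j} - K)) = K \<union> (L - K)"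
      using F by auto
    ultimately show ?case by simp
  qed
  then show ?thesis by simp
qed

lemma growth_transcendence_basis:
  assumes V: "prime_set V" and S: "transcendence_basis V S"
  shows "growth V UNIV (card S)"
proof -
  have "growth V (S \<union> UNIV) (card S)"
    using S V by (intro growth_algebraic_extension[OF V] growth_card)
      (auto simp: transcendence_basis_def prime_set_def)
  then show ?thesis by simp
qed

text \<open>
  Dimension drops on proper closed subsets: by \<open>algebraic_relation\<close>, if \<open>f\<close> vanishes on \<open>W\<close> and not on \<open>V\<close>,
  then at least \<open>d\<close> coordinates satisfy a nontrivial relation on \<open>W\<close>. The inclusion of \<open>W\<close> in the closure
  of \<open>V\<close> is expressed by the vanishing ideals, since \<open>W\<close> need not be contained in \<open>V\<close>.
\<close>

lemma independent_card_less:
  fixes V W :: "(complex ^ 'n::finite) set"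
  assumes V: "prime_set V" and gr: "growth V UNIV d"
    and sub: "\<And>g. g \<in> polys_on UNIV \<Longrightarrow> (\<And>x. x \<in> V \<Longrightarrow> g x = 0) \<Longrightarrow> (\<And>x. x \<in> W \<Longrightarrow> g x = 0)"
    and f: "f \<in> polys_on UNIV" "\<And>x. x \<in> W \<Longrightarrow> f x = 0" "x0 \<in> V" "f x0 \<noteq> 0"
    and T: "independent_on W T"
  shows "card T < d"
proof (rule ccontr)
  assume "\<not> card T < d"
  then have "d \<le> card T" by simp
  from algebraic_relation[OF V gr this, of "\<lambda>x. x" f x0]
  obtain Q R u where Q: "Q \<in> polys_on T" "R \<in> polys_on UNIV" "Q u \<noteq> 0"
    and rel: "\<And>x. x \<in> V \<Longrightarrow> Q x + f x * R x = 0"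
    using f by auto
  have "(\<lambda>x. Q x + f x * R x) \<in> polys_on UNIV"
    by (intro polys_on_add polys_on_mult polys_on_mono[OF Q(1)] f(1) Q(2)) auto
  from sub[OF this rel] have "Q x = 0" if "x \<in> W" for x
    using f(2)[OF that] that by fastforce
  then show False
    using T Q by (auto simp: independent_on_def)
qed

lemma irreducible_imp_prime_set:
  assumes "irreducible_variety V"
  shows "prime_set V"
  unfolding prime_set_def
proof (intro conjI ballI impI)
  show "V \<noteq> {}"
    using assms by (simp add: irreducible_variety_def)
  fix f g :: "complex ^ 'a \<Rightarrow> complex"
  assume f: "f \<in> polys_on UNIV" and g: "g \<in> polys_on UNIV" and fg: "\<forall>x\<in>V. f x * g x = 0"
  obtain F where F: "F \<subseteq> polys_on UNIV" "V = zeros F"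
    using assms by (auto simp: irreducible_variety_def zariski_closed_def polys_UNIV)
  have "zariski_closed (zeros (insert h F))" if "h \<in> polys_on UNIV" for h
    unfolding zariski_closed_def polys_UNIV using F that by (intro exI[of _ "insert h F"]) auto
  moreover have "V = zeros (insert f F) \<union> zeros (insert g F)"
    using fg F by (auto simp: zeros_def)
  ultimately have "V = zeros (insert f F) \<or> V = zeros (insert g F)"
    using assms f g unfolding irreducible_variety_def by blast
  then show "(\<forall>x\<in>V. f x = 0) \<or> (\<forall>x\<in>V. g x = 0)"
    by (auto simp: zeros_def)
qed

lemma zeros_vanishing_ideal:
  assumes "zariski_closed V"
  shows "zeros (vanishing_ideal V) = V"
  using assms unfolding zariski_closed_def zeros_def vanishing_ideal_def by blast

lemma vanishing_ideal_prime:
  assumes "prime_set V"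
  shows "prime_poly_ideal (vanishing_ideal V)"
  unfolding prime_poly_ideal_def poly_ideal_def
proof (intro conjI ballI impI)
  show "(\<lambda>x. 1) \<notin> vanishing_ideal V"
    using assms by (auto simp: prime_set_def vanishing_ideal_def)
  fix f g :: "complex ^ 'a \<Rightarrow> complex"
  assume "f \<in> polys_on UNIV" "g \<in> polys_on UNIV" "(\<lambda>x. f x * g x) \<in> vanishing_ideal V"
  then show "f \<in> vanishing_ideal V \<or> g \<in> vanishing_ideal V"
    using assms by (auto simp: prime_set_def vanishing_ideal_def polys_UNIV)
qed (auto simp: vanishing_ideal_def polys_UNIV)

lemma chain_length_bound:
  fixes Z :: "nat \<Rightarrow> (complex ^ 'n::finite) set"
  assumes irr: "\<And>i. i \<le> d \<Longrightarrow> irreducible_variety (Z i)" and strict: "\<And>i. i < d \<Longrightarrow> Z i \<subset> Z (Suc i)"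
    and S: "transcendence_basis (Z d) S"
  shows "d \<le> card S"
  using assms
proof (induction d arbitrary: S)
  case (Suc d)
  have p: "prime_set (Z i)" if "i \<le> Suc d" for i
    using Suc.prems(1)[OF that] by (rule irreducible_imp_prime_set)
  then have "Z d \<noteq> {}"
    by (simp add: prime_set_def)
  then obtain T where T: "transcendence_basis (Z d) T"
    using transcendence_basis_exists by blast
  have "d \<le> card T"
    using Suc.IH[OF _ _ T] Suc.prems by auto
  obtain x0 where x0: "x0 \<in> Z (Suc d)" "x0 \<notin> Z d"
    using Suc.prems(2)[of d] by auto
  have "zariski_closed (Z d)"
    using Suc.prems(1)[of d] by (auto simp: irreducible_variety_def)
  then obtain f where f: "f \<in> polys_on UNIV" "f x0 \<noteq> 0" "\<And>x. x \<in> Z d \<Longrightarrow> f x = 0"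
    using zariski_closed_separates[OF _ x0(2)] by blast
  have "card T < card S"
  proof (rule independent_card_less[OF p growth_transcendence_basis[OF p Suc.prems(3)] _ f(1) f(3) x0(1) f(2)])
    show "independent_on (Z d) T"
      using T by (simp add: transcendence_basis_def)
    show "g x = 0" if "\<And>x. x \<in> Z (Suc d) \<Longrightarrow> g x = 0" "x \<in> Z d" for g x
      using that Suc.prems(2)[of d] by auto
  qed auto
  then show ?case
    using \<open>d \<le> card T\<close> by simp
qed simp

text \<open>
  The inequality between transcendence degree and Krull dimension that makes general points nonsingular.
  The bound on chain lengths enters because the supremum of an unbounded set of natural numbers is
  an unspecified number.
\<close>

lemma independent_le_variety_dim:
  fixes V :: "(complex ^ 'n::finite) set"
  assumes V: "irreducible_variety V" and T: "independent_on V T"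
  shows "card T \<le> variety_dim V"
proof -
  have p: "prime_set V"
    using V by (rule irreducible_imp_prime_set)
  define \<D> where "\<D> = {d. \<exists>Z :: nat \<Rightarrow> (complex ^ 'n) set.
      (\<forall>i\<le>d. irreducible_variety (Z i) \<and> Z i \<subseteq> V) \<and> (\<forall>i<d. Z i \<subset> Z (Suc i))}"
  have "d \<le> CARD('n)" if dD: "d \<in> \<D>" for d
  proof -
    obtain Z :: "nat \<Rightarrow> (complex ^ 'n) set" where
      Z: "\<forall>i\<le>d. irreducible_variety (Z i) \<and> Z i \<subseteq> V" "\<forall>i<d. Z i \<subset> Z (Suc i)"
      using dD unfolding \<D>_def by blast
    have "Z d \<noteq> {}"
      using Z(1) by (auto simp: irreducible_variety_def)
    then obtain S where "transcendence_basis (Z d) S"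
      using transcendence_basis_exists by blast
    then have "d \<le> card S"
      using chain_length_bound[where d = d and Z = Z and S = S] Z by auto
    also have "card S \<le> CARD('n)"
      by (rule card_mono) auto
    finally show ?thesis .
  qed
  then have "bdd_above \<D>"
    by (intro bdd_aboveI[of _ "CARD('n)"])
  moreover have "card T \<in> \<D>"
  proof -
    have "zeros (vanishing_ideal V) = V"
      using V by (intro zeros_vanishing_ideal) (auto simp: irreducible_variety_def)
    moreover have "f x = 0" if "f \<in> vanishing_ideal V" "f \<in> polys_on T" for f x
      using that T by (auto simp: independent_on_def vanishing_ideal_def)
    ultimately show ?thesis
      using prime_chain[OF vanishing_ideal_prime[OF p], of T] by (simp add: \<D>_def)
  qed
  ultimately show ?thesis
    unfolding variety_dim_def \<D>_def[symmetric] by (rule cSup_upper[rotated])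
qed

section \<open>Polynomial vector fields tangent to a variety\<close>

definition poly_field :: "(complex ^ 'n::finite \<Rightarrow> complex ^ 'm::finite) \<Rightarrow> bool" where
  "poly_field w \<longleftrightarrow> (\<forall>i. (\<lambda>x. w x $ i) \<in> polys_on UNIV)"

text \<open>
  For \<open>K = UNIV\<close>, the derivation along \<open>w\<close> preserves the vanishing ideal of \<open>V\<close>, so \<open>w\<close> is tangent to \<open>V\<close> at
  every point of \<open>V\<close>. For smaller \<open>K\<close> this is asked only of the elimination ideal, so \<open>w\<close> is tangent to the
  projection of \<open>V\<close> to the coordinates in \<open>K\<close>.
\<close>

definition tangent_field :: "(complex ^ 'n::finite) set \<Rightarrow> 'n set \<Rightarrow> (complex ^ 'n \<Rightarrow> complex ^ 'n) \<Rightarrow> bool" where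
  "tangent_field V K w \<longleftrightarrow>
     (\<forall>f\<in>polys_on K. (\<forall>x\<in>V. f x = 0) \<longrightarrow> (\<forall>x\<in>V. bform (gradient f x) (w x) = 0))"

lemma polys_on_bform:
  assumes "poly_field a" "poly_field b"
  shows "(\<lambda>x. bform (a x) (b x)) \<in> polys_on UNIV"
  using assms unfolding bform_def poly_field_def by (intro polys_on_sum polys_on_mult) auto

lemma poly_field_gradient: "f \<in> polys_on K \<Longrightarrow> poly_field (gradient f)"
  unfolding poly_field_def by (auto intro: polys_on_mono polys_on_gradient)

lemma poly_field_scale:
  "g \<in> polys_on UNIV \<Longrightarrow> poly_field w \<Longrightarrow> poly_field (\<lambda>x. g x *s w x)"
  by (auto simp: poly_field_def)

lemma tangent_field_scale:
  "tangent_field V K w \<Longrightarrow> tangent_field V K (\<lambda>x. g x *s w x)"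
  by (auto simp: tangent_field_def bform_linear)

lemma bform_gradient_cong:
  assumes "f \<in> polys_on K" "\<And>i. i \<in> K \<Longrightarrow> v $ i = c * w $ i"
  shows "bform (gradient f x) v = c * bform (gradient f x) w"
  unfolding bform_def sum_distrib_left
proof (rule sum.cong[OF refl])
  fix i
  show "gradient f x $ i * v $ i = c * (gradient f x $ i * w $ i)"
    using assms gradient_outside[OF assms(1), of i x] by (cases "i \<in> K") auto
qed

lemma gradient_expansion:
  assumes c: "\<And>i. c i \<in> polys_on K"
  shows "bform (gradient (\<lambda>x. \<Sum>i\<le>D. c i x * x $ j ^ i) x) v =
    (\<Sum>i\<le>D. bform (gradient (c i) x) v * x $ j ^ i) +
    (\<Sum>i\<le>D. of_nat i * c i x * x $ j ^ (i - 1)) * v $ j"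
proof -
  have c': "c i \<in> polys_on UNIV" for i
    using c by (rule polys_on_mono) auto
  have "gradient (\<lambda>x. c i x * x $ j ^ i) x =
      x $ j ^ i *s gradient (c i) x + c i x *s ((of_nat i * x $ j ^ (i - 1)) *s axis j 1)" for i
    by (subst gradient_mult[where L = UNIV, OF c])
      (auto simp: gradient_power[where K = UNIV] gradient_coord)
  moreover have "gradient (\<lambda>x. \<Sum>i\<le>D. c i x * x $ j ^ i) x =
      (\<Sum>i\<le>D. gradient (\<lambda>x. c i x * x $ j ^ i) x)"
    by (intro gradient_sum[where K = UNIV] polys_on_mult polys_on_power polys_on_coord c') auto
  ultimately have "gradient (\<lambda>x. \<Sum>i\<le>D. c i x * x $ j ^ i) x = (\<Sum>i\<le>D.
      x $ j ^ i *s gradient (c i) x + c i x *s ((of_nat i * x $ j ^ (i - 1)) *s axis j 1))"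
    by simp
  then show ?thesis
    by (simp add: bform_commute[of _ v] bform_sum_right bform_linear sum.distrib sum_distrib_left sum_distrib_right mult_ac)
qed

text \<open>
  A relation of least degree plays the role of the minimal polynomial of \<open>x\<^sub>j\<close>. Relations of
  smaller degree have all their coefficients in the vanishing ideal. In particular the derivative in
  the direction of \<open>x\<^sub>j\<close> does not vanish on \<open>V\<close>: here characteristic 0 is used.
\<close>

lemma minimal_relation:
  fixes V :: "(complex ^ 'n::finite) set"
  assumes "algebraic_over V K j"
  shows "\<exists>D c. D \<ge> 1 \<and> (\<forall>i. c i \<in> polys_on K) \<and> (\<forall>x\<in>V. (\<Sum>i\<le>D. c i x * x $ j ^ i) = 0) \<and>
    (\<exists>x\<in>V. c D x \<noteq> 0) \<and> (\<exists>x\<in>V. (\<Sum>i\<le>D. of_nat i * c i x * x $ j ^ (i - 1)) \<noteq> 0) \<and>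
    (\<forall>e<D. \<forall>b. (\<forall>i. b i \<in> polys_on K) \<longrightarrow> (\<forall>x\<in>V. (\<Sum>i\<le>e. b i x * x $ j ^ i) = 0) \<longrightarrow>
      (\<forall>i\<le>e. \<forall>x\<in>V. b i x = 0))"
proof -
  define R where "R = (\<lambda>D c. (\<forall>i. c i \<in> polys_on K) \<and>
     (\<forall>x\<in>V. (\<Sum>i\<le>D. c i x * x $ j ^ i) = 0) \<and> (\<exists>x\<in>V. c D x \<noteq> 0))"
  define D where "D = (LEAST D. \<exists>c. R D c)"
  have "\<exists>D c. R D c"
    using assms by (simp add: algebraic_over_def R_def)
  then have "\<exists>c. R D c"
    unfolding D_def by (rule LeastI_ex)
  then obtain c where c: "R D c" by blast
  have least: "\<not> R e b" if "e < D" for e b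
    using not_less_Least[of e "\<lambda>D. \<exists>c. R D c"] that unfolding D_def by blast
  have cK: "\<And>i. c i \<in> polys_on K" and rel: "\<And>x. x \<in> V \<Longrightarrow> (\<Sum>i\<le>D. c i x * x $ j ^ i) = 0"
    and top: "\<exists>x\<in>V. c D x \<noteq> 0"
    using c by (simp_all add: R_def)
  have "D \<noteq> 0"
    using rel top by (intro notI) auto
  then obtain D' where D': "D = Suc D'" by (cases D) auto
  have sep: "\<exists>x\<in>V. (\<Sum>i\<le>D. of_nat i * c i x * x $ j ^ (i - 1)) \<noteq> 0"
  proof (rule ccontr)
    assume "\<not> ?thesis"
    then have "\<And>x. x \<in> V \<Longrightarrow> (\<Sum>i\<le>D'. of_nat (Suc i) * c (Suc i) x * x $ j ^ i) = 0"
      unfolding D' sum.atMost_Suc_shift by simp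
    moreover have "\<exists>x\<in>V. of_nat (Suc D') * c (Suc D') x \<noteq> 0"
      using top unfolding D' by (metis mult_eq_0_iff of_nat_eq_0_iff nat.simps(3))
    ultimately have "R D' (\<lambda>i x. of_nat (Suc i) * c (Suc i) x)"
      unfolding R_def using cK by blast
    then show False using least[of D'] D' by blast
  qed
  have min: "b i x = 0" if e: "e < D" and b: "\<And>i. b i \<in> polys_on K"
      "\<And>x. x \<in> V \<Longrightarrow> (\<Sum>i\<le>e. b i x * x $ j ^ i) = 0" and i: "i \<le> e" "x \<in> V" for e b i x
  proof (rule ccontr)
    assume "b i x \<noteq> 0"
    then obtain e' where "e' \<le> e" "R e' b"
      using algebraic_over_truncate[OF b i] b(1) unfolding R_def by blast
    then show False
      using least[of e' b] e by simp
  qed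
  have "D \<ge> 1"
    using \<open>D \<noteq> 0\<close> by simp
  moreover have "\<forall>e<D. \<forall>b. (\<forall>i. b i \<in> polys_on K) \<longrightarrow> (\<forall>x\<in>V. (\<Sum>i\<le>e. b i x * x $ j ^ i) = 0) \<longrightarrow>
      (\<forall>i\<le>e. \<forall>x\<in>V. b i x = 0)"
    using min by blast
  moreover have "\<forall>i. c i \<in> polys_on K" "\<forall>x\<in>V. (\<Sum>i\<le>D. c i x * x $ j ^ i) = 0"
    using cK rel by blast+
  ultimately show ?thesis
    by (intro exI[of _ D] exI[of _ c] conjI top sep)
qed

text \<open>
  Derivations extend along separable extensions. If \<open>x\<^sub>j\<close> is transcendental, any value of the new component
  does. If it satisfies the minimal relation \<open>P\<close>, the condition that the derivative of \<open>P\<close> vanishes determines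
  the new component up to the factor \<open>s = \<partial>P / \<partial>x\<^sub>j\<close>, by which the field is multiplied to keep it polynomial.
\<close>

lemma tangent_field_extend_step:
  fixes V :: "(complex ^ 'n::finite) set"
  assumes V: "prime_set V" and w: "poly_field w" "tangent_field V K w" and j: "j \<notin> K"
  shows "\<exists>g\<in>polys_on UNIV. \<exists>w'. (\<exists>x\<in>V. g x \<noteq> 0) \<and> poly_field w' \<and>
    (\<forall>i\<in>K. \<forall>x. w' x $ i = g x * w x $ i) \<and> tangent_field V (insert j K) w'"
proof (cases "algebraic_over V K j")
  case False
  have "bform (gradient f x) (w x) = 0"
    if f: "f \<in> polys_on (insert j K)" "\<And>x. x \<in> V \<Longrightarrow> f x = 0" and x: "x \<in> V" for f x
  proof -
    obtain M c where c: "\<And>i. c i \<in> polys_on K" "\<And>x. f x = (\<Sum>i\<le>M. c i x * x $ j ^ i)"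
      using polys_on_insert_expand[OF f(1)] by (elim exE conjE) blast
    have rel: "(\<Sum>i\<le>M. c i x * x $ j ^ i) = 0" if "x \<in> V" for x
      using f(2)[OF that] by (simp only: c(2))
    have z: "c i x = 0" if "i \<le> M" "x \<in> V" for i x
    proof (rule ccontr)
      assume "c i x \<noteq> 0"
      from algebraic_over_truncate[OF c(1) rel that this] show False
        using False c(1) unfolding algebraic_over_def by blast
    qed
    have "bform (gradient (c i) x) (w x) = 0" if "i \<le> M" for i
      using w(2) c(1)[of i] z[OF that] x by (auto simp: tangent_field_def)
    moreover have "f = (\<lambda>x. \<Sum>i\<le>M. c i x * x $ j ^ i)"
      using c(2) by auto
    ultimately show ?thesis
      using z x by (simp add: gradient_expansion[of c K] c(1))
  qed
  then have "tangent_field V (insert j K) w"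
    by (auto simp: tangent_field_def)
  then show ?thesis
    using w V by (intro bexI[of _ "\<lambda>_. 1"] exI[of _ w]) (auto simp: prime_set_def)
next
  case True
  obtain D c where D: "D \<ge> 1" and c: "\<And>i. c i \<in> polys_on K"
    and rel: "\<And>x. x \<in> V \<Longrightarrow> (\<Sum>i\<le>D. c i x * x $ j ^ i) = 0"
    and top: "\<exists>x\<in>V. c D x \<noteq> 0"
    and sep: "\<exists>x\<in>V. (\<Sum>i\<le>D. of_nat i * c i x * x $ j ^ (i - 1)) \<noteq> 0"
    and min: "\<And>e b i x. e < D \<Longrightarrow> (\<And>i. b i \<in> polys_on K) \<Longrightarrow>
      (\<And>x. x \<in> V \<Longrightarrow> (\<Sum>i\<le>e. b i x * x $ j ^ i) = 0) \<Longrightarrow> i \<le> e \<Longrightarrow> x \<in> V \<Longrightarrow> b i x = 0"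
    using minimal_relation[OF True] by (elim exE conjE) blast
  have cU: "c i \<in> polys_on UNIV" for i
    using c by (rule polys_on_mono) auto
  define s where "s = (\<lambda>x. \<Sum>i\<le>D. of_nat i * c i x * x $ j ^ (i - 1))"
  define u where "u = (\<lambda>x. \<Sum>i\<le>D. bform (gradient (c i) x) (w x) * x $ j ^ i)"
  define w' where "w' = (\<lambda>x. \<chi> i. if i = j then - u x else s x * w x $ i)"
  define P where "P = (\<lambda>x. \<Sum>i\<le>D. c i x * x $ j ^ i)"
  have s: "s \<in> polys_on UNIV"
    unfolding s_def by (intro polys_on_sum polys_on_mult polys_on_power polys_on_coord cU) auto
  have u: "u \<in> polys_on UNIV"
    unfolding u_def
    by (intro polys_on_sum polys_on_mult polys_on_power polys_on_coord polys_on_bform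
        poly_field_gradient[OF c] w) auto
  have P: "P \<in> polys_on UNIV"
    unfolding P_def by (intro polys_on_sum polys_on_mult polys_on_power polys_on_coord cU) auto
  have w'j: "w' x $ j = - u x" for x
    by (simp add: w'_def)
  have w'K: "w' x $ i = s x * w x $ i" if "i \<in> K" for i x
    using that j by (auto simp: w'_def)
  have "poly_field w'"
    unfolding poly_field_def
  proof
    fix i
    show "(\<lambda>x. w' x $ i) \<in> polys_on UNIV"
      using s u w(1) by (cases "i = j") (auto simp: w'_def poly_field_def)
  qed
  have w'c: "bform (gradient b x) (w' x) = s x * bform (gradient b x) (w x)" if "b \<in> polys_on K" for b x
    using that w'K by (rule bform_gradient_cong)
  have DP: "bform (gradient P x) (w' x) = 0" for x
  proof -
    have "bform (gradient P x) (w' x) = (\<Sum>i\<le>D. s x * bform (gradient (c i) x) (w x) * x $ j ^ i) + s x * - u x"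
      unfolding P_def gradient_expansion[OF c] w'c[OF c] w'j s_def by simp
    also have "(\<Sum>i\<le>D. s x * bform (gradient (c i) x) (w x) * x $ j ^ i) = s x * u x"
      by (simp add: u_def sum_distrib_left mult.assoc)
    finally show ?thesis by simp
  qed
  \<comment> \<open>Division by \<open>P\<close>, one coefficient at a time, reduces a relation to one of smaller degree than \<open>P\<close>.\<close>
  have main: "bform (gradient (\<lambda>x. \<Sum>i\<le>e. b i x * x $ j ^ i) x) (w' x) = 0"
    if "\<And>i. b i \<in> polys_on K" "\<And>x. x \<in> V \<Longrightarrow> (\<Sum>i\<le>e. b i x * x $ j ^ i) = 0" "x \<in> V" for e b x
    using that
  proof (induction e arbitrary: b x rule: less_induct)
    case (less e)
    note b = less.prems(1)
    have bU: "b i \<in> polys_on UNIV" for i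
      using b by (rule polys_on_mono) auto
    show ?case
    proof (cases "e < D")
      case True
      have z: "b i x = 0" if "i \<le> e" "x \<in> V" for i x
        using min[OF True b less.prems(2) that] .
      have "bform (gradient (b i) x) (w x) = 0" if "i \<le> e" for i
        using w(2) b[of i] z[OF that] less.prems(3) by (auto simp: tangent_field_def)
      then show ?thesis
        using z less.prems(3) by (simp add: gradient_expansion[OF b] w'c[OF b])
    next
      case False
      define F where "F = (\<lambda>x. \<Sum>i\<le>e. b i x * x $ j ^ i)"
      \<comment> \<open>The coefficients after one division step; the one of degree \<open>e\<close> cancels.\<close>
      define b' where "b' = (\<lambda>i x. c D x * b i x - (if e - D \<le> i then b e x * c (i - (e - D)) x else 0))"
      have F: "F \<in> polys_on UNIV"
        unfolding F_def by (intro polys_on_sum polys_on_mult polys_on_power polys_on_coord bU) auto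
      have b': "b' i \<in> polys_on K" for i
        unfolding b'_def by (cases "e - D \<le> i") (simp_all add: b c polys_on_diff polys_on_mult)
      have top0: "b' e x = 0" for x
        using False by (simp add: b'_def)
      define Q where "Q = (\<lambda>x. b e x * x $ j ^ (e - D))"
      have Q: "Q \<in> polys_on UNIV"
        unfolding Q_def by (intro polys_on_mult polys_on_power polys_on_coord bU) auto
      have eq: "(\<Sum>i\<le>e - 1. b' i x * x $ j ^ i) = c D x * F x + (- 1) * (Q x * P x)" for x
      proof -
        obtain e' where e': "e = Suc e'"
          using False D by (cases e) auto
        have "(\<Sum>i\<le>e - 1. b' i x * x $ j ^ i) = (\<Sum>i\<le>e. b' i x * x $ j ^ i)"
          using top0[of x] unfolding e' by simp
        also have "\<dots> = c D x * F x -
            (\<Sum>i\<le>e. if e - D \<le> i then b e x * c (i - (e - D)) x * x $ j ^ i else 0)"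
          by (simp add: b'_def F_def left_diff_distrib sum_subtractf sum_distrib_left mult.assoc
              if_distrib[of "\<lambda>z. z * _"] cong: if_cong)
        also have "(\<Sum>i\<le>e. if e - D \<le> i then b e x * c (i - (e - D)) x * x $ j ^ i else 0) =
            (\<Sum>i\<in>{e - D..e}. b e x * c (i - (e - D)) x * x $ j ^ i)"
          by (intro sum.mono_neutral_cong_right) auto
        also have "\<dots> = (\<Sum>k\<le>D. b e x * c k x * x $ j ^ (k + (e - D)))"
          using False
          by (intro sum.reindex_bij_witness[of _ "\<lambda>k. k + (e - D)" "\<lambda>i. i - (e - D)"]) auto
        also have "\<dots> = Q x * P x"
          by (simp add: Q_def P_def sum_distrib_left power_add mult_ac)
        finally show ?thesis by simp
      qed
      have "(\<Sum>i\<le>e - 1. b' i x * x $ j ^ i) = 0" if "x \<in> V" for x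
        using less.prems(2)[OF that] rel[OF that] unfolding eq by (simp add: F_def P_def)
      then have "bform (gradient (\<lambda>x. \<Sum>i\<le>e - 1. b' i x * x $ j ^ i) x) (w' x) = 0" if "x \<in> V" for x
        using less.IH[of "e - 1" b' x] b' that False D by simp
      then have grad0: "bform (gradient (\<lambda>x. c D x * F x + (- 1) * (Q x * P x)) x) (w' x) = 0" if "x \<in> V" for x
        unfolding eq using that by blast
      have "c D x * bform (gradient F x) (w' x) = 0" if x: "x \<in> V" for x
      proof -
        have QP: "(\<lambda>x. Q x * P x) \<in> polys_on UNIV" using Q P by auto
        have "gradient (\<lambda>x. c D x * F x + (- 1) * (Q x * P x)) x =
          (F x *s gradient (c D) x + c D x *s gradient F x) +
          (- 1) *s (P x *s gradient Q x + Q x *s gradient P x)"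
          using gradient_add[of "\<lambda>x. c D x * F x" UNIV "\<lambda>x. (- 1) * (Q x * P x)" UNIV x]
            gradient_mult[OF cU F, of D x] gradient_mult[OF Q P, of x]
            gradient_mult[of "\<lambda>_. - 1" UNIV, OF _ QP, of x] cU F QP
          by (simp add: polys_on_mult polys_on_uminus)
        moreover have "F x = 0" "P x = 0"
          using less.prems(2)[OF x] rel[OF x] by (simp_all add: F_def P_def)
        ultimately show ?thesis
          using grad0[OF x] DP[of x] by (simp add: bform_linear bform_diff_left)
      qed
      moreover obtain x0 where "x0 \<in> V" "c D x0 \<noteq> 0"
        using top by blast
      ultimately have "bform (gradient F x) (w' x) = 0"
        using prime_setD[OF V cU[of D] polys_on_bform[OF poly_field_gradient[OF F] \<open>poly_field w'\<close>]
            _ _ _ less.prems(3)] by blast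
      then show ?thesis
        by (simp add: F_def)
    qed
  qed
  have "tangent_field V (insert j K) w'"
    unfolding tangent_field_def
  proof (intro ballI impI)
    fix f x assume f: "f \<in> polys_on (insert j K)" "\<forall>x\<in>V. f x = 0" and x: "x \<in> V"
    obtain M b where b: "\<And>i. b i \<in> polys_on K" "\<And>x. f x = (\<Sum>i\<le>M. b i x * x $ j ^ i)"
      using polys_on_insert_expand[OF f(1)] by (elim exE conjE) blast
    then have "f = (\<lambda>x. \<Sum>i\<le>M. b i x * x $ j ^ i)"
      by auto
    moreover have "(\<Sum>i\<le>M. b i x * x $ j ^ i) = 0" if "x \<in> V" for x
      using f(2) that by (simp only: b(2))
    ultimately show "bform (gradient f x) (w' x) = 0"
      using main[where e = M and b = b, OF b(1) _ x] by simp
  qed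
  then show ?thesis
    using s sep \<open>poly_field w'\<close> w'K by (intro bexI[of _ s] exI[of _ w']) (auto simp: s_def)
qed

lemma tangent_field_extend:
  fixes V :: "(complex ^ 'n::finite) set"
  assumes V: "prime_set V" and w: "poly_field w" "tangent_field V K w"
  shows "\<exists>g\<in>polys_on UNIV. \<exists>w'. (\<exists>x\<in>V. g x \<noteq> 0) \<and> poly_field w' \<and>
    (\<forall>i\<in>K. \<forall>x. w' x $ i = g x * w x $ i) \<and> tangent_field V UNIV w'"
proof -
  have "finite (- K)" by simp
  then show ?thesis using w
  proof (induction "- K" arbitrary: K w rule: finite_induct)
    case empty
    then have "K = UNIV" by auto
    then show ?case
      using empty V by (intro bexI[of _ "\<lambda>_. 1"] exI[of _ w]) (auto simp: prime_set_def)
  next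
    case (insert j F)
    have F: "F = - insert j K" "j \<notin> K"
      using insert.hyps by auto
    obtain g w1 where g: "g \<in> polys_on UNIV" "\<exists>x\<in>V. g x \<noteq> 0" and w1: "poly_field w1"
      "\<And>i x. i \<in> K \<Longrightarrow> w1 x $ i = g x * w x $ i" "tangent_field V (insert j K) w1"
      using tangent_field_extend_step[OF V insert.prems F(2)] by blast
    obtain g' w' where g': "g' \<in> polys_on UNIV" "\<exists>x\<in>V. g' x \<noteq> 0" and w': "poly_field w'"
      "\<And>i x. i \<in> insert j K \<Longrightarrow> w' x $ i = g' x * w1 x $ i" "tangent_field V UNIV w'"
      using insert.hyps(3)[OF F(1) w1(1,3)] by blast
    have "\<exists>x\<in>V. g' x * g x \<noteq> 0"
      using g g' prime_set_common[OF V g'(1) g(1)] by auto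
    then show ?case
      using g g' w1 w' by (intro bexI[of _ "\<lambda>x. g' x * g x"] exI[of _ w']) auto
  qed
qed

text \<open>
  The relation of an algebraic coordinate, differentiated, determines that component of a tangent vector
  wherever its separant does not vanish.
\<close>

lemma tangent_space_algebraic:
  fixes V :: "(complex ^ 'n::finite) set"
  assumes "algebraic_over V S j"
  shows "\<exists>h\<in>polys_on UNIV. (\<exists>x\<in>V. h x \<noteq> 0) \<and>
    (\<forall>x\<in>V. h x \<noteq> 0 \<longrightarrow> (\<forall>v\<in>tangent_space V x. (\<forall>s\<in>S. v $ s = 0) \<longrightarrow> v $ j = 0))"
proof -
  obtain D c where c: "\<And>i. c i \<in> polys_on S"
    and rel: "\<And>x. x \<in> V \<Longrightarrow> (\<Sum>i\<le>D. c i x * x $ j ^ i) = 0"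
    and sep: "\<exists>x\<in>V. (\<Sum>i\<le>D. of_nat i * c i x * x $ j ^ (i - 1)) \<noteq> 0"
    using minimal_relation[OF assms] by (elim exE conjE) blast
  have cU: "c i \<in> polys_on UNIV" for i
    using c by (rule polys_on_mono) auto
  define s where "s = (\<lambda>x. \<Sum>i\<le>D. of_nat i * c i x * x $ j ^ (i - 1))"
  define P where "P = (\<lambda>x. \<Sum>i\<le>D. c i x * x $ j ^ i)"
  have s: "s \<in> polys_on UNIV"
    unfolding s_def by (intro polys_on_sum polys_on_mult polys_on_power polys_on_coord cU) auto
  have "P \<in> polys_on UNIV"
    unfolding P_def by (intro polys_on_sum polys_on_mult polys_on_power polys_on_coord cU) auto
  then have P: "P \<in> vanishing_ideal V"
    using rel by (auto simp: vanishing_ideal_def polys_UNIV P_def)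
  have "v $ j = 0" if x: "s x \<noteq> 0" and v: "v \<in> tangent_space V x" "\<And>i. i \<in> S \<Longrightarrow> v $ i = 0" for x v
  proof -
    have "bform (gradient P x) v = 0"
      using v(1) P by (auto simp: tangent_space_def)
    moreover have "bform (gradient (c i) x) v = 0" for i
      using bform_gradient_cong[OF c, of v 0 v i x] v(2) by simp
    ultimately have "s x * v $ j = 0"
      unfolding P_def gradient_expansion[OF c] by (simp add: s_def)
    then show ?thesis using x by simp
  qed
  then show ?thesis
    using s sep by (intro bexI[of _ s]) (auto simp: s_def)
qed

lemma prime_set_prod:
  assumes "prime_set V" "finite A" "\<And>a. a \<in> A \<Longrightarrow> f a \<in> polys_on UNIV" "\<And>a. a \<in> A \<Longrightarrow> \<exists>x\<in>V. f a x \<noteq> 0"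
  shows "\<exists>x\<in>V. (\<Prod>a\<in>A. f a x) \<noteq> 0"
  using assms(2-)
proof (induction A rule: finite_induct)
  case empty
  then show ?case using assms(1) by (auto simp: prime_set_def)
next
  case (insert a A)
  obtain x where x: "x \<in> V" "f a x \<noteq> 0"
    using insert.prems(2)[of a] by blast
  have "\<exists>y\<in>V. (\<Prod>a\<in>A. f a y) \<noteq> 0"
    by (rule insert.IH) (use insert.prems in blast)+
  then obtain y where y: "y \<in> V" "(\<Prod>a\<in>A. f a y) \<noteq> 0"
    by blast
  have "f a \<in> polys_on UNIV" "(\<lambda>x. \<Prod>a\<in>A. f a x) \<in> polys_on UNIV"
    using insert.prems(1) by (auto intro: polys_on_prod)
  from prime_set_common[OF assms(1) this x y] show ?case
    using insert.hyps by simp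
qed

text \<open>
  Polynomial vector fields that form a basis of the tangent space wherever \<open>G\<close> does not vanish, dual
  to the coordinates in \<open>S\<close> up to the factor \<open>G\<close>. They make tangency and conormality polynomial
  conditions, which then pass to closures.
\<close>

definition tangent_frame ::
    "(complex ^ 'n::finite) set \<Rightarrow> 'n set \<Rightarrow> (complex ^ 'n \<Rightarrow> complex) \<Rightarrow>
     ('n \<Rightarrow> complex ^ 'n \<Rightarrow> complex ^ 'n) \<Rightarrow> bool" where
  "tangent_frame V S G w \<longleftrightarrow> G \<in> polys_on UNIV \<and> (\<exists>x\<in>V. G x \<noteq> 0) \<and>
     (\<forall>s\<in>S. poly_field (w s) \<and> tangent_field V UNIV (w s) \<and>
       (\<forall>r\<in>S. \<forall>x. w s x $ r = (if r = s then G x else 0))) \<and>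
     (\<forall>x\<in>V. G x \<noteq> 0 \<longrightarrow> (\<forall>v\<in>tangent_space V x. (\<forall>s\<in>S. v $ s = 0) \<longrightarrow> v = 0))"

text \<open>
  Since no nonzero polynomial in the coordinates \<open>S\<close> vanishes on \<open>V\<close>, every constant field is tangent with
  respect to \<open>S\<close>, and extends. The remaining factors in \<open>w'\<close> give all members of the frame the same
  denominator \<open>G\<close>.
\<close>

lemma tangent_frame_exists:
  fixes V :: "(complex ^ 'n::finite) set"
  assumes V: "prime_set V" and S: "transcendence_basis V S"
  shows "\<exists>G w. tangent_frame V S G w"
proof -
  have "\<exists>g\<in>polys_on UNIV. \<exists>w'. (\<exists>x\<in>V. g x \<noteq> 0) \<and> poly_field w' \<and>
    (\<forall>i\<in>S. \<forall>x. w' x $ i = g x * (axis s 1 :: complex ^ 'n) $ i) \<and> tangent_field V UNIV w'" for s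
  proof (rule tangent_field_extend[OF V])
    show "poly_field (\<lambda>_. axis s 1 :: complex ^ 'n)"
      by (simp add: poly_field_def)
    show "tangent_field V S (\<lambda>_. axis s 1)"
      unfolding tangent_field_def
    proof (intro ballI impI)
      fix f x assume "f \<in> polys_on S" "\<forall>x\<in>V. f x = 0"
      then have "f = (\<lambda>x. 0)"
        using S by (auto simp: transcendence_basis_def independent_on_def)
      then show "bform (gradient f x) (axis s 1) = 0"
        by simp
    qed
  qed
  then obtain g w where g: "\<And>s. g s \<in> polys_on UNIV" "\<And>s. \<exists>x\<in>V. g s x \<noteq> 0"
    and w: "\<And>s. poly_field (w s)" "\<And>s. tangent_field V UNIV (w s)"
      "\<And>s i x. i \<in> S \<Longrightarrow> w s x $ i = g s x * (axis s 1 :: complex ^ 'n) $ i"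
    by metis
  define good where "good = (\<lambda>j h. h \<in> polys_on UNIV \<and> (\<exists>x\<in>V. h x \<noteq> 0) \<and>
    (\<forall>x\<in>V. h x \<noteq> 0 \<longrightarrow> (\<forall>v\<in>tangent_space V x. (\<forall>s\<in>S. v $ s = 0) \<longrightarrow> v $ j = 0)))"
  have "\<exists>h. good j h" if "j \<notin> S" for j
    using tangent_space_algebraic[of V S j] S that unfolding good_def transcendence_basis_def by blast
  then have "\<forall>j\<in>-S. \<exists>h. good j h"
    by auto
  from bchoice[OF this] obtain h where "\<forall>j\<in>-S. good j (h j)"
    by blast
  then have h: "\<And>j. j \<in> - S \<Longrightarrow> h j \<in> polys_on UNIV" "\<And>j. j \<in> - S \<Longrightarrow> \<exists>x\<in>V. h j x \<noteq> 0"
    "\<And>j x v. j \<in> - S \<Longrightarrow> x \<in> V \<Longrightarrow> h j x \<noteq> 0 \<Longrightarrow> v \<in> tangent_space V x \<Longrightarrow> (\<forall>s\<in>S. v $ s = 0) \<Longrightarrow> v $ j = 0"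
    unfolding good_def by blast+
  define H where "H = (\<lambda>x. \<Prod>j\<in>-S. h j x)"
  define G where "G = (\<lambda>x. (\<Prod>s\<in>S. g s x) * H x)"
  define w' where "w' = (\<lambda>s x. ((\<Prod>r\<in>S - {s}. g r x) * H x) *s w s x)"
  have H: "H \<in> polys_on UNIV"
    unfolding H_def using h by (intro polys_on_prod) auto
  have gp: "(\<lambda>x. \<Prod>r\<in>A. g r x) \<in> polys_on UNIV" for A
    using g by (intro polys_on_prod) auto
  have G: "G \<in> polys_on UNIV"
    unfolding G_def using H gp by auto
  obtain x y where "x \<in> V" "(\<Prod>s\<in>S. g s x) \<noteq> 0" "y \<in> V" "H y \<noteq> 0"
    using prime_set_prod[OF V, of S g] prime_set_prod[OF V, of "- S" h] g h unfolding H_def by auto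
  then have G0: "\<exists>x\<in>V. G x \<noteq> 0"
    using prime_set_common[OF V gp H] by (auto simp: G_def)
  have "w' s x $ r = (if r = s then G x else 0)" if "s \<in> S" "r \<in> S" for s r x
    using that w(3)[of r s x] prod.remove[of S s "\<lambda>r. g r x"] by (auto simp: w'_def G_def axis_def)
  moreover have "v = 0" if x: "x \<in> V" "G x \<noteq> 0" and v: "v \<in> tangent_space V x" "\<forall>s\<in>S. v $ s = 0" for x v
  proof -
    have "h j x \<noteq> 0" if "j \<in> - S" for j
      using x(2) that by (auto simp: G_def H_def)
    then have "v $ j = 0" for j
      using h(3)[of j x v] x v by (cases "j \<in> S") auto
    then show ?thesis by (simp add: vec_eq_iff)
  qed
  moreover have "poly_field (w' s) \<and> tangent_field V UNIV (w' s)" for s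
    unfolding w'_def using w gp H by (intro conjI poly_field_scale tangent_field_scale) auto
  ultimately have "tangent_frame V S G w'"
    using G G0 unfolding tangent_frame_def by blast
  then show ?thesis by blast
qed

lemma tangent_field_in_tangent_space:
  assumes "tangent_field V UNIV w" "x \<in> V"
  shows "w x \<in> tangent_space V x"
  using assms by (auto simp: tangent_field_def tangent_space_def vanishing_ideal_def polys_UNIV)

lemma tangent_frame_span:
  assumes fr: "tangent_frame V S G w" and x: "x \<in> V" "G x \<noteq> 0" and v: "v \<in> tangent_space V x"
  shows "G x *s v = (\<Sum>s\<in>S. v $ s *s w s x)"
proof -
  define z where "z = G x *s v + (- 1) *s (\<Sum>s\<in>S. v $ s *s w s x)"
  have "z \<in> tangent_space V x"
    unfolding tangent_space_def
  proof (intro CollectI ballI)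
    fix f assume f: "f \<in> vanishing_ideal V"
    have "bform (gradient f x) (w s x) = 0" if "s \<in> S" for s
      using tangent_field_in_tangent_space[of V "w s" x] fr that x f
      by (auto simp: tangent_frame_def tangent_space_def)
    moreover have "bform (gradient f x) v = 0"
      using v f by (auto simp: tangent_space_def)
    ultimately show "bform (gradient f x) z = 0"
      unfolding z_def bform_linear bform_sum_right by simp
  qed
  moreover have "z $ r = 0" if r: "r \<in> S" for r
  proof -
    have "(\<Sum>s\<in>S. v $ s * w s x $ r) = (\<Sum>s\<in>S. if s = r then v $ r * G x else 0)"
      using fr r by (intro sum.cong) (auto simp: tangent_frame_def)
    then show ?thesis
      using r by (simp add: z_def mult.commute)
  qed
  ultimately have "z = 0"
    using fr x by (auto simp: tangent_frame_def)
  then show ?thesis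
    by (simp add: z_def)
qed

lemma perp_tangent_frame:
  assumes fr: "tangent_frame V S G w" and x: "x \<in> V" "G x \<noteq> 0"
    and y: "\<And>s. s \<in> S \<Longrightarrow> bform y (w s x) = 0"
  shows "perp y (tangent_space V x)"
  unfolding perp_def
proof
  fix v assume "v \<in> tangent_space V x"
  then have "bform y (G x *s v) = 0"
    using y by (simp add: tangent_frame_span[OF fr x] bform_sum_right bform_linear)
  then show "bform y v = 0"
    using x by (simp add: bform_linear)
qed

lemma bform_span:
  assumes "\<And>b. b \<in> B \<Longrightarrow> bform b v = 0" "a \<in> vec.span B"
  shows "bform a v = 0"
  using assms(2)
  by (induction rule: vec.span_induct_alt) (auto simp: bform_linear assms(1))

text \<open>
  If the gradients spanned too small a space, then fewer than \<open>n\<close> linear equations would define the tangent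
  vectors with zero \<open>S\<close>-components, and there would be a nonzero one.
\<close>

lemma gradients_dim_ge:
  fixes V :: "(complex ^ 'n::finite) set"
  assumes uniq: "\<And>v. v \<in> tangent_space V x \<Longrightarrow> (\<forall>s\<in>S. v $ s = 0) \<Longrightarrow> v = 0"
  shows "CARD('n) - card S \<le> vec.dim ((\<lambda>f. gradient f x) ` vanishing_ideal V)"
proof (rule ccontr)
  assume "\<not> ?thesis"
  then have lt: "vec.dim ((\<lambda>f. gradient f x) ` vanishing_ideal V) + card S < CARD('n)"
    by simp
  obtain B where B: "B \<subseteq> (\<lambda>f. gradient f x) ` vanishing_ideal V" "vec.independent B"
    "(\<lambda>f. gradient f x) ` vanishing_ideal V \<subseteq> vec.span B"
    "card B = vec.dim ((\<lambda>f. gradient f x) ` vanishing_ideal V)"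
    using vec.basis_exists by blast
  have fB: "finite B"
    using B(2) vec.finiteI_independent by blast
  define m where "m = (\<lambda>(a :: 'n) e. case e of Inl b \<Rightarrow> b $ a | Inr s \<Rightarrow> (axis s 1 :: complex ^ 'n) $ a)"
  have "card (B <+> S) < card (UNIV :: 'n set)"
    using lt B(4) fB by (simp add: card_Plus)
  then obtain c where c: "\<exists>a. c a \<noteq> 0" "\<And>e. e \<in> B <+> S \<Longrightarrow> (\<Sum>a\<in>UNIV. c a * m a e) = 0"
    using homogeneous_system_solvable[of UNIV "B <+> S" m] fB by auto
  define v where "v = (\<chi> a. c a)"
  have "bform b v = 0" if "b \<in> B" for b
    using c(2)[of "Inl b"] that by (auto simp: m_def bform_def v_def mult.commute)
  then have "bform (gradient f x) v = 0" if "f \<in> vanishing_ideal V" for f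
    using bform_span[of B v] B(3) that by blast
  then have "v \<in> tangent_space V x"
    by (auto simp: tangent_space_def)
  moreover have "v $ s = 0" if "s \<in> S" for s
  proof -
    have "bform v (axis s 1) = 0"
      using c(2)[of "Inr s"] that by (auto simp: m_def bform_def v_def)
    then show ?thesis by simp
  qed
  ultimately have "v = 0"
    using uniq by blast
  then show False
    using c(1) by (simp add: v_def vec_eq_iff)
qed

lemma generic_nonsingular:
  fixes V :: "(complex ^ 'n::finite) set"
  assumes V: "irreducible_variety V" and S: "transcendence_basis V S" and fr: "tangent_frame V S G w"
    and x: "x \<in> V" "G x \<noteq> 0"
  shows "x \<notin> singular_locus V"
proof -
  have "CARD('n) - card S \<le> vec.dim ((\<lambda>f. gradient f x) ` vanishing_ideal V)"
    using fr x by (intro gradients_dim_ge) (auto simp: tangent_frame_def)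
  moreover have "card S \<le> variety_dim V"
    using S by (intro independent_le_variety_dim[OF V]) (auto simp: transcendence_basis_def)
  ultimately show ?thesis
    by (auto simp: singular_locus_def)
qed

lemma prime_set_frame:
  assumes V: "prime_set V"
  obtains S G w where "transcendence_basis V S" "tangent_frame V S G w"
proof -
  have "V \<noteq> {}"
    using V by (simp add: prime_set_def)
  from transcendence_basis_exists[OF this] obtain S where "transcendence_basis V S"
    by blast
  with tangent_frame_exists[OF V this] that show ?thesis
    by blast
qed

section \<open>The conormal variety\<close>

text \<open>
  Pairs \<open>(x, y)\<close> of vectors are points of one affine space, with the coordinates of \<open>x\<close> under \<open>Inl\<close> and those of
  \<open>y\<close> under \<open>Inr\<close>, so that everything above applies to varieties of pairs.
\<close>

definition fst_part :: "complex ^ ('n::finite + 'n) \<Rightarrow> complex ^ 'n" where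
  "fst_part z = (\<chi> i. z $ Inl i)"

definition snd_part :: "complex ^ ('n::finite + 'n) \<Rightarrow> complex ^ 'n" where
  "snd_part z = (\<chi> i. z $ Inr i)"

definition vpair :: "complex ^ 'n::finite \<Rightarrow> complex ^ 'n \<Rightarrow> complex ^ ('n + 'n)" where
  "vpair x y = (\<chi> k. case k of Inl i \<Rightarrow> x $ i | Inr i \<Rightarrow> y $ i)"

lemma part_nth [simp]: "fst_part z $ i = z $ Inl i" "snd_part z $ i = z $ Inr i"
  by (simp_all add: fst_part_def snd_part_def)

lemma vpair_nth [simp]: "vpair x y $ Inl i = x $ i" "vpair x y $ Inr i = y $ i"
  by (simp_all add: vpair_def)

lemma part_vpair [simp]: "fst_part (vpair x y) = x" "snd_part (vpair x y) = y"
  by (simp_all add: vec_eq_iff)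

lemma vec_sum_eq_iff: "z = z' \<longleftrightarrow> fst_part z = fst_part z' \<and> snd_part z = snd_part z'"
  for z :: "complex ^ ('n::finite + 'n)"
proof
  assume "fst_part z = fst_part z' \<and> snd_part z = snd_part z'"
  then have "z $ k = z' $ k" for k
    by (cases k) (auto simp: vec_eq_iff)
  then show "z = z'" by (simp add: vec_eq_iff)
qed simp

lemma vpair_parts [simp]: "vpair (fst_part z) (snd_part z) = z"
  by (simp add: vec_sum_eq_iff)

lemma part_linear [simp]:
  "fst_part (a + t *s b) = fst_part a + t *s fst_part b"
  "snd_part (a + t *s b) = snd_part a + t *s snd_part b"
  by (simp_all add: vec_eq_iff)

lemma part_axis [simp]:
  "fst_part (axis (Inl i) c) = axis i c" "snd_part (axis (Inl i) c) = 0"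
  "fst_part (axis (Inr i) c) = 0" "snd_part (axis (Inr i) c) = axis i c"
  by (simp_all add: vec_eq_iff axis_def)

lemma bform_parts: "bform a b = bform (fst_part a) (fst_part b) + bform (snd_part a) (snd_part b)"
proof -
  have "bform a b = (\<Sum>k\<in>UNIV <+> UNIV. a $ k * b $ k)"
    by (simp add: bform_def)
  also have "\<dots> = bform (fst_part a) (fst_part b) + bform (snd_part a) (snd_part b)"
    by (subst sum.Plus) (simp_all add: bform_def)
  finally show ?thesis .
qed

lemma polys_on_fst: "f \<in> polys_on K \<Longrightarrow> (\<lambda>z. f (fst_part z)) \<in> polys_on (Inl ` K)"
  by (rule polys_on_compose) auto

lemma polys_on_fst_UNIV [intro]: "f \<in> polys_on UNIV \<Longrightarrow> (\<lambda>z. f (fst_part z)) \<in> polys_on UNIV"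
  by (rule polys_on_compose) auto

lemma polys_on_snd_UNIV [intro]: "f \<in> polys_on UNIV \<Longrightarrow> (\<lambda>z. f (snd_part z)) \<in> polys_on UNIV"
  by (rule polys_on_compose) auto

lemma gradient_fst: "gradient (\<lambda>z. f (fst_part z)) z = vpair (gradient f (fst_part z)) 0"
proof -
  have "gradient (\<lambda>z. f (fst_part z)) z $ k = vpair (gradient f (fst_part z)) 0 $ k" for k
    by (cases k) (simp_all add: gradient_eq)
  then show ?thesis by (simp add: vec_eq_iff)
qed

lemma gradient_snd: "gradient (\<lambda>z. f (snd_part z)) z = vpair 0 (gradient f (snd_part z))"
proof -
  have "gradient (\<lambda>z. f (snd_part z)) z $ k = vpair 0 (gradient f (snd_part z)) $ k" for k
    by (cases k) (simp_all add: gradient_eq)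
  then show ?thesis by (simp add: vec_eq_iff)
qed

text \<open>
  All points of \<open>V\<close> are allowed here, also the singular ones: this adds only points of the closure of the
  part over the nonsingular points (see \<open>conormal_field\<close>), and frees the following from case distinctions.
\<close>

definition conormal :: "(complex ^ 'n::finite) set \<Rightarrow> (complex ^ ('n + 'n)) set" where
  "conormal V = {z. fst_part z \<in> V \<and> perp (snd_part z) (tangent_space V (fst_part z))}"

lemma perp_zero [simp]: "perp 0 T"
  by (simp add: perp_def)

lemma conormal_zero: "x \<in> V \<Longrightarrow> vpair x 0 \<in> conormal V"
  by (simp add: conormal_def)

text \<open>
  The double orthogonal complement with respect to the bilinear form, which holds although there
  are isotropic vectors: a functional that separates \<open>y\<close> from the span is represented by a vector.
\<close>

lemma perp_imp_span:
  fixes A :: "(complex ^ 'n::finite) set"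
  assumes "perp y {v. \<forall>g\<in>A. bform g v = 0}"
  shows "y \<in> vec.span A"
proof (rule ccontr)
  assume y: "y \<notin> vec.span A"
  obtain B where B: "B \<subseteq> A" "vec.independent B" "A \<subseteq> vec.span B"
    using vec.maximal_independent_subset by blast
  have "vec.span A \<subseteq> vec.span B"
    using B(3) by (simp add: vec.span_minimal)
  have "y \<notin> vec.span B"
    using y B(1) vec.span_mono by blast
  then have ind: "vec.independent (insert y B)"
    using B(2) by (simp add: vec.independent_insertI)
  define i0 :: 'n where "i0 = undefined"
  obtain g :: "complex ^ 'n \<Rightarrow> complex ^ 'n" where g: "Vector_Spaces.linear (*s) (*s) g"
    "\<And>b. b \<in> insert y B \<Longrightarrow> g b = (if b = y then axis i0 1 else 0)"
    using vec.linear_independent_extend[OF ind, of "\<lambda>b. if b = y then axis i0 1 else 0"] by blast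
  define v where "v = (\<chi> i. g (axis i 1) $ i0)"
  have gv: "bform x v = g x $ i0" for x
  proof -
    have "g x = g (\<Sum>i\<in>UNIV. x $ i *s axis i 1)"
      by (simp add: basis_expansion)
    also have "\<dots> = (\<Sum>i\<in>UNIV. x $ i *s g (axis i 1))"
      by (simp add: vec.linear_sum[OF g(1)] vec.linear_scale[OF g(1)])
    finally show ?thesis
      by (simp add: bform_def v_def)
  qed
  have "bform b v = 0" if "b \<in> B" for b
    using that g(2)[of b] \<open>y \<notin> vec.span B\<close> vec.span_base[OF that] by (auto simp: gv)
  then have "bform a v = 0" if "a \<in> A" for a
    using bform_span[of B v a] B(3) that by blast
  then have "bform y v = 0"
    using assms by (auto simp: perp_def)
  then show False
    using g(2)[of y] by (simp add: gv axis_def)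
qed

text \<open>
  Every conormal vector, even at a singular point, extends to a polynomial field of conormal vectors:
  it is a combination of gradients of elements of the ideal at that point, and the same combination of
  gradients works everywhere.
\<close>

lemma conormal_field:
  fixes V :: "(complex ^ 'n::finite) set"
  assumes "z \<in> conormal V"
  shows "\<exists>a. poly_field a \<and> a (fst_part z) = snd_part z \<and> (\<forall>x\<in>V. perp (a x) (tangent_space V x))"
proof -
  let ?x = "fst_part z"
  have "perp (snd_part z) {v. \<forall>g\<in>(\<lambda>f. gradient f ?x) ` vanishing_ideal V. bform g v = 0}"
    using assms by (simp add: conormal_def tangent_space_def)
  then have "snd_part z \<in> vec.span ((\<lambda>f. gradient f ?x) ` vanishing_ideal V)"
    by (rule perp_imp_span)
  then show ?thesis
  proof (induction rule: vec.span_induct_alt)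
    case base
    show ?case by (intro exI[of _ "\<lambda>_. 0"]) (simp add: poly_field_def)
  next
    case (step c b y)
    then obtain f a where f: "f \<in> vanishing_ideal V" "b = gradient f ?x"
      and a: "poly_field a" "a ?x = y" "\<And>x. x \<in> V \<Longrightarrow> perp (a x) (tangent_space V x)"
      by blast
    have "(\<lambda>x. gradient f x $ i) \<in> polys_on UNIV" for i
      using f(1) by (intro polys_on_gradient) (simp add: vanishing_ideal_def polys_UNIV)
    then have "poly_field (\<lambda>x. c *s gradient f x + a x)"
      using a(1) unfolding poly_field_def by (auto intro!: polys_on_add polys_on_mult)
    moreover have "perp (c *s gradient f x + a x) (tangent_space V x)" if "x \<in> V" for x
      using a(3)[OF that] f(1) by (auto simp: perp_def tangent_space_def bform_linear)
    ultimately show ?case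
      using f a by (intro exI[of _ "\<lambda>x. c *s gradient f x + a x"]) auto
  qed
qed

lemma polys_on_vpair:
  fixes a b :: "complex ^ 'm::finite \<Rightarrow> complex ^ 'n::finite"
  assumes "f \<in> polys_on UNIV" "poly_field a" "poly_field b"
  shows "(\<lambda>x. f (vpair (a x) (b x))) \<in> polys_on UNIV"
  using assms(1)
proof (rule polys_on_compose)
  fix k :: "'n + 'n"
  show "(\<lambda>x. vpair (a x) (b x) $ k) \<in> polys_on UNIV"
    using assms by (cases k) (auto simp: poly_field_def)
qed

lemma poly_field_id: "poly_field (\<lambda>x. x)"
  by (auto simp: poly_field_def)

text \<open>
  Extend two given conormal vectors to conormal fields \<open>a\<close> and \<open>b\<close>. If \<open>f\<close> does not vanish along \<open>a\<close> and \<open>g\<close> not along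
  \<open>b\<close>, then by irreducibility of \<open>V\<close> both happen over one point \<open>x\<close>, and on the line through \<open>a x\<close> and \<open>b x\<close> in
  the fibre there is a point where neither vanishes.
\<close>

lemma conormal_prime:
  fixes V :: "(complex ^ 'n::finite) set"
  assumes V: "prime_set V"
  shows "prime_set (conormal V)"
  unfolding prime_set_def
proof (intro conjI ballI impI)
  show "conormal V \<noteq> {}"
    using V conormal_zero[of _ V] by (auto simp: prime_set_def)
  fix f g :: "complex ^ ('n + 'n) \<Rightarrow> complex"
  assume f: "f \<in> polys_on UNIV" and g: "g \<in> polys_on UNIV" and fg: "\<forall>z\<in>conormal V. f z * g z = 0"
  show "(\<forall>z\<in>conormal V. f z = 0) \<or> (\<forall>z\<in>conormal V. g z = 0)"
  proof (rule ccontr)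
    assume "\<not> ?thesis"
    then obtain z0 z1 where z0: "z0 \<in> conormal V" "f z0 \<noteq> 0" and z1: "z1 \<in> conormal V" "g z1 \<noteq> 0"
      by auto
    obtain a where a: "poly_field a" "a (fst_part z0) = snd_part z0"
      "\<And>x. x \<in> V \<Longrightarrow> perp (a x) (tangent_space V x)"
      using conormal_field[OF z0(1)] by blast
    obtain b where b: "poly_field b" "b (fst_part z1) = snd_part z1"
      "\<And>x. x \<in> V \<Longrightarrow> perp (b x) (tangent_space V x)"
      using conormal_field[OF z1(1)] by blast
    have "\<exists>x\<in>V. f (vpair x (a x)) \<noteq> 0 \<and> g (vpair x (b x)) \<noteq> 0"
    proof (rule prime_set_common[OF V polys_on_vpair[OF f poly_field_id a(1)] polys_on_vpair[OF g poly_field_id b(1)]])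
      show "fst_part z0 \<in> V" "fst_part z1 \<in> V"
        using z0 z1 by (auto simp: conormal_def)
      show "f (vpair (fst_part z0) (a (fst_part z0))) \<noteq> 0" "g (vpair (fst_part z1) (b (fst_part z1))) \<noteq> 0"
        using z0 z1 by (simp_all add: a b)
    qed
    then obtain x where x: "x \<in> V" "f (vpair x (a x)) \<noteq> 0" "g (vpair x (b x)) \<noteq> 0"
      by blast
    have line: "vpair x (a x) + t *s vpair 0 (b x - a x) = vpair x (a x + t *s (b x - a x))" for t
      by (simp add: vec_sum_eq_iff)
    have "\<exists>t. f (vpair x (a x) + t *s vpair 0 (b x - a x)) \<noteq> 0 \<and> g (vpair x (a x) + t *s vpair 0 (b x - a x)) \<noteq> 0"
      unfolding line using x common_nonzero_on_line[OF f g, of "vpair x (a x)" 0 "vpair 0 (b x - a x)" 1]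
      by (simp only: line) simp
    then obtain t where t: "f (vpair x (a x + t *s (b x - a x))) \<noteq> 0" "g (vpair x (a x + t *s (b x - a x))) \<noteq> 0"
      by (auto simp: line)
    have "perp (a x + t *s (b x - a x)) (tangent_space V x)"
      using a(3)[OF x(1)] b(3)[OF x(1)] by (simp add: perp_def bform_linear bform_diff_left)
    then have "vpair x (a x + t *s (b x - a x)) \<in> conormal V"
      using x(1) by (simp add: conormal_def)
    then show False
      using fg t by auto
  qed
qed

lemma conormal_frame:
  assumes "tangent_frame V S G w" "z \<in> conormal V" "s \<in> S"
  shows "bform (snd_part z) (w s (fst_part z)) = 0"
  using assms tangent_field_in_tangent_space[of V "w s" "fst_part z"]
  by (auto simp: conormal_def perp_def tangent_frame_def)

lemma algebraic_over_fst:
  assumes "algebraic_over V S j"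
  shows "algebraic_over (conormal V) (Inl ` S) (Inl j)"
proof -
  obtain D c where c: "\<And>i. c i \<in> polys_on S" "\<And>x. x \<in> V \<Longrightarrow> (\<Sum>i\<le>D. c i x * x $ j ^ i) = 0"
    "\<exists>x\<in>V. c D x \<noteq> 0"
    using assms unfolding algebraic_over_def by (elim exE conjE) blast
  obtain x0 where x0: "x0 \<in> V" "c D x0 \<noteq> 0"
    using c(3) by blast
  show ?thesis
    unfolding algebraic_over_def
  proof (intro exI[of _ D] exI[of _ "\<lambda>i z. c i (fst_part z)"] conjI allI ballI)
    show "(\<lambda>z. c i (fst_part z)) \<in> polys_on (Inl ` S)" for i
      by (rule polys_on_fst[OF c(1)])
    show "(\<Sum>i\<le>D. c i (fst_part z) * z $ Inl j ^ i) = 0" if "z \<in> conormal V" for z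
      using c(2)[of "fst_part z"] that by (simp add: conormal_def)
    show "\<exists>z\<in>conormal V. c D (fst_part z) \<noteq> 0"
      using x0 by (intro bexI[of _ "vpair x0 0"] conormal_zero) auto
  qed
qed

text \<open>
  The conormal variety has dimension \<open>n\<close>: a general point is determined, up to finitely many choices, by
  the coordinates \<open>x\<^sub>s\<close> with \<open>s\<close> in a transcendence basis \<open>S\<close> of the base, and the coordinates \<open>y\<^sub>j\<close> with \<open>j\<close>
  outside \<open>S\<close>. This lemma counts them.
\<close>

lemma card_base_fibre_coords: "card (Inl ` S \<union> Inr ` (- S) :: ('n::finite + 'n) set) = CARD('n)"
proof -
  have "card (Inl ` S \<union> Inr ` (- S) :: ('n + 'n) set) =
      card (Inl ` S :: ('n + 'n) set) + card (Inr ` (- S) :: ('n + 'n) set)"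
    by (intro card_Un_disjoint) auto
  also have "\<dots> = card S + card (- S)"
    by (simp add: card_image)
  also have "\<dots> = card (S \<union> - S)"
    by (subst card_Un_disjoint) auto
  finally show ?thesis by simp
qed

text \<open>
  The other \<open>x\<^sub>j\<close> are algebraic over these coordinates as on \<open>V\<close>, and the other \<open>y\<^sub>s\<close> because orthogonality to the
  \<open>s\<close>-th member of the frame is a linear equation with coefficient \<open>G\<close> at \<open>y\<^sub>s\<close>.
\<close>

lemma conormal_growth:
  fixes V :: "(complex ^ 'n::finite) set"
  assumes V: "prime_set V"
  shows "growth (conormal V) UNIV CARD('n)"
proof -
  obtain S G w where S: "transcendence_basis V S" and fr: "tangent_frame V S G w"
    by (rule prime_set_frame[OF V])
  note N = conormal_prime[OF V]
  define K where "K = Inl ` S \<union> Inr ` (- S)"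
  have "card K = CARD('n)"
    unfolding K_def by (rule card_base_fibre_coords)
  then have "growth (conormal V) K CARD('n)"
    using growth_card[of "conormal V" K] N by (simp add: prime_set_def)
  then have gr: "growth (conormal V) (K \<union> range Inl) CARD('n)"
  proof (rule growth_algebraic_extension[OF N])
    fix k assume "k \<in> range Inl - K"
    then obtain j where j: "k = Inl j" "j \<notin> S"
      by (auto simp: K_def)
    then have "algebraic_over (conormal V) (Inl ` S) (Inl j)"
      using S by (intro algebraic_over_fst) (auto simp: transcendence_basis_def)
    then show "algebraic_over (conormal V) K k"
      unfolding j by (rule algebraic_over_mono) (auto simp: K_def)
  qed
  have "growth (conormal V) ((K \<union> range Inl) \<union> UNIV) CARD('n)"
  proof (rule growth_algebraic_extension[OF N gr])
    fix k assume "k \<in> UNIV - (K \<union> range Inl)"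
    then obtain s where s: "k = Inr s" "s \<in> S"
      by (cases k) (auto simp: K_def)
    \<comment> \<open>The coefficients of the equation of orthogonality as a polynomial of degree 1 in \<open>y\<^sub>s\<close>.\<close>
    define c where "c = (\<lambda>i :: nat. \<lambda>z :: complex ^ ('n + 'n). if i = 0 then (\<Sum>l\<in>-S. w s (fst_part z) $ l * z $ Inr l)
      else G (fst_part z))"
    have ws: "(\<lambda>x. w s x $ l) \<in> polys_on UNIV" for l
      using fr s(2) by (auto simp: tangent_frame_def poly_field_def)
    have fstK: "(\<lambda>z. f (fst_part z)) \<in> polys_on (K \<union> range Inl)" if "f \<in> polys_on UNIV" for f
      using polys_on_fst[OF that] by (rule polys_on_mono) auto
    have "c i \<in> polys_on (K \<union> range Inl)" for i
    proof (cases "i = 0")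
      case True
      have "(\<lambda>z. \<Sum>l\<in>-S. w s (fst_part z) $ l * z $ Inr l) \<in> polys_on (K \<union> range Inl)"
        by (intro polys_on_sum polys_on_mult fstK[OF ws] polys_on_coord) (auto simp: K_def)
      then show ?thesis using True by (simp add: c_def)
    next
      case False
      then show ?thesis using fstK[of G] fr by (simp add: c_def tangent_frame_def)
    qed
    moreover have "(\<Sum>i\<le>1. c i z * z $ k ^ i) = 0" if z: "z \<in> conormal V" for z
    proof -
      have "0 = bform (snd_part z) (w s (fst_part z))"
        using conormal_frame[OF fr z s(2)] by simp
      also have "\<dots> = (\<Sum>l\<in>UNIV. w s (fst_part z) $ l * z $ Inr l)"
        by (simp add: bform_def mult.commute)
      also have "\<dots> = (\<Sum>l\<in>S. w s (fst_part z) $ l * z $ Inr l) + (\<Sum>l\<in>-S. w s (fst_part z) $ l * z $ Inr l)"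
        using sum.union_disjoint[of S "- S" "\<lambda>l. w s (fst_part z) $ l * z $ Inr l"] by simp
      also have "(\<Sum>l\<in>S. w s (fst_part z) $ l * z $ Inr l) =
          (\<Sum>l\<in>S. if l = s then G (fst_part z) * z $ Inr s else 0)"
        using fr s(2) by (intro sum.cong) (auto simp: tangent_frame_def)
      finally show ?thesis
        using s by (simp add: c_def add.commute)
    qed
    moreover have "\<exists>z\<in>conormal V. c 1 z \<noteq> 0"
    proof -
      obtain x0 where "x0 \<in> V" "G x0 \<noteq> 0"
        using fr by (auto simp: tangent_frame_def)
      then show ?thesis
        by (intro bexI[of _ "vpair x0 0"] conormal_zero) (auto simp: c_def)
    qed
    ultimately show "algebraic_over (conormal V) (K \<union> range Inl) k"
      unfolding algebraic_over_def by (intro exI[of _ 1] exI[of _ c] conjI allI ballI)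
  qed
  then show ?thesis by simp
qed

text \<open>
  Where \<open>G\<close> does not vanish, the \<open>y\<^sub>j\<close> with \<open>j\<close> outside \<open>S\<close> can be prescribed, and the equations of
  orthogonality to the frame are then solved by the remaining \<open>y\<^sub>s\<close>.
\<close>

lemma conormal_independent:
  fixes V :: "(complex ^ 'n::finite) set"
  assumes V: "prime_set V"
  shows "\<exists>K. independent_on (conormal V) K \<and> card K = CARD('n)"
proof -
  obtain S G w where S: "transcendence_basis V S" and fr: "tangent_frame V S G w"
    by (rule prime_set_frame[OF V])
  define K where "K = Inl ` S \<union> Inr ` (- S)"
  have "card K = CARD('n)"
    unfolding K_def by (rule card_base_fibre_coords)
  moreover have "independent_on (conormal V) K"
    unfolding independent_on_def
  proof (intro ballI impI allI)
    fix f and z :: "complex ^ ('n + 'n)"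
    assume f: "f \<in> polys_on K" "\<forall>z\<in>conormal V. f z = 0"
    define b where "b = snd_part z"
    define h where "h = (\<lambda>x. f (vpair x b))"
    have h: "h \<in> polys_on S"
      unfolding h_def using f(1) by (rule polys_on_compose) (auto simp: K_def)
    have "h x = 0" if x: "x \<in> V" "G x \<noteq> 0" for x
    proof -
      \<comment> \<open>The solution of these equations with the prescribed components \<open>b\<close>.\<close>
      define y where "y = (\<chi> j. if j \<in> S then - (\<Sum>l\<in>-S. b $ l * w j x $ l) / G x else b $ j)"
      have "bform y (w s x) = 0" if s: "s \<in> S" for s
      proof -
        have "bform y (w s x) = (\<Sum>l\<in>S. y $ l * w s x $ l) + (\<Sum>l\<in>-S. y $ l * w s x $ l)"
          using sum.union_disjoint[of S "- S" "\<lambda>l. y $ l * w s x $ l"] by (simp add: bform_def)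
        also have "(\<Sum>l\<in>S. y $ l * w s x $ l) = (\<Sum>l\<in>S. if l = s then y $ s * G x else 0)"
          using fr s by (intro sum.cong) (auto simp: tangent_frame_def)
        also have "\<dots> = - (\<Sum>l\<in>-S. b $ l * w s x $ l)"
          using s x(2) by (simp add: y_def)
        also have "(\<Sum>l\<in>-S. y $ l * w s x $ l) = (\<Sum>l\<in>-S. b $ l * w s x $ l)"
          by (intro sum.cong) (auto simp: y_def)
        finally show ?thesis by simp
      qed
      then have "vpair x y \<in> conormal V"
        using perp_tangent_frame[OF fr x] x(1) by (simp add: conormal_def)
      then have "f (vpair x y) = 0"
        using f(2) by blast
      moreover have "f (vpair x y) = f (vpair x b)"
        by (rule polys_on_cong[OF f(1)]) (auto simp: K_def y_def)
      ultimately show ?thesis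
        by (simp add: h_def)
    qed
    then have "G x * h x = 0" if "x \<in> V" for x
      using that by auto
    moreover obtain x0 where "x0 \<in> V" "G x0 \<noteq> 0"
      using fr by (auto simp: tangent_frame_def)
    moreover have "G \<in> polys_on UNIV"
      using fr by (simp add: tangent_frame_def)
    ultimately have "h x = 0" if "x \<in> V" for x
      using prime_setD[OF V _ h] that by blast
    then have "h (fst_part z) = 0"
      using S h by (auto simp: transcendence_basis_def independent_on_def)
    then show "f z = 0"
      by (simp add: h_def b_def)
  qed
  ultimately show ?thesis by blast
qed

section \<open>Biduality\<close>

text \<open>
  The dual variety is the closure of the second projection of the conormal variety. Its definition uses
  only nonsingular points, but those with \<open>G x \<noteq> 0\<close> already suffice to test a polynomial on the
  irreducible conormal variety.
\<close>

lemma vanishing_on_dual_iff: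
  fixes V :: "(complex ^ 'n::finite) set"
  assumes V: "irreducible_variety V" and g: "g \<in> polys_on UNIV"
  shows "(\<forall>y\<in>dual_variety V. g y = 0) \<longleftrightarrow> (\<forall>z\<in>conormal V. g (snd_part z) = 0)"
    and "z \<in> conormal V \<Longrightarrow> snd_part z \<in> dual_variety V"
proof -
  define Y where "Y = {y. \<exists>x\<in>V - singular_locus V. perp y (tangent_space V x)}"
  have dual: "dual_variety V = zeros (vanishing_ideal Y)"
    by (simp add: dual_variety_def zariski_closure_def Y_def)
  have pV: "prime_set V"
    using V by (rule irreducible_imp_prime_set)
  note N = conormal_prime[OF pV]
  obtain S G w where S: "transcendence_basis V S" and fr: "tangent_frame V S G w"
    by (rule prime_set_frame[OF pV])
  have G: "G \<in> polys_on UNIV"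
    using fr by (simp add: tangent_frame_def)
  obtain x0 where x0: "x0 \<in> V" "G x0 \<noteq> 0"
    using fr by (auto simp: tangent_frame_def)
  have van: "h (snd_part z) = 0" if h: "h \<in> polys_on UNIV" "\<And>y. y \<in> Y \<Longrightarrow> h y = 0" and z: "z \<in> conormal V" for h z
  proof (rule prime_setD[OF N polys_on_fst_UNIV[OF G] polys_on_snd_UNIV[OF h(1)] _ conormal_zero[OF x0(1)] _ z])
    show "G (fst_part (vpair x0 0)) \<noteq> 0"
      using x0 by simp
    fix z assume z: "z \<in> conormal V"
    show "G (fst_part z) * h (snd_part z) = 0"
    proof (cases "G (fst_part z) = 0")
      case False
      then have "fst_part z \<notin> singular_locus V"
        using generic_nonsingular[OF V S fr] z by (simp add: conormal_def)
      then have "snd_part z \<in> Y"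
        using z by (auto simp: Y_def conormal_def)
      then show ?thesis
        using h(2) by simp
    qed simp
  qed
  show dualI: "snd_part z \<in> dual_variety V" if "z \<in> conormal V" for z
    using van that by (auto simp: dual zeros_def vanishing_ideal_def polys_UNIV)
  show "(\<forall>y\<in>dual_variety V. g y = 0) \<longleftrightarrow> (\<forall>z\<in>conormal V. g (snd_part z) = 0)"
  proof
    assume R: "\<forall>z\<in>conormal V. g (snd_part z) = 0"
    have "g y = 0" if yY: "y \<in> Y" for y
    proof -
      obtain x where "x \<in> V" "perp y (tangent_space V x)"
        using yY by (auto simp: Y_def)
      then have "vpair x y \<in> conormal V"
        by (simp add: conormal_def)
      then show ?thesis
        using R by fastforce
    qed
    then have "g \<in> vanishing_ideal Y"
      using g by (simp add: vanishing_ideal_def polys_UNIV)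
    then show "\<forall>y\<in>dual_variety V. g y = 0"
      by (auto simp: dual zeros_def)
  qed (use dualI in auto)
qed

lemma dual_variety_irreducible:
  fixes V :: "(complex ^ 'n::finite) set"
  assumes V: "irreducible_variety V"
  shows "irreducible_variety (dual_variety V)"
proof (rule prime_set_imp_irreducible)
  have "vanishing_ideal Y \<subseteq> polys UNIV" for Y :: "(complex ^ 'n) set"
    by (auto simp: vanishing_ideal_def)
  then show "zariski_closed (dual_variety V)"
    unfolding dual_variety_def zariski_closure_def zariski_closed_def by blast
  note N = conormal_prime[OF irreducible_imp_prime_set[OF V]]
  then obtain z where "z \<in> conormal V"
    by (auto simp: prime_set_def)
  then have "dual_variety V \<noteq> {}"
    using vanishing_on_dual_iff(2)[OF V, of "\<lambda>_. 0" z] by auto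
  moreover have "(\<forall>y\<in>dual_variety V. f y = 0) \<or> (\<forall>y\<in>dual_variety V. g y = 0)"
    if f: "f \<in> polys_on UNIV" and g: "g \<in> polys_on UNIV" and "\<forall>y\<in>dual_variety V. f y * g y = 0" for f g
  proof -
    have "\<forall>z\<in>conormal V. f (snd_part z) * g (snd_part z) = 0"
      using that(3) unfolding vanishing_on_dual_iff(1)[OF V polys_on_mult[OF f g]] .
    then show ?thesis
      unfolding vanishing_on_dual_iff(1)[OF V f] vanishing_on_dual_iff(1)[OF V g]
      using prime_setD[OF N polys_on_snd_UNIV[OF f] polys_on_snd_UNIV[OF g]] by blast
  qed
  ultimately show "prime_set (dual_variety V)"
    by (auto simp: prime_set_def)
qed

text \<open>
  Euler's relation, in the form that a cone contains the line through each of its points and the origin.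
\<close>

lemma cone_euler:
  assumes V: "affine_cone V" and x: "x \<in> V"
  shows "x \<in> tangent_space V x"
  unfolding tangent_space_def
proof (intro CollectI ballI)
  fix f assume "f \<in> vanishing_ideal V"
  then have f: "f \<in> polys_on UNIV" "\<And>y. y \<in> V \<Longrightarrow> f y = 0"
    by (auto simp: vanishing_ideal_def polys_UNIV)
  have "x + t *s x \<in> V" for t
  proof -
    have "x + t *s x = (1 + t) *s x"
      by (simp add: vec_eq_iff algebra_simps)
    then show ?thesis using V x unfolding affine_cone_def by metis
  qed
  then have "(\<lambda>t. f (x + t *s x)) = (\<lambda>t. 0)"
    using f(2) by auto
  then show "bform (gradient f x) x = 0"
    using directional_derivative[OF f(1), of x x] by (metis DERIV_const DERIV_unique)
qed

lemma cone_conormal_orthogonal: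
  assumes "affine_cone V" "z \<in> conormal V"
  shows "bform (fst_part z) (snd_part z) = 0"
  using assms cone_euler[OF assms(1), of "fst_part z"] by (auto simp: conormal_def perp_def bform_commute)

lemma gradient_pairing:
  fixes z :: "complex ^ ('n::finite + 'n)"
  shows "gradient (\<lambda>z. bform (fst_part z) (snd_part z)) z = vpair (snd_part z) (fst_part z)"
proof -
  have 1: "gradient (\<lambda>z :: complex ^ ('n + 'n). z $ Inl i * z $ Inr i) z =
      z $ Inr i *s axis (Inl i) 1 + z $ Inl i *s axis (Inr i) 1" for i and z :: "complex ^ ('n + 'n)"
    by (subst gradient_mult[where K = UNIV and L = UNIV]) (auto simp: gradient_coord)
  have "gradient (\<lambda>z. \<Sum>i\<in>UNIV. z $ Inl i * z $ Inr i) z =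
      (\<Sum>i\<in>UNIV. gradient (\<lambda>z :: complex ^ ('n + 'n). z $ Inl i * z $ Inr i) z)" for z :: "complex ^ ('n + 'n)"
    by (rule gradient_sum[where K = UNIV]) auto
  then have 2: "gradient (\<lambda>z. bform (fst_part z) (snd_part z)) z =
      (\<Sum>i\<in>UNIV. z $ Inr i *s axis (Inl i) 1 + z $ Inl i *s axis (Inr i) 1)" for z :: "complex ^ ('n + 'n)"
    by (simp add: bform_def 1)
  have "gradient (\<lambda>z. bform (fst_part z) (snd_part z)) z $ k = vpair (snd_part z) (fst_part z) $ k"
    for k and z :: "complex ^ ('n + 'n)"
    unfolding 2 by (cases k)
      (auto simp: axis_def if_distrib[of "\<lambda>z. _ * z"] cong: if_cong)
  then show ?thesis by (simp add: vec_eq_iff)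
qed

text \<open>
  The heart of biduality. A vector field \<open>w\<close> on the dual variety lifts to a field \<open>(\<xi>, g w)\<close> tangent to the conormal
  variety, since fields extend along projections. On the conormal variety \<open>x \<cdot> y = 0\<close> by Euler's relation, so
  along the lifted field \<open>\<xi> \<cdot> y + g (x \<cdot> w) = 0\<close>. But \<open>\<xi>\<close> is tangent to \<open>V\<close> and \<open>y\<close> is conormal, so \<open>\<xi> \<cdot> y = 0\<close>.
\<close>

lemma conormal_perp_dual_field:
  fixes V :: "(complex ^ 'n::finite) set"
  assumes V: "irreducible_variety V" and cone: "affine_cone V"
    and w: "poly_field w" "tangent_field (dual_variety V) UNIV w" and z: "z \<in> conormal V"
  shows "bform (fst_part z) (w (snd_part z)) = 0"
proof -
  note N = conormal_prime[OF irreducible_imp_prime_set[OF V]]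
  define \<eta> where "\<eta> = (\<lambda>z. vpair 0 (w (snd_part z)))"
  have "poly_field \<eta>"
    unfolding poly_field_def
  proof
    fix k :: "'n + 'n"
    have "(\<lambda>x. w x $ i) \<in> polys_on UNIV" for i
      using w(1) by (simp add: poly_field_def)
    then show "(\<lambda>z. \<eta> z $ k) \<in> polys_on UNIV"
      by (cases k) (auto simp: \<eta>_def)
  qed
  moreover have "tangent_field (conormal V) (range Inr) \<eta>"
    unfolding tangent_field_def
  proof (intro ballI impI)
    fix f z assume f: "f \<in> polys_on (range Inr)" "\<forall>z\<in>conormal V. f z = 0" and z: "z \<in> conormal V"
    define g where "g = (\<lambda>y. f (vpair 0 y))"
    have g: "g \<in> polys_on UNIV"
      unfolding g_def using f(1) by (rule polys_on_compose) auto
    have fg: "f = (\<lambda>z. g (snd_part z))"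
      unfolding g_def by (intro ext polys_on_cong[OF f(1)]) auto
    have "\<forall>y\<in>dual_variety V. g y = 0"
      unfolding vanishing_on_dual_iff(1)[OF V g] using f(2) by (simp add: fg)
    then have "bform (gradient g (snd_part z)) (w (snd_part z)) = 0"
      using w(2) g vanishing_on_dual_iff(2)[OF V g z] by (auto simp: tangent_field_def)
    then show "bform (gradient f z) (\<eta> z) = 0"
      unfolding fg gradient_snd by (simp add: bform_parts \<eta>_def)
  qed
  ultimately obtain g \<omega> where g: "g \<in> polys_on UNIV" "\<exists>z\<in>conormal V. g z \<noteq> 0"
    and \<omega>: "\<forall>i\<in>range Inr. \<forall>z. \<omega> z $ i = g z * \<eta> z $ i" "tangent_field (conormal V) UNIV \<omega>"
    using tangent_field_extend[OF N, of \<eta> "range Inr"] by (metis (no_types, lifting))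
  have snd\<omega>: "snd_part (\<omega> z) = g z *s w (snd_part z)" for z
    using \<omega>(1) by (simp add: vec_eq_iff \<eta>_def)
  have "g z * bform (fst_part z) (w (snd_part z)) = 0" if z: "z \<in> conormal V" for z
  proof -
    have "fst_part (\<omega> z) \<in> tangent_space V (fst_part z)"
      unfolding tangent_space_def
    proof (intro CollectI ballI)
      fix f assume "f \<in> vanishing_ideal V"
      then have "(\<lambda>z. f (fst_part z)) \<in> polys_on UNIV" "\<forall>z\<in>conormal V. f (fst_part z) = 0"
        by (auto simp: vanishing_ideal_def polys_UNIV conormal_def)
      then have "bform (gradient (\<lambda>z. f (fst_part z)) z) (\<omega> z) = 0"
        using \<omega>(2) z by (auto simp: tangent_field_def)
      then show "bform (gradient f (fst_part z)) (fst_part (\<omega> z)) = 0"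
        by (simp add: gradient_fst bform_parts)
    qed
    then have 1: "bform (snd_part z) (fst_part (\<omega> z)) = 0"
      using z by (auto simp: conormal_def perp_def)
    have "(\<lambda>z :: complex ^ ('n + 'n). bform (fst_part z) (snd_part z)) \<in> polys_on UNIV"
      by (intro polys_on_bform) (auto simp: poly_field_def)
    then have "bform (gradient (\<lambda>z. bform (fst_part z) (snd_part z)) z) (\<omega> z) = 0"
      using \<omega>(2) z cone_conormal_orthogonal[OF cone] by (auto simp: tangent_field_def)
    then show ?thesis
      using 1 by (simp add: gradient_pairing bform_parts snd\<omega> bform_linear)
  qed
  moreover have "(\<lambda>z. bform (fst_part z) (w (snd_part z))) \<in> polys_on UNIV"
  proof (rule polys_on_bform)
    show "poly_field (fst_part :: complex ^ ('n + 'n) \<Rightarrow> _)"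
      by (auto simp: poly_field_def)
    have "(\<lambda>x. w x $ i) \<in> polys_on UNIV" for i
      using w(1) by (simp add: poly_field_def)
    then show "poly_field (\<lambda>z. w (snd_part z))"
      by (auto simp: poly_field_def)
  qed
  moreover obtain z0 where "z0 \<in> conormal V" "g z0 \<noteq> 0"
    using g by blast
  ultimately show ?thesis
    using prime_setD[OF N g(1)] z by blast
qed

definition swap :: "complex ^ ('n::finite + 'n) \<Rightarrow> complex ^ ('n + 'n)" where
  "swap z = vpair (snd_part z) (fst_part z)"

lemma swap_simps [simp]: "fst_part (swap z) = snd_part z" "snd_part (swap z) = fst_part z" "swap (swap z) = z"
  by (simp_all add: swap_def)

definition swap_index :: "'n + 'n \<Rightarrow> 'n + 'n" where
  "swap_index k = (case k of Inl i \<Rightarrow> Inr i | Inr i \<Rightarrow> Inl i)"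

lemma swap_index_swap_index [simp]: "swap_index (swap_index k) = k"
  by (cases k) (simp_all add: swap_index_def)

lemma inj_swap_index: "inj swap_index"
  by (metis injI swap_index_swap_index)

lemma polys_on_swap:
  assumes "f \<in> polys_on K"
  shows "(\<lambda>z. f (swap z)) \<in> polys_on (swap_index ` K)"
  using assms
proof (rule polys_on_compose)
  fix k assume "k \<in> K"
  then show "(\<lambda>z. swap z $ k) \<in> polys_on (swap_index ` K)"
    by (cases k) (auto simp: swap_def swap_index_def image_iff intro!: polys_on_coord bexI[of _ k])
qed

text \<open>
  The conormal varieties of \<open>V\<close> and of its dual are exchanged by swapping, up to closure. One inclusion
  follows from \<open>conormal_perp_dual_field\<close>, since at general points of the dual the tangent space is spanned by a
  frame. As both sides are irreducible of dimension \<open>n\<close>, they have the same vanishing ideal.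
\<close>

theorem biduality:
  fixes V :: "(complex ^ 'n::finite) set"
  assumes V: "irreducible_variety V" and cone: "affine_cone V" and F: "F \<in> polys_on UNIV"
  shows "(\<forall>z\<in>conormal (dual_variety V). F z = 0) \<longleftrightarrow> (\<forall>z\<in>conormal V. F (swap z) = 0)"
proof -
  let ?W = "dual_variety V"
  note pV = irreducible_imp_prime_set[OF V]
  note pW = irreducible_imp_prime_set[OF dual_variety_irreducible[OF V]]
  note N = conormal_prime[OF pV] and N' = conormal_prime[OF pW]
  obtain S G w where S: "transcendence_basis ?W S" and fr: "tangent_frame ?W S G w"
    by (rule prime_set_frame[OF pW])
  have G: "G \<in> polys_on UNIV"
    using fr by (simp add: tangent_frame_def)
  obtain y0 where "y0 \<in> ?W" "G y0 \<noteq> 0"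
    using fr by (auto simp: tangent_frame_def)
  then obtain z0 where z0: "z0 \<in> conormal V" "G (snd_part z0) \<noteq> 0"
    using vanishing_on_dual_iff(1)[OF V G] by blast
  have swapU: "(\<lambda>z. f (swap z)) \<in> polys_on UNIV" if "f \<in> polys_on UNIV" for f :: "complex ^ ('n + 'n) \<Rightarrow> complex"
    using polys_on_swap[OF that] by (rule polys_on_mono) auto
  have sub: "f (swap z) = 0" if f: "f \<in> polys_on UNIV" "\<And>z. z \<in> conormal ?W \<Longrightarrow> f z = 0" and z: "z \<in> conormal V" for f z
  proof (rule prime_setD[OF N polys_on_snd_UNIV[OF G] swapU[OF f(1)] _ z0 z])
    fix z assume z: "z \<in> conormal V"
    show "G (snd_part z) * f (swap z) = 0"
    proof (cases "G (snd_part z) = 0")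
      case False
      have y: "snd_part z \<in> ?W"
        using vanishing_on_dual_iff(2)[OF V G z] .
      have "perp (fst_part z) (tangent_space ?W (snd_part z))"
        using fr by (intro perp_tangent_frame[OF fr y False] conormal_perp_dual_field[OF V cone _ _ z])
          (auto simp: tangent_frame_def)
      then have "swap z \<in> conormal ?W"
        using y by (simp add: conormal_def)
      then show ?thesis
        using f(2) by simp
    qed simp
  qed
  have "F z = 0" if R: "\<forall>z\<in>conormal V. F (swap z) = 0" and z: "z \<in> conormal ?W" for z
  proof (rule ccontr)
    assume Fz: "F z \<noteq> 0"
    obtain K where K: "independent_on (conormal V) K" "card K = CARD('n)"
      using conormal_independent[OF pV] by blast
    have "card (swap_index ` K) < CARD('n)"
    proof (rule independent_card_less[OF N' conormal_growth[OF pW] _ F _ z Fz])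
      show "independent_on (swap ` conormal V) (swap_index ` K)"
        unfolding independent_on_def
      proof (intro ballI impI allI)
        fix f x assume f: "f \<in> polys_on (swap_index ` K)" "\<forall>x\<in>swap ` conormal V. f x = 0"
        have "(\<lambda>z. f (swap z)) \<in> polys_on (swap_index ` swap_index ` K)"
          using polys_on_swap[OF f(1)] .
        then have "(\<lambda>z. f (swap z)) \<in> polys_on K"
          by (simp add: image_image)
        from K(1)[unfolded independent_on_def, THEN bspec, OF this]
        have "\<forall>x. f (swap x) = 0"
          using f(2) by simp
        then have "f (swap (swap x)) = 0"
          by blast
        then show "f x = 0" by simp
      qed
      show "f x = 0" if f: "f \<in> polys_on UNIV" "\<And>x. x \<in> conormal ?W \<Longrightarrow> f x = 0"
        and x: "x \<in> swap ` conormal V" for f x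
      proof -
        obtain z where "z \<in> conormal V" "x = swap z"
          using x by blast
        then show ?thesis
          using sub[OF f] by simp
      qed
      show "F x = 0" if "x \<in> swap ` conormal V" for x
        using R that by blast
    qed
    then show False
      using K(2) by (simp add: card_image inj_on_subset[OF inj_swap_index])
  qed
  then show ?thesis
    using sub[OF F] by blast
qed

section \<open>Critical points for general data\<close>

text \<open>
  For a variety \<open>N\<close> of pairs of dimension at most \<open>n\<close>, the sums of the pairs in a proper closed subset lie in a
  hypersurface: they cannot be general.
\<close>

lemma general_sum_avoids:
  fixes N :: "(complex ^ ('n::finite + 'n)) set"
  assumes N: "prime_set N" "growth N UNIV CARD('n)" and f: "f \<in> polys_on UNIV" "z0 \<in> N" "f z0 \<noteq> 0"
  shows "\<exists>Q\<in>polys_on UNIV. (\<exists>u. Q u \<noteq> 0) \<and> (\<forall>z\<in>N. f z = 0 \<longrightarrow> Q (fst_part z + snd_part z) = 0)"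
proof -
  have "\<exists>Q\<in>polys_on UNIV. \<exists>R\<in>polys_on UNIV. (\<exists>u. Q u \<noteq> 0) \<and>
      (\<forall>z\<in>N. Q (fst_part z + snd_part z) + f z * R z = 0)"
    by (rule algebraic_relation[OF N _ _ f]) auto
  then obtain Q R where Q: "Q \<in> polys_on UNIV" "\<exists>u. Q u \<noteq> 0"
    and QR: "\<forall>z\<in>N. Q (fst_part z + snd_part z) + f z * R z = 0"
    by blast
  have "Q (fst_part z + snd_part z) = 0" if "z \<in> N" "f z = 0" for z
    using QR that by fastforce
  then show ?thesis
    using Q by blast
qed

text \<open>
  A critical point \<open>x\<close> for \<open>u\<close> is the same as a conormal pair \<open>(x, u - x)\<close> over a nonsingular point. By
  biduality the swapped pair satisfies the polynomial conditions for a conormal pair of the dual, which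
  are sufficient unless the denominator \<open>G'\<close> of the frame vanishes at \<open>u - x\<close>. That excludes a proper closed
  subset of the conormal variety, hence only special \<open>u\<close>. The converse is the same argument with
  both varieties exchanged.
\<close>

lemma general_critical_points_dual:
  fixes V :: "(complex ^ 'n::finite) set"
  assumes V: "irreducible_variety V" and cone: "affine_cone V"
  shows "\<exists>Q\<in>polys_on UNIV. (\<exists>u. Q u \<noteq> 0) \<and> (\<forall>u. Q u \<noteq> 0 \<longrightarrow>
    (\<forall>x\<in>critical_points V u. u - x \<in> critical_points (dual_variety V) u) \<and>
    (\<forall>y\<in>critical_points (dual_variety V) u. u - y \<in> critical_points V u))"
proof -
  let ?W = "dual_variety V"
  note W = dual_variety_irreducible[OF V]
  note pV = irreducible_imp_prime_set[OF V] and pW = irreducible_imp_prime_set[OF W]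
  note N = conormal_prime[OF pV] and N' = conormal_prime[OF pW]
  obtain S G w where S: "transcendence_basis V S" and fr: "tangent_frame V S G w"
    by (rule prime_set_frame[OF pV])
  obtain S' G' w' where S': "transcendence_basis ?W S'" and fr': "tangent_frame ?W S' G' w'"
    by (rule prime_set_frame[OF pW])
  have G: "G \<in> polys_on UNIV" and G': "G' \<in> polys_on UNIV"
    using fr fr' by (auto simp: tangent_frame_def)
  obtain x0 where x0: "x0 \<in> V" "G x0 \<noteq> 0"
    using fr by (auto simp: tangent_frame_def)
  obtain y0 where "y0 \<in> ?W" "G' y0 \<noteq> 0"
    using fr' by (auto simp: tangent_frame_def)
  then obtain z0 where z0: "z0 \<in> conormal V" "G' (snd_part z0) \<noteq> 0"
    using vanishing_on_dual_iff(1)[OF V G'] by blast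
  obtain z1 where z1: "z1 \<in> conormal ?W" "G (snd_part z1) \<noteq> 0"
    using biduality[OF V cone polys_on_snd_UNIV[OF G]] x0 conormal_zero[OF x0(1)] by fastforce
  obtain Q where Q: "Q \<in> polys_on UNIV" "\<exists>u. Q u \<noteq> 0"
    "\<And>z. z \<in> conormal V \<Longrightarrow> G' (snd_part z) = 0 \<Longrightarrow> Q (fst_part z + snd_part z) = 0"
    using general_sum_avoids[OF N conormal_growth[OF pV] polys_on_snd_UNIV[OF G'] z0] by blast
  obtain Q' where Q': "Q' \<in> polys_on UNIV" "\<exists>u. Q' u \<noteq> 0"
    "\<And>z. z \<in> conormal ?W \<Longrightarrow> G (snd_part z) = 0 \<Longrightarrow> Q' (fst_part z + snd_part z) = 0"
    using general_sum_avoids[OF N' conormal_growth[OF pW] polys_on_snd_UNIV[OF G] z1] by blast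
  have forward: "u - x \<in> critical_points ?W u" if u: "Q u \<noteq> 0" and x: "x \<in> critical_points V u" for u x
  proof -
    define z where "z = vpair x (u - x)"
    have z: "z \<in> conormal V"
      using x by (simp add: z_def conormal_def critical_points_def)
    then have y: "u - x \<in> ?W"
      using vanishing_on_dual_iff(2)[OF V G z] by (simp add: z_def)
    have "G' (u - x) \<noteq> 0"
      using Q(3)[OF z] u by (auto simp: z_def)
    moreover from this have "perp x (tangent_space ?W (u - x))"
      using conormal_perp_dual_field[OF V cone _ _ z] fr'
      by (intro perp_tangent_frame[OF fr' y]) (auto simp: tangent_frame_def z_def)
    ultimately show ?thesis
      using generic_nonsingular[OF W S' fr' y] y by (simp add: critical_points_def)
  qed
  have backward: "u - y \<in> critical_points V u" if u: "Q' u \<noteq> 0" and y: "y \<in> critical_points ?W u" for u y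
  proof -
    define z where "z = vpair y (u - y)"
    have z: "z \<in> conormal ?W"
      using y by (simp add: z_def conormal_def critical_points_def)
    have "f (snd_part z) = 0" if f: "f \<in> vanishing_ideal V" for f
      using biduality[OF V cone, of "\<lambda>z. f (snd_part z)"] f z
      by (auto simp: vanishing_ideal_def polys_UNIV conormal_def)
    then have x: "u - y \<in> V"
      using V zeros_vanishing_ideal[of V] by (auto simp: irreducible_variety_def zeros_def z_def)
    have ws: "bform y (w s (u - y)) = 0" if s: "s \<in> S" for s
    proof -
      have "poly_field (w s)"
        using fr s by (simp add: tangent_frame_def)
      then have "(\<lambda>z. bform (fst_part z) (w s (snd_part z))) \<in> polys_on UNIV"
        by (intro polys_on_bform) (auto simp: poly_field_def)
      then have "bform (fst_part z) (w s (snd_part z)) = 0"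
        using biduality[OF V cone] conormal_frame[OF fr _ s] z by (fastforce)
      then show ?thesis by (simp add: z_def)
    qed
    have "G (u - y) \<noteq> 0"
      using Q'(3)[OF z] u by (auto simp: z_def)
    moreover from this have "perp y (tangent_space V (u - y))"
      using ws by (intro perp_tangent_frame[OF fr x]) auto
    ultimately show ?thesis
      using generic_nonsingular[OF V S fr x] x by (simp add: critical_points_def)
  qed
  have "\<exists>u. Q u * Q' u \<noteq> 0"
    using polys_no_zero_divisors[OF Q(1) Q'(1)] Q(2) Q'(2) by auto
  then show ?thesis
    using Q(1) Q'(1) forward backward by (intro bexI[of _ "\<lambda>u. Q u * Q' u"]) auto
qed

text \<open>
  A nonempty open set contains the complement of a hypersurface, so a single polynomial \<open>Q\<close> can describe
  what general means.
\<close>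

lemma for_generalI:
  assumes "Q \<in> polys_on UNIV" "Q u \<noteq> 0" "\<And>u. Q u \<noteq> 0 \<Longrightarrow> P u"
  shows "for_general P"
  unfolding for_general_def
proof (intro exI[of _ "{u. Q u \<noteq> 0}"] conjI)
  have "- {u. Q u \<noteq> 0} = zeros {Q}"
    by (auto simp: zeros_def)
  then show "zariski_open {u. Q u \<noteq> 0}"
    unfolding zariski_open_def zariski_closed_def using assms(1)
    by (intro exI[of _ "{Q}"]) (auto simp: polys_UNIV)
qed (use assms in auto)

lemma for_generalD:
  assumes "for_general P"
  shows "\<exists>Q\<in>polys_on UNIV. (\<exists>u. Q u \<noteq> 0) \<and> (\<forall>u. Q u \<noteq> 0 \<longrightarrow> P u)"
proof -
  obtain U u where U: "zariski_open U" "u \<in> U" "\<And>u. u \<in> U \<Longrightarrow> P u"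
    using assms by (auto simp: for_general_def)
  then obtain Q where "Q \<in> polys_on UNIV" "Q u \<noteq> 0" "\<forall>v\<in>-U. Q v = 0"
    using zariski_closed_separates[of "- U" u] by (auto simp: zariski_open_def)
  then show ?thesis
    using U(3) by blast
qed

lemma for_general_mp:
  assumes "for_general (\<lambda>u. P u \<longrightarrow> R u)" "for_general P"
  shows "for_general R"
proof -
  obtain Q u where Q: "Q \<in> polys_on UNIV" "Q u \<noteq> 0" "\<And>u. Q u \<noteq> 0 \<Longrightarrow> P u \<longrightarrow> R u"
    using for_generalD[OF assms(1)] by blast
  obtain Q' u' where Q': "Q' \<in> polys_on UNIV" "Q' u' \<noteq> 0" "\<And>u. Q' u \<noteq> 0 \<Longrightarrow> P u"
    using for_generalD[OF assms(2)] by blast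
  obtain v where "Q v * Q' v \<noteq> 0"
    using polys_no_zero_divisors[OF Q(1) Q'(1) Q(2) Q'(2)] by auto
  then show ?thesis
    by (rule for_generalI[rotated]) (use Q Q' in auto)
qed

lemma for_general_mono: "for_general P \<Longrightarrow> (\<And>u. P u \<Longrightarrow> R u) \<Longrightarrow> for_general R"
  by (meson for_general_def)

text \<open>
  Two conditions that hold for general data hold simultaneously for general data. Hence the descriptions
  of the two degrees are satisfied by the same numbers.
\<close>

lemma EDdegree_cong:
  fixes X Y :: "(complex ^ 'n::finite) set"
  assumes "for_general (\<lambda>u. \<exists>h. bij_betw h (critical_points X u) (critical_points Y u))"
  shows "EDdegree X = EDdegree Y"
proof -
  have same: "finite (critical_points X u) \<and> card (critical_points X u) = N \<longleftrightarrow>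
      finite (critical_points Y u) \<and> card (critical_points Y u) = N"
    if "\<exists>h. bij_betw h (critical_points X u) (critical_points Y u)" for u N
    using that bij_betw_finite bij_betw_same_card by metis
  have "for_general (\<lambda>u. finite (critical_points X u) \<and> card (critical_points X u) = N) \<longleftrightarrow>
      for_general (\<lambda>u. finite (critical_points Y u) \<and> card (critical_points Y u) = N)" for N
  proof
    assume A: "for_general (\<lambda>u. finite (critical_points X u) \<and> card (critical_points X u) = N)"
    show "for_general (\<lambda>u. finite (critical_points Y u) \<and> card (critical_points Y u) = N)"
      by (rule for_general_mp[OF for_general_mono[OF assms] A]) (use same in blast)
  next
    assume A: "for_general (\<lambda>u. finite (critical_points Y u) \<and> card (critical_points Y u) = N)"
    show "for_general (\<lambda>u. finite (critical_points X u) \<and> card (critical_points X u) = N)"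
      by (rule for_general_mp[OF for_general_mono[OF assms] A]) (use same in blast)
  qed
  then show ?thesis
    by (simp add: EDdegree_def)
qed

section \<open>Real data\<close>

lemma complexify_line: "complexify (a + t *\<^sub>R b) = complexify a + of_real t *s complexify b"
  by (simp add: complexify_def vec_eq_iff)

lemma real_point_complexify: "real_point (complexify u)"
  by (simp add: real_point_def complexify_def)

lemma real_point_diff: "real_point u \<Longrightarrow> real_point x \<Longrightarrow> real_point (u - x)"
  by (simp add: real_point_def)

text \<open>
  As a function of \<open>t\<close>, the polynomial at \<open>Re u + t Im u\<close> is nonzero for \<open>t = \<i>\<close>, hence for all but
  finitely many real \<open>t\<close>.
\<close>

lemma nonzero_at_real_point:
  assumes Q: "Q \<in> polys_on UNIV" "Q u \<noteq> 0"
  shows "\<exists>r. Q (complexify r) \<noteq> 0"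
proof -
  define a b where "a = (\<chi> i. Re (u $ i))" and "b = (\<chi> i. Im (u $ i))"
  obtain q where q: "\<And>t. Q (complexify a + t *s complexify b) = poly q t"
    using poly_on_line[OF Q(1)] by metis
  have "u = complexify a + \<i> *s complexify b"
    by (simp add: vec_eq_iff a_def b_def complexify_def complex_eq[symmetric])
  then have "q \<noteq> 0"
    using q[of \<i>] Q(2) by auto
  then have "finite {t. poly q t = 0}"
    by (rule poly_roots_finite)
  moreover have "infinite (range complex_of_real)"
    using finite_imageD[of complex_of_real UNIV] infinite_UNIV_char_0[where 'a = real] by (auto simp: inj_on_def)
  ultimately obtain t where "poly q (complex_of_real t) \<noteq> 0"
    by (metis (mono_tags, lifting) finite_subset image_subset_iff mem_Collect_eq)
  then have "Q (complexify (a + t *\<^sub>R b)) \<noteq> 0"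
    by (simp add: complexify_line q)
  then show ?thesis by blast
qed

text \<open>
  Each line through a real point \<open>r0\<close> outside the zero set \<open>Z\<close> meets \<open>Z\<close> in finitely many points. By Fubini,
  for almost every \<open>t\<close> the image of \<open>Z\<close> under the dilation with centre \<open>r0\<close> and factor \<open>1 / t\<close> is a null set, and
  dilations preserve null sets.
\<close>

lemma AE_polynomial_nonzero:
  fixes Q :: "complex ^ 'n::finite \<Rightarrow> complex"
  assumes Q: "Q \<in> polys_on UNIV" "Q u \<noteq> 0"
  shows "AE r in lborel. Q (complexify r) \<noteq> 0"
proof -
  obtain r0 where r0: "Q (complexify r0) \<noteq> 0"
    using nonzero_at_real_point[OF Q] by blast
  define F where "F = (\<lambda>r :: real ^ 'n. Q (complexify r))"
  have cont: "continuous_on UNIV F"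
    unfolding F_def using Q(1)
    by (induction rule: polys_on_induct) (auto simp: complexify_def intro!: continuous_intros)
  then have meas [measurable]: "F \<in> borel_measurable borel"
    by (rule borel_measurable_continuous_onI)
  define h where "h = (\<lambda>(p :: real ^ 'n) (t :: real). (1 - t) *\<^sub>R r0 + t *\<^sub>R p)"
  have [measurable]: "(\<lambda>x. F (h (fst x) (snd x))) \<in> borel_measurable (borel \<Otimes>\<^sub>M borel)"
    unfolding h_def by measurable
  have "AE t in lborel. F (h p t) \<noteq> 0" for p
  proof -
    obtain q where q: "\<And>t. Q (complexify r0 + t *s complexify (p - r0)) = poly q t"
      using poly_on_line[OF Q(1)] by metis
    have hq: "F (h p t) = poly q (complex_of_real t)" for t
    proof -
      have "h p t = r0 + t *\<^sub>R (p - r0)"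
        by (simp add: h_def algebra_simps)
      then show ?thesis
        unfolding F_def by (simp add: complexify_line q)
    qed
    have "poly q 0 \<noteq> 0"
      using q[of 0] r0 by simp
    then have "finite {t. poly q t = 0}"
      by (intro poly_roots_finite) auto
    then have "finite (complex_of_real -` {t. poly q t = 0})"
      by (intro finite_vimageI) (auto simp: inj_on_def)
    then have "{t. F (h p t) = 0} \<in> null_sets lborel"
      unfolding hq vimage_def by (intro finite_imp_null_set_lborel) auto
    from AE_not_in[OF this] show ?thesis
      by simp
  qed
  then have "AE p in lborel. AE t in lborel. F (h p t) \<noteq> 0"
    by simp
  then have "AE t in lborel. AE p in lborel. F (h p t) \<noteq> 0"
    by (subst (asm) lborel_pair.AE_commute) measurable
  moreover have "AE t in lborel. (t :: real) \<noteq> 0"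
    using AE_lborel_singleton[of "0 :: real"] by simp
  ultimately have "AE t in lborel. (t :: real) \<noteq> 0 \<and> (AE p in lborel. F (h p t) \<noteq> 0)"
    by eventually_elim auto
  moreover have "ae_filter (lborel :: real measure) \<noteq> bot"
    by (simp add: ae_filter_eq_bot_iff)
  ultimately obtain t where t: "t \<noteq> 0" "AE p in lborel. F (h p t) \<noteq> 0"
    using eventually_happens' by blast
  have "AE r in lborel. F r \<noteq> 0"
    using t(2) by (subst lborel_affine[OF t(1), of "(1 - t) *\<^sub>R r0"])
      (simp add: AE_density AE_distr_iff h_def)
  then show ?thesis
    by (simp add: F_def)
qed

lemma real_point_norm:
  assumes "real_point z"
  shows "bform z z = of_real ((norm z)\<^sup>2)"
proof -
  have "z $ i * z $ i = of_real ((norm (z $ i))\<^sup>2)" for i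
  proof -
    obtain r where "z $ i = of_real r"
      using assms by (auto simp: real_point_def elim: Reals_cases)
    then show ?thesis by (simp add: power2_eq_square)
  qed
  then show ?thesis
    by (simp add: bform_def norm_vec_def L2_set_def sum_nonneg)
qed

text \<open>
  On a cone, \<open>x\<close> is itself tangent at \<open>x\<close>, so the conormal vector \<open>u - x\<close> is orthogonal to it. The distances of \<open>u\<close>
  to \<open>x\<close> and to \<open>u - x\<close> are the legs of a right triangle with hypotenuse \<open>u\<close>: when one grows, the other
  shrinks.
\<close>

lemma critical_pythagoras:
  assumes cone: "affine_cone V" and u: "real_point u" and x: "x \<in> real_critical_points V u"
  shows "(norm u)\<^sup>2 = (norm x)\<^sup>2 + (norm (u - x))\<^sup>2"
proof -
  have x': "real_point x" "x \<in> V" "perp (u - x) (tangent_space V x)"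
    using x by (auto simp: real_critical_points_def critical_points_def)
  have "bform (u - x) x = 0"
    using cone_euler[OF cone x'(2)] x'(3) by (simp add: perp_def)
  moreover have "bform u u = bform x x + bform (u - x) (u - x) + 2 * bform (u - x) x"
  proof -
    have "bform (x + (u - x)) (x + (u - x)) = bform x x + bform (u - x) (u - x) + 2 * bform (u - x) x"
      unfolding bform_linear using bform_commute[of x "u - x"] by simp
    then show ?thesis by simp
  qed
  ultimately have "complex_of_real ((norm u)\<^sup>2) = of_real ((norm x)\<^sup>2 + (norm (u - x))\<^sup>2)"
    using real_point_norm[OF u] real_point_norm[OF x'(1)] real_point_norm[OF real_point_diff[OF u x'(1)]]
    by simp
  then show ?thesis
    by (simp only: of_real_eq_iff)
qed

lemma critical_proximity_reversing:
  assumes cone: "affine_cone V" and u: "real_point u"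
    and x: "x \<in> real_critical_points V u" "x' \<in> real_critical_points V u" and lt: "dist u x < dist u x'"
  shows "dist u (u - x) > dist u (u - x')"
proof -
  have "(norm (u - x))\<^sup>2 < (norm (u - x'))\<^sup>2"
    using lt by (intro power_strict_mono) (auto simp: dist_norm)
  then have "(norm x')\<^sup>2 < (norm x)\<^sup>2"
    using critical_pythagoras[OF cone u x(1)] critical_pythagoras[OF cone u x(2)] by linarith
  then have "norm x' < norm x"
    by (rule power2_less_imp_less) simp
  then show ?thesis
    by (simp add: dist_norm)
qed

lemma emeasure_count_space_bij:
  assumes "bij_betw h A B"
  shows "emeasure (count_space UNIV) A = emeasure (count_space UNIV) B"
  using bij_betw_finite[OF assms] bij_betw_same_card[OF assms] by (auto simp: emeasure_count_space)

theorem theorem5p2: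
  fixes X Y :: "(complex ^ 'n::finite) set"
  assumes "irreducible_variety X"
    and "affine_cone X"
    and "defined_over_reals X"
    and "Y = dual_variety X"
  shows "for_general (\<lambda>u.
           bij_betw (\<lambda>x. u - x) (critical_points X u) (critical_points Y u) \<and>
           (real_point u \<longrightarrow>
              (\<forall>x \<in> real_critical_points X u. u - x \<in> real_critical_points Y u) \<and>
              (\<forall>x \<in> real_critical_points X u. \<forall>x' \<in> real_critical_points X u.
                 dist u x < dist u x' \<longrightarrow> dist u (u - x) > dist u (u - x')))) \<and>
         EDdegree X = EDdegree Y \<and>
         (\<forall>w :: real ^ 'n \<Rightarrow> real.
            w \<in> borel_measurable borel \<longrightarrow> (\<integral>\<^sup>+ u. ennreal \<bar>w u\<bar> \<partial>lborel) = 1 \<longrightarrow>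
            aEDdegree X w = aEDdegree Y w)"
proof -
  obtain Q u0 where Q: "Q \<in> polys_on UNIV" "Q u0 \<noteq> 0"
    and fwd: "\<And>u x. Q u \<noteq> 0 \<Longrightarrow> x \<in> critical_points X u \<Longrightarrow> u - x \<in> critical_points Y u"
    and bwd: "\<And>u y. Q u \<noteq> 0 \<Longrightarrow> y \<in> critical_points Y u \<Longrightarrow> u - y \<in> critical_points X u"
    using general_critical_points_dual[OF assms(1,2)] unfolding assms(4) by blast
  have bij: "bij_betw (\<lambda>x. u - x) (critical_points X u) (critical_points Y u)" if "Q u \<noteq> 0" for u
    using fwd[OF that] bwd[OF that] by (intro bij_betw_byWitness[where f' = "\<lambda>y. u - y"]) auto
  have real_bij: "bij_betw (\<lambda>x. u - x) (real_critical_points X u) (real_critical_points Y u)"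
    if "Q u \<noteq> 0" "real_point u" for u
    using fwd[OF that(1)] bwd[OF that(1)] real_point_diff[OF that(2)]
    by (intro bij_betw_byWitness[where f' = "\<lambda>y. u - y"]) (auto simp: real_critical_points_def)
  have "for_general (\<lambda>u.
           bij_betw (\<lambda>x. u - x) (critical_points X u) (critical_points Y u) \<and>
           (real_point u \<longrightarrow>
              (\<forall>x \<in> real_critical_points X u. u - x \<in> real_critical_points Y u) \<and>
              (\<forall>x \<in> real_critical_points X u. \<forall>x' \<in> real_critical_points X u.
                 dist u x < dist u x' \<longrightarrow> dist u (u - x) > dist u (u - x'))))"
    using bij bij_betwE[OF real_bij] critical_proximity_reversing[OF assms(2)]
    by (intro for_generalI[OF Q]) blast
  moreover have "EDdegree X = EDdegree Y"
    by (rule EDdegree_cong, rule for_generalI[OF Q]) (use bij in blast)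
  moreover have "aEDdegree X w = aEDdegree Y w" for w :: "real ^ 'n \<Rightarrow> real"
  proof -
    have "AE u in lborel. emeasure (count_space UNIV) (real_critical_points X (complexify u)) =
        emeasure (count_space UNIV) (real_critical_points Y (complexify u))"
      using AE_polynomial_nonzero[OF Q]
      by eventually_elim (rule emeasure_count_space_bij[OF real_bij[OF _ real_point_complexify]])
    then show ?thesis
      unfolding aEDdegree_def by (intro nn_integral_cong_AE) (auto elim: eventually_mono)
  qed
  ultimately show ?thesis by blast
qed

end
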